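(* Let $p$ be a prime and let $(r_n)_{n\ge 1}$ be a sequence of positive integers such that $\lim_{n\to\infty} r_n=+\infty$ and $\lim_{n\to\infty}(n-r_n)=+\infty$. Then, as $n\to\infty$, $$\sum_{[K:\mathbb{Q}_p]\le r_n}\mathbb{E}\left[Z_{\mathcal{O}_K^{\mathrm{new}},n}\right]=r_n+\sum_{m=1}^\infty\left(1-(p^{-m};p^{-1})_\infty\right)+o(1),$$ where the sum on the left ranges over all finite extensions $K/\mathbb{Q}_p$, viewed as subfields of $\overline{\mathbb{Q}}_p$, of degree at most $r_n$, and $(p^{-m};p^{-1})_\infty:=\prod_{k=0}^{\infty}(1-p^{-m-k})$.
   Context: $\overline{\mathbb{Q}}_p$ is a fixed algebraic closure of $\mathbb{Q}_p$. $\mathrm{Mat}_n(\mathbb{Z}_p)$ is the space of $n\times n$ matrices over $\mathbb{Z}_p$, regarded as a probability space with the additive Haar probability measure. For $U\subset\overline{\mathbb{Q}}_p$ and $A\in\mathrm{Mat}_n(\mathbb{Z}_p)$, $Z_{U,n}=Z_{U,n}(A)$ denotes the number of eigenvalues of $A$ (in $\overline{\mathbb{Q}}_p$, counted with multiplicity) that lie in $U$; $\mathbb{E}$ is expectation over Haar-distributed $A$. For a finite extension $K/\mathbb{Q}_p$ inside $\overline{\mathbb{Q}}_p$ with ring of integers $\mathcal{O}_K$, $K^{\mathrm{new}}$ is the set of elements of $K$ not lying in any proper subextension of $K/\mathbb{Q}_p$ (i.e. $x\in K$ with $\mathbb{Q}_p[x]=K$), and $\mathcal{O}_K^{\mathrm{new}}:=K^{\mathrm{new}}\cap\mathcal{O}_K$.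 *)

theory Defs
  imports
    "HOL-Probability.Probability"
    "HOL-Computational_Algebra.Computational_Algebra"
    "HOL-Algebra.Algebraic_Closure_Type"
    "HOL-Library.Landau_Symbols"
    "Jordan_Normal_Form.Char_Poly"
    "Berlekamp_Zassenhaus.Finite_Field"
begin

text \<open>The prime is the cardinality \<^term>\<open>CARD('p)\<close> of a type of class \<^class>\<open>prime_card\<close>.
  A p-adic integer is a compatible sequence of residues modulo the powers of the prime, i.e. an
  element of the inverse limit of the rings of integers modulo the k-th power of the prime.\<close>

typedef (overloaded) ('p :: prime_card) padic_int =
  "{x :: nat \<Rightarrow> int. \<forall>k. x k \<in> {0..<int CARD('p) ^ k} \<and> x (Suc k) mod int CARD('p) ^ k = x k}"
  morphisms residue Abs_padic_int
  by (rule exI[of _ "\<lambda>_. 0"]) auto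

setup_lifting type_definition_padic_int

lemma mod_Suc_power: "(a mod (q::int) ^ Suc k) mod q ^ k = a mod q ^ k"
  by (rule mod_mod_cancel) simp
lemma compatible_mod:
  fixes z :: "nat \<Rightarrow> int"
  assumes "\<And>k. z (Suc k) mod int CARD('p :: prime_card) ^ k = z k mod int CARD('p) ^ k"
  shows "z k mod int CARD('p) ^ k \<in> {0..<int CARD('p) ^ k} \<and>
     (z (Suc k) mod int CARD('p) ^ Suc k) mod int CARD('p) ^ k = z k mod int CARD('p) ^ k"
proof -
  have "0 < int CARD('p) ^ k" by simp
  then have "z k mod int CARD('p) ^ k \<in> {0..<int CARD('p) ^ k}"
    by (auto simp del: zero_less_power)
  moreover have "(z (Suc k) mod int CARD('p) ^ Suc k) mod int CARD('p) ^ k = z k mod int CARD('p) ^ k"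
    using assms[of k] by (metis mod_Suc_power)
  ultimately show ?thesis by blast
qed

instantiation padic_int :: (prime_card) comm_ring_1
begin

lift_definition zero_padic_int :: "'a padic_int" is "\<lambda>_. 0" by simp

lift_definition one_padic_int :: "'a padic_int" is "\<lambda>k. 1 mod int CARD('a) ^ k"
  by (rule compatible_mod) (rule refl)

lift_definition plus_padic_int :: "'a padic_int \<Rightarrow> 'a padic_int \<Rightarrow> 'a padic_int"
  is "\<lambda>x y k. (x k + y k) mod int CARD('a) ^ k"
  by (rule compatible_mod) (metis mod_add_eq)

lift_definition times_padic_int :: "'a padic_int \<Rightarrow> 'a padic_int \<Rightarrow> 'a padic_int"
  is "\<lambda>x y k. (x k * y k) mod int CARD('a) ^ k"
  by (rule compatible_mod) (metis mod_mult_eq)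

lift_definition uminus_padic_int :: "'a padic_int \<Rightarrow> 'a padic_int"
  is "\<lambda>x k. (- x k) mod int CARD('a) ^ k"
  by (rule compatible_mod) (metis mod_minus_eq)

definition minus_padic_int :: "'a padic_int \<Rightarrow> 'a padic_int \<Rightarrow> 'a padic_int"
  where "minus_padic_int x y = x + - y"

instance
proof
  fix a b c :: "'a padic_int"
  have red: "x k mod int CARD('a) ^ k = x k"
    if "\<forall>k. x k \<in> {0..<int CARD('a) ^ k} \<and> x (Suc k) mod int CARD('a) ^ k = x k" for x k
    using that by (auto intro: mod_pos_pos_trivial)
  show "a + b + c = a + (b + c)"
    by transfer (auto simp: mod_simps add.assoc)
  show "a + b = b + a"
    by transfer (auto simp: add.commute)
  show "0 + a = a"
    by transfer (auto intro!: ext)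
  show "- a + a = 0"
    by transfer (auto simp: mod_simps)
  show "a - b = a + - b"
    by (rule minus_padic_int_def)
  show "a * b * c = a * (b * c)"
    by transfer (auto simp: mod_simps mult.assoc)
  show "a * b = b * a"
    by transfer (auto simp: mult.commute)
  show "1 * a = a"
    by transfer (auto intro!: ext simp: mod_simps)
  show "(a + b) * c = a * c + b * c"
    by transfer (auto simp: mod_simps distrib_right)
  show "(0::'a padic_int) \<noteq> 1"
  proof transfer
    have "1 mod int CARD('a) ^ 1 \<noteq> 0"
      using prime_card[where ?'a = 'a] by (auto simp: prime_nat_iff)
    then show "(\<lambda>_. 0) \<noteq> (\<lambda>k. 1 mod int CARD('a) ^ k)"
      by metis
  qed
qed

end

lemma residue_range: "residue (x :: 'p :: prime_card padic_int) k \<in> {0..<int CARD('p) ^ k}"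
  using residue[of x] by auto

lemma residue_mod:
  assumes "k \<le> l"
  shows "residue (x :: 'p :: prime_card padic_int) l mod int CARD('p) ^ k = residue x k"
  using assms
proof (induction l rule: dec_induct)
  case base
  then show ?case using residue_range[of x k] by simp
next
  case (step l)
  have "residue x (Suc l) mod int CARD('p) ^ l = residue x l"
    using residue[of x] by auto
  moreover have "residue x (Suc l) mod int CARD('p) ^ k
      = (residue x (Suc l) mod int CARD('p) ^ l) mod int CARD('p) ^ k"
    using step by (intro mod_mod_cancel [symmetric] le_imp_power_dvd) auto
  ultimately show ?case using step by simp
qed

lemma residue_add: "residue (x + y :: 'p :: prime_card padic_int) k
    = (residue x k + residue y k) mod int CARD('p) ^ k"
  by transfer simp

lemma residue_eqI: "(\<And>k. residue x k = residue y k) \<Longrightarrow> x = y"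
  by (metis residue_inject ext)

instance padic_int :: (prime_card) idom
proof
  fix a b :: "'a padic_int"
  assume "a \<noteq> 0" "b \<noteq> 0"
  let ?p = "int CARD('a)"
  have p: "Factorial_Ring.prime ?p" using prime_card[where ?'a = 'a] by simp
  obtain k where k: "residue a k \<noteq> 0"
    using \<open>a \<noteq> 0\<close> residue_eqI[of a 0] by (auto simp: zero_padic_int.rep_eq)
  obtain l where l: "residue b l \<noteq> 0"
    using \<open>b \<noteq> 0\<close> residue_eqI[of b 0] by (auto simp: zero_padic_int.rep_eq)
  let ?a = "residue a (k + l)" and ?b = "residue b (k + l)"
  have na: "\<not> ?p ^ k dvd ?a" using k residue_mod[of k "k + l" a] by (auto simp: dvd_eq_mod_eq_0)
  have nb: "\<not> ?p ^ l dvd ?b" using l residue_mod[of l "k + l" b] by (auto simp: dvd_eq_mod_eq_0)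
  have nz: "?a \<noteq> 0" "?b \<noteq> 0" using na nb by auto
  have "multiplicity ?p ?a < k" "multiplicity ?p ?b < l"
    using na nb multiplicity_dvd' not_le by blast+
  moreover have "multiplicity ?p (?a * ?b) = multiplicity ?p ?a + multiplicity ?p ?b"
    using p nz by (intro prime_elem_multiplicity_mult_distrib) auto
  ultimately have "multiplicity ?p (?a * ?b) < k + l" by simp
  then have "\<not> ?p ^ (k + l) dvd ?a * ?b"
    using nz p not_prime_unit[of ?p] by (subst power_dvd_iff_le_multiplicity) auto
  then have "residue (a * b) (k + l) \<noteq> residue 0 (k + l)"
    by (auto simp: times_padic_int.rep_eq zero_padic_int.rep_eq dvd_eq_mod_eq_0)
  then show "a * b \<noteq> 0" by auto
qed

type_synonym 'p padic = "'p padic_int fract"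
type_synonym 'p padic_closure = "'p padic alg_closure"

definition embed_int :: "'p :: prime_card padic_int \<Rightarrow> 'p padic_closure" where
  "embed_int a = to_ac (to_fract a)"

global_interpretation padic_vs:
  Vector_Spaces.vector_space "\<lambda>(c :: 'p :: prime_card padic) (x :: 'p padic_closure). to_ac c * x"
  by unfold_locales (auto simp: algebra_simps)

definition intermediate_field :: "'p :: prime_card padic_closure set \<Rightarrow> bool" where
  "intermediate_field K \<longleftrightarrow> range to_ac \<subseteq> K \<and>
     (\<forall>x\<in>K. \<forall>y\<in>K. x + y \<in> K \<and> x - y \<in> K \<and> x * y \<in> K \<and> inverse x \<in> K)"

definition finite_extension :: "'p :: prime_card padic_closure set \<Rightarrow> bool" where
  "finite_extension K \<longleftrightarrow> intermediate_field K \<and> (\<exists>B. finite B \<and> K = padic_vs.span B)"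

definition ext_degree :: "'p :: prime_card padic_closure set \<Rightarrow> nat" where
  "ext_degree K = padic_vs.dim K"

definition new_elements :: "'p :: prime_card padic_closure set \<Rightarrow> 'p padic_closure set" where
  "new_elements K = {x \<in> K. \<forall>L. intermediate_field L \<and> L \<subset> K \<longrightarrow> x \<notin> L}"

text \<open>The ring of integers of an extension is the integral closure of the p-adic integers in it.\<close>

definition integers_of :: "'p :: prime_card padic_closure set \<Rightarrow> 'p padic_closure set" where
  "integers_of K = {x \<in> K. \<exists>f :: 'p padic_int poly.
     Polynomial.lead_coeff f = 1 \<and> poly (map_poly embed_int f) x = 0}"

definition new_integers :: "'p :: prime_card padic_closure set \<Rightarrow> 'p padic_closure set" where
  "new_integers K = new_elements K \<inter> integers_of K"

text \<open>The matrices congruent to a given one modulo the k-th power of the prime.  These are the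
  basic open sets of the topology on matrices obtained from the inverse limit topology on
  the p-adic integers.\<close>

definition cong_ball :: "nat \<Rightarrow> 'p :: prime_card padic_int Matrix.mat \<Rightarrow> nat \<Rightarrow>
    'p padic_int Matrix.mat set" where
  "cong_ball n A k = {B \<in> carrier_mat n n.
     \<forall>i<n. \<forall>j<n. residue (B $$ (i, j)) k = residue (A $$ (i, j)) k}"

definition open_mat :: "nat \<Rightarrow> 'p :: prime_card padic_int Matrix.mat set \<Rightarrow> bool" where
  "open_mat n U \<longleftrightarrow> U \<subseteq> carrier_mat n n \<and> (\<forall>A\<in>U. \<exists>k. cong_ball n A k \<subseteq> U)"

definition is_haar :: "nat \<Rightarrow> 'p :: prime_card padic_int Matrix.mat measure \<Rightarrow> bool" where
  "is_haar n M \<longleftrightarrow> prob_space M \<and> space M = carrier_mat n n \<and>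
     sets M = sigma_sets (carrier_mat n n) {U. open_mat n U} \<and>
     (\<forall>A\<in>carrier_mat n n. \<forall>S\<in>sets M. emeasure M ((\<lambda>B. A + B) ` S) = emeasure M S)"

definition haar :: "nat \<Rightarrow> 'p :: prime_card padic_int Matrix.mat measure" where
  "haar n = (THE M. is_haar n M)"

definition balls :: "nat \<Rightarrow> nat \<Rightarrow> 'p :: prime_card padic_int Matrix.mat set set" where
  "balls n k = (\<lambda>A. cong_ball n A k) ` carrier_mat n n"

lemma cong_ball_subset: "cong_ball n A k \<subseteq> carrier_mat n n"
  by (auto simp: cong_ball_def)

lemma cong_ball_self: "A \<in> carrier_mat n n \<Longrightarrow> A \<in> cong_ball n A k"
  by (auto simp: cong_ball_def)

lemma cong_ball_eq: "B \<in> cong_ball n A k \<Longrightarrow> cong_ball n B k = cong_ball n A k"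
  by (auto simp: cong_ball_def)

lemma cong_ball_mono: "k \<le> l \<Longrightarrow> cong_ball n A l \<subseteq> cong_ball n A k"
  by (auto simp: cong_ball_def) (metis residue_mod)

lemma open_cong_ball: "open_mat n (cong_ball n A k)"
  unfolding open_mat_def
proof (intro conjI ballI)
  show "\<exists>l. cong_ball n B l \<subseteq> cong_ball n A k" if "B \<in> cong_ball n A k" for B
    using cong_ball_eq[OF that] by blast
qed (rule cong_ball_subset)

lemma finite_balls: "finite (balls n k :: 'p :: prime_card padic_int Matrix.mat set set)"
proof (rule finite_subset)
  let ?I = "{..<n} \<times> {..<n}"
  let ?F = "\<lambda>f. {B \<in> carrier_mat n n. \<forall>i<n. \<forall>j<n. residue (B $$ (i, j) :: 'p padic_int) k = f (i, j)}"
  show "balls n k \<subseteq> ?F ` (PiE ?I (\<lambda>_. {0..<int CARD('p) ^ k}))"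
  proof
    fix S :: "'p padic_int Matrix.mat set"
    assume "S \<in> balls n k"
    then obtain A where A: "A \<in> carrier_mat n n" "S = cong_ball n A k" by (auto simp: balls_def)
    let ?f = "restrict (\<lambda>ij. residue (A $$ ij) k) ?I"
    have "?f \<in> PiE ?I (\<lambda>_. {0..<int CARD('p) ^ k})"
      using residue_range by (intro PiE_I) auto
    moreover have "S = ?F ?f" using A by (auto simp: cong_ball_def)
    ultimately show "S \<in> ?F ` (PiE ?I (\<lambda>_. {0..<int CARD('p) ^ k}))" by blast
  qed
  show "finite (?F ` (PiE ?I (\<lambda>_. {0..<int CARD('p) ^ k})))"
    by (rule finite_imageI, rule finite_PiE) simp_all
qed

lemma Union_balls: "\<Union>(balls n k) = carrier_mat n n"
  unfolding balls_def
proof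
  show "carrier_mat n n \<subseteq> (\<Union>A\<in>carrier_mat n n. cong_ball n A k)"
    using cong_ball_self by blast
qed (auto simp: cong_ball_def)

lemma disjoint_balls: "disjoint (balls n k)"
proof (rule disjointI)
  fix S T :: "'a padic_int Matrix.mat set"
  assume "S \<in> balls n k" "T \<in> balls n k" "S \<noteq> T"
  then obtain A B where "S = cong_ball n A k" "T = cong_ball n B k" by (auto simp: balls_def)
  then show "S \<inter> T = {}" using \<open>S \<noteq> T\<close> cong_ball_eq by (metis disjoint_iff)
qed

definition all_balls :: "nat \<Rightarrow> 'p :: prime_card padic_int Matrix.mat set set" where
  "all_balls n = insert {} (\<Union>k. balls n k)"

lemma all_balls_subset: "all_balls n \<subseteq> Pow (carrier_mat n n)"
  by (auto simp: all_balls_def balls_def cong_ball_def)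

lemma Int_stable_all_balls: "Int_stable (all_balls n)"
proof (rule Int_stableI)
  have *: "cong_ball n A k \<inter> cong_ball n B l \<in> all_balls n"
    if "A \<in> carrier_mat n n" "B \<in> carrier_mat n n" "k \<le> l"
    for A B :: "'a padic_int Matrix.mat" and k l
  proof (cases "cong_ball n A k \<inter> cong_ball n B l = {}")
    case False
    then obtain C where C: "C \<in> cong_ball n A k" "C \<in> cong_ball n B l" by blast
    have "cong_ball n A k = cong_ball n C k" "cong_ball n B l = cong_ball n C l"
      using C[THEN cong_ball_eq] by simp_all
    then have "cong_ball n A k \<inter> cong_ball n B l = cong_ball n B l"
      using cong_ball_mono[OF that(3)] by blast
    then show ?thesis using that by (auto simp: all_balls_def balls_def)
  qed (auto simp: all_balls_def)
  fix S T :: "'a padic_int Matrix.mat set"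
  assume "S \<in> all_balls n" "T \<in> all_balls n"
  then consider "S = {}" | "T = {}"
    | A k B l where "A \<in> carrier_mat n n" "B \<in> carrier_mat n n"
        "S = cong_ball n A k" "T = cong_ball n B l"
    by (auto simp: all_balls_def balls_def)
  then show "S \<inter> T \<in> all_balls n"
  proof cases
    case 3
    then show ?thesis
      using *[of A B k l] *[of B A l k] by (cases "k \<le> l") (simp_all add: Int_commute)
  qed (auto simp: all_balls_def)
qed

lemma sigma_open_mat: "sigma_sets (carrier_mat n n) {U. open_mat n U}
    = sigma_sets (carrier_mat n n) (all_balls n :: 'p :: prime_card padic_int Matrix.mat set set)"
proof (rule sigma_sets_eqI)
  fix U :: "'p padic_int Matrix.mat set"
  assume "U \<in> {U. open_mat n U}"
  then have U: "open_mat n U" by simp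
  let ?\<B> = "\<Union>k. {S \<in> balls n k. S \<subseteq> U}"
  have "U = \<Union>?\<B>"
  proof
    show "U \<subseteq> \<Union>?\<B>"
    proof
      fix A assume A: "A \<in> U"
      then obtain k where "cong_ball n A k \<subseteq> U" using U by (auto simp: open_mat_def)
      moreover have "A \<in> carrier_mat n n" using U A by (auto simp: open_mat_def)
      ultimately have "cong_ball n A k \<in> ?\<B>" "A \<in> cong_ball n A k"
        by (auto simp: balls_def cong_ball_self)
      then show "A \<in> \<Union>?\<B>" by blast
    qed
  qed auto
  have cnt: "countable ?\<B>"
    by (intro countable_UN) (auto intro!: countable_finite finite_subset[OF _ finite_balls])
  have sub: "?\<B> \<subseteq> sigma_sets (carrier_mat n n) (all_balls n)"
    by (auto simp: all_balls_def intro: sigma_sets.Basic)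
  have "\<Union>?\<B> \<in> sigma_sets (carrier_mat n n) (all_balls n)"
    by (rule sigma_sets_UNION[OF cnt]) (erule subsetD[OF sub])
  then show "U \<in> sigma_sets (carrier_mat n n) (all_balls n)"
    using \<open>U = \<Union>?\<B>\<close> by simp
next
  fix S :: "'p padic_int Matrix.mat set"
  assume "S \<in> all_balls n"
  then have "open_mat n S" using open_cong_ball by (auto simp: all_balls_def balls_def open_mat_def)
  then show "S \<in> sigma_sets (carrier_mat n n) {U. open_mat n U}" by auto
qed

lemma residue_add_cong_iff:
  fixes a b c :: "'p :: prime_card padic_int"
  shows "residue (a + b) k = residue (a + c) k \<longleftrightarrow> residue b k = residue c k"
proof
  assume "residue (a + b) k = residue (a + c) k"
  then have "residue (- a + (a + b)) k = residue (- a + (a + c)) k"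
    by (simp only: residue_add)
  then show "residue b k = residue c k" by simp
qed (simp add: residue_add)

lemma add_mem_cong_ball_iff:
  assumes "A \<in> carrier_mat n n" "B \<in> carrier_mat n n" "C \<in> carrier_mat n n"
  shows "A + C \<in> cong_ball n (A + B) k \<longleftrightarrow> C \<in> cong_ball n B k"
  using assms by (auto simp: cong_ball_def residue_add_cong_iff)

text \<open>By the uniqueness of the uniform distribution on the finitely many classes modulo each power of
  the prime, translation invariance is equivalent to giving equal mass to all balls of a level.\<close>

definition uniform_on_balls where
  "uniform_on_balls n M \<longleftrightarrow> prob_space M \<and> space M = carrier_mat n n \<and>
     sets M = sigma_sets (carrier_mat n n) {U. open_mat n U} \<and>
     (\<forall>k. \<forall>A\<in>carrier_mat n n. emeasure M (cong_ball n A k)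
        = emeasure M (cong_ball n (0\<^sub>m n n :: 'p :: prime_card padic_int Matrix.mat) k))"

lemma uniform_on_ballsD:
  assumes "uniform_on_balls n M"
  shows "prob_space M" "space M = carrier_mat n n"
    "sets M = sigma_sets (carrier_mat n n) {U. open_mat n U}"
    "A \<in> carrier_mat n n \<Longrightarrow> emeasure M (cong_ball n A k) = emeasure M (cong_ball n (0\<^sub>m n n) k)"
  using assms unfolding uniform_on_balls_def by blast+

lemma ball_in_sets:
  assumes "sets M = sigma_sets (carrier_mat n n) {U. open_mat n U}"
  shows "cong_ball n A k \<in> sets M"
  unfolding assms using open_cong_ball by (intro sigma_sets.Basic) simp

lemma measure_cong_ball:
  fixes M :: "'p :: prime_card padic_int Matrix.mat measure"
  assumes "uniform_on_balls n M" and A: "A \<in> carrier_mat n n"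
  shows "measure M (cong_ball n A k) = 1 / card (balls n k :: 'p padic_int Matrix.mat set set)"
proof -
  interpret prob_space M using assms(1) by (rule uniform_on_ballsD)
  have sets: "sets M = sigma_sets (carrier_mat n n) {U. open_mat n U}" and sp: "space M = carrier_mat n n"
    using uniform_on_ballsD[OF assms(1)] by simp_all
  let ?c = "measure M (cong_ball n (0\<^sub>m n n) k)"
  have c: "measure M (cong_ball n B k) = ?c" if "B \<in> carrier_mat n n" for B
    unfolding measure_def using uniform_on_ballsD(4)[OF assms(1) that] by (rule arg_cong)
  let ?\<B> = "balls n k :: 'p padic_int Matrix.mat set set"
  have "1 = measure M (\<Union>S\<in>?\<B>. S)" using prob_space sp by (simp add: Union_balls)
  also have "\<dots> = (\<Sum>S\<in>?\<B>. measure M S)"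
  proof (rule finite_measure_finite_Union)
    show "finite ?\<B>" by (rule finite_balls)
    show "(\<lambda>S. S) ` ?\<B> \<subseteq> sets M" using ball_in_sets[OF sets] by (auto simp: balls_def)
    show "disjoint_family_on (\<lambda>S. S) ?\<B>"
      using disjoint_balls by (fastforce simp: disjoint_family_on_def disjoint_def)
  qed
  also have "\<dots> = (\<Sum>S\<in>?\<B>. ?c)" 
  proof (rule sum.cong)
    fix S assume "S \<in> ?\<B>"
    then obtain B where "B \<in> carrier_mat n n" "S = cong_ball n B k" by (auto simp: balls_def)
    then show "measure M S = ?c" using c[of B] by (simp only:)
  qed (rule refl)
  also have "\<dots> = real (card ?\<B>) * ?c" by (rule sum_constant)
  finally have "?c = 1 / card ?\<B>" by (cases "card ?\<B> = 0") (simp_all add: field_simps)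
  then show ?thesis by (simp only: c[OF A])
qed

lemma uniform_on_balls_unique:
  assumes M: "uniform_on_balls n M" and N: "uniform_on_balls n N"
  shows "M = N"
proof (rule measure_eqI_generator_eq_countable)
  interpret M: prob_space M using M by (rule uniform_on_ballsD)
  interpret N: prob_space N using N by (rule uniform_on_ballsD)
  show "Int_stable (all_balls n)" "all_balls n \<subseteq> Pow (carrier_mat n n)"
    by (rule Int_stable_all_balls, rule all_balls_subset)
  show "emeasure M S = emeasure N S" if "S \<in> all_balls n" for S
    using that measure_cong_ball[OF M] measure_cong_ball[OF N]
    by (auto simp: all_balls_def balls_def M.emeasure_eq_measure N.emeasure_eq_measure)
  show "sets M = sigma_sets (carrier_mat n n) (all_balls n)"
    "sets N = sigma_sets (carrier_mat n n) (all_balls n)"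
    using uniform_on_ballsD(3)[OF M] uniform_on_ballsD(3)[OF N] by (simp_all add: sigma_open_mat)
  show "balls n 0 \<subseteq> all_balls n" by (auto simp: all_balls_def)
  show "\<Union>(balls n 0) = carrier_mat n n" by (rule Union_balls)
  show "countable (balls n 0)" by (rule countable_finite[OF finite_balls])
  show "emeasure M S \<noteq> \<infinity>" for S by simp
qed

lemma translate_cong_ball:
  assumes "A \<in> carrier_mat n n" "B \<in> carrier_mat n n"
  shows "(\<lambda>C. A + C) ` cong_ball n B k = cong_ball n (A + B) k"
proof (intro equalityI subsetI)
  fix D assume D: "D \<in> cong_ball n (A + B) k"
  then have Dc: "D \<in> carrier_mat n n" by (simp add: cong_ball_def)
  have "A + (- A + D) = D" using assms Dc by (intro eq_matI) auto
  then show "D \<in> (\<lambda>C. A + C) ` cong_ball n B k"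
    using D add_mem_cong_ball_iff[OF assms, of "- A + D"] assms Dc by (intro image_eqI[of _ _ "- A + D"]) auto
next
  fix D assume "D \<in> (\<lambda>C. A + C) ` cong_ball n B k"
  then show "D \<in> cong_ball n (A + B) k"
    using add_mem_cong_ball_iff[OF assms] cong_ball_subset by blast
qed

lemma is_haar_iff_uniform_on_balls: "is_haar n M \<longleftrightarrow> uniform_on_balls n M"
proof
  assume M: "is_haar n M"
  have "emeasure M (cong_ball n A k) = emeasure M (cong_ball n (0\<^sub>m n n) k)"
    if "A \<in> carrier_mat n n" for A k
  proof -
    have "emeasure M ((\<lambda>B. A + B) ` cong_ball n (0\<^sub>m n n) k) = emeasure M (cong_ball n (0\<^sub>m n n) k)"
      using M that ball_in_sets[of M n] by (simp add: is_haar_def)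
    then show ?thesis using translate_cong_ball[OF that, of "0\<^sub>m n n"] that by simp
  qed
  then show "uniform_on_balls n M" using M unfolding is_haar_def uniform_on_balls_def by blast
next
  assume M: "uniform_on_balls n M"
  then have sets: "sets M = sigma_sets (carrier_mat n n) {U. open_mat n U}" and sp: "space M = carrier_mat n n"
    using uniform_on_ballsD[OF M] by simp_all
  interpret prob_space M using M by (rule uniform_on_ballsD)
  have "emeasure M ((\<lambda>B. A + B) ` S) = emeasure M S" if A: "A \<in> carrier_mat n n" and S: "S \<in> sets M" for A S
  proof -
    let ?T = "\<lambda>B. - A + B"
    have pre: "?T -` R \<inter> space M = (\<lambda>B. A + B) ` R" if "R \<subseteq> carrier_mat n n" for R
    proof (intro equalityI subsetI)
      fix D assume D: "D \<in> ?T -` R \<inter> space M"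
      then have "A + (- A + D) = D" using A by (intro eq_matI) (auto simp: sp)
      then show "D \<in> (\<lambda>B. A + B) ` R" using D by (intro image_eqI[of _ _ "- A + D"]) auto
    next
      fix D assume "D \<in> (\<lambda>B. A + B) ` R"
      then obtain B where B: "B \<in> R" "D = A + B" by blast
      have "- A + (A + B) = B" using A B that by (intro eq_matI) auto
      then show "D \<in> ?T -` R \<inter> space M" using A B that by (auto simp: sp)
    qed
    have T: "?T \<in> measurable M M"
    proof (rule measurable_sigma_sets)
      show "sets M = sigma_sets (carrier_mat n n) (all_balls n)" by (simp add: sets sigma_open_mat)
      show "all_balls n \<subseteq> Pow (carrier_mat n n)" by (rule all_balls_subset)
      show "?T \<in> space M \<rightarrow> carrier_mat n n" using A by (auto simp: sp)
      fix R :: "'a padic_int Matrix.mat set"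
      assume R: "R \<in> all_balls n"
      then have "?T -` R \<inter> space M = (\<lambda>B. A + B) ` R" using all_balls_subset by (intro pre) auto
      then show "?T -` R \<inter> space M \<in> sets M"
        using R ball_in_sets[OF sets] A by (auto simp: all_balls_def balls_def translate_cong_ball)
    qed
    have "uniform_on_balls n (distr M M ?T)"
      unfolding uniform_on_balls_def
    proof (intro conjI allI ballI)
      show "prob_space (distr M M ?T)" by (rule prob_space_distr[OF T])
      fix k and C :: "'a padic_int Matrix.mat"
      assume C: "C \<in> carrier_mat n n"
      have *: "emeasure (distr M M ?T) (cong_ball n B k) = emeasure M (cong_ball n (A + B) k)"
        if "B \<in> carrier_mat n n" for B
        using T ball_in_sets[OF sets] pre[OF cong_ball_subset] translate_cong_ball[OF A that]
        by (simp add: emeasure_distr)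
      show "emeasure (distr M M ?T) (cong_ball n C k) = emeasure (distr M M ?T) (cong_ball n (0\<^sub>m n n) k)"
        using *[OF C] *[of "0\<^sub>m n n"] uniform_on_ballsD(4)[OF M, of "A + C" k]
          uniform_on_ballsD(4)[OF M, of "A + 0\<^sub>m n n" k] A C by simp
    qed (simp_all add: sets sp)
    then have "distr M M ?T = M" by (rule uniform_on_balls_unique[OF _ M])
    then have "emeasure M S = emeasure (distr M M ?T) S" by simp
    also have "\<dots> = emeasure M (?T -` S \<inter> space M)" using T S by (rule emeasure_distr)
    also have "?T -` S \<inter> space M = (\<lambda>B. A + B) ` S"
      using sets.sets_into_space[OF S] by (intro pre) (simp add: sp)
    finally show ?thesis by simp
  qed
  then show "is_haar n M" using M unfolding is_haar_def uniform_on_balls_def by blast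
qed

lift_definition from_digits :: "(nat \<Rightarrow> int) \<Rightarrow> 'p :: prime_card padic_int" is
  "\<lambda>f k. (\<Sum>t<k. f t * int CARD('p) ^ t) mod int CARD('p) ^ k"
  by (rule compatible_mod) simp

lemma digit_sum_range:
  assumes "\<And>t. t < k \<Longrightarrow> f t \<in> {0..<q}" "0 < (q :: int)"
  shows "(\<Sum>t<k. f t * q ^ t) \<in> {0..<q ^ k}"
  using assms(1)
proof (induction k)
  case (Suc k)
  have "(\<Sum>t<k. f t * q ^ t) \<in> {0..<q ^ k}" "f k \<in> {0..<q}" using Suc by auto
  moreover from this have "f k * q ^ k \<le> (q - 1) * q ^ k"
    using assms(2) by (intro mult_right_mono) auto
  ultimately show ?case using assms(2) by (auto simp: algebra_simps)
qed simp

lemma residue_from_digits_eq_iff: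
  fixes x :: "'p :: prime_card padic_int"
  assumes "\<And>t. t < k \<Longrightarrow> f t \<in> {0..<int CARD('p)}"
  shows "residue (from_digits f :: 'p padic_int) k = residue x k \<longleftrightarrow>
    (\<forall>t<k. f t = residue x (Suc t) div int CARD('p) ^ t)"
  using assms
proof (induction k)
  case 0
  show ?case using residue_range[of x 0] residue_range[of "from_digits f :: 'p padic_int" 0] by simp
next
  case (Suc k)
  let ?q = "int CARD('p)"
  let ?s = "\<Sum>t<k. f t * ?q ^ t"
  have q: "0 < ?q" by simp
  have s: "?s \<in> {0..<?q ^ k}" "(\<Sum>t<Suc k. f t * ?q ^ t) \<in> {0..<?q ^ Suc k}"
    using Suc.prems q by (intro digit_sum_range; simp)+
  have r: "residue (from_digits f :: 'p padic_int) k = ?s"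
    "residue (from_digits f :: 'p padic_int) (Suc k) = ?s + f k * ?q ^ k"
    using s by (simp_all add: from_digits.rep_eq mod_pos_pos_trivial del: power_Suc)
  let ?x = "residue x (Suc k)"
  have xmod: "?x mod ?q ^ k = residue x k" using residue_mod[of k "Suc k" x] by simp
  have "?s + f k * ?q ^ k = ?x \<longleftrightarrow> ?s = residue x k \<and> f k = ?x div ?q ^ k"
  proof
    assume eq: "?s + f k * ?q ^ k = ?x"
    have "(?s + f k * ?q ^ k) mod ?q ^ k = ?s" "(?s + f k * ?q ^ k) div ?q ^ k = f k"
      using s q by (simp_all add: mod_pos_pos_trivial div_pos_pos_trivial)
    then show "?s = residue x k \<and> f k = ?x div ?q ^ k" using eq xmod by simp
  next
    assume "?s = residue x k \<and> f k = ?x div ?q ^ k"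
    then show "?s + f k * ?q ^ k = ?x" using xmod mod_div_mult_eq[of ?x "?q ^ k"] by simp
  qed
  then show ?case using Suc r by (auto simp: less_Suc_eq)
qed

lemma digit_range:
  fixes x :: "'p :: prime_card padic_int"
  shows "residue x (Suc t) div int CARD('p) ^ t \<in> {0..<int CARD('p)}"
proof -
  have q: "0 < int CARD('p) ^ t" by simp
  have "residue x (Suc t) < int CARD('p) * int CARD('p) ^ t" "0 \<le> residue x (Suc t)"
    using residue_range[of x "Suc t"] by auto
  moreover have "residue x (Suc t) div int CARD('p) ^ t * int CARD('p) ^ t \<le> residue x (Suc t)"
    using q by (simp add: minus_mod_eq_div_mult [symmetric] del: zero_less_power)
  ultimately have "residue x (Suc t) div int CARD('p) ^ t * int CARD('p) ^ t
      < int CARD('p) * int CARD('p) ^ t"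
    by linarith
  then have "residue x (Suc t) div int CARD('p) ^ t < int CARD('p)"
    using q by (meson mult_less_cancel_right_pos)
  then show ?thesis
    using q \<open>0 \<le> residue x (Suc t)\<close>
    by (simp add: pos_imp_zdiv_nonneg_iff del: zero_less_power)
qed

lemma ex_uniform_on_balls: "\<exists>M :: 'p :: prime_card padic_int Matrix.mat measure. uniform_on_balls n M"
proof -
  define Q where "Q = measure_pmf (pmf_of_set {0..<int CARD('p)})"
  define I where "I = ({..<n} \<times> {..<n}) \<times> (UNIV :: nat set)"
  have ne: "{0..<int CARD('p)} \<noteq> {}" by simp
  have Q: "emeasure Q {a} = ennreal (1 / real CARD('p))" if "a \<in> {0..<int CARD('p)}" for a
    using that ne by (simp add: Q_def emeasure_pmf_single pmf_of_set)
  interpret Q: prob_space Q unfolding Q_def by (rule measure_pmf.prob_space_axioms)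
  interpret P: product_prob_space "\<lambda>_. Q" I by standard
  define D where "D = PiM I (\<lambda>_. Q)"
  define F :: "(((nat \<times> nat) \<times> nat) \<Rightarrow> int) \<Rightarrow> 'p padic_int Matrix.mat" where
    "F d = Matrix.mat n n (\<lambda>ij. from_digits (\<lambda>t. d (ij, t) mod int CARD('p)))" for d
  define L where "L = sigma (carrier_mat n n) {U :: 'p padic_int Matrix.mat set. open_mat n U}"
  have sub: "{U :: 'p padic_int Matrix.mat set. open_mat n U} \<subseteq> Pow (carrier_mat n n)" by (auto simp: open_mat_def)
  have L: "space L = carrier_mat n n" "sets L = sigma_sets (carrier_mat n n) {U. open_mat n U}"
    using sub by (simp_all add: L_def)
  define J where "J k = ({..<n} \<times> {..<n}) \<times> {..<k}" for k :: nat
  have J: "J k \<subseteq> I" "finite (J k)" for k by (auto simp: J_def I_def)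
  define c where "c A = (\<lambda>(ij, t). residue (A $$ ij) (Suc t) div int CARD('p) ^ t)"
    for A :: "'p padic_int Matrix.mat"
  have c: "c A x \<in> {0..<int CARD('p)}" for A x
    using digit_range by (cases x) (simp add: c_def)
  have pre: "F -` cong_ball n A k \<inter> space D
      = {d \<in> space D. \<forall>x\<in>J k. d x \<in> {a. a mod int CARD('p) = c A x}}" for A k
  proof -
    have "F d \<in> cong_ball n A k \<longleftrightarrow> (\<forall>x\<in>J k. d x mod int CARD('p) = c A x)" for d
    proof -
      have "F d \<in> cong_ball n A k \<longleftrightarrow> (\<forall>i<n. \<forall>j<n.
          residue (from_digits (\<lambda>t. d ((i, j), t) mod int CARD('p)) :: 'p padic_int) k = residue (A $$ (i, j)) k)"
        by (auto simp: F_def cong_ball_def)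
      also have "\<dots> \<longleftrightarrow> (\<forall>i<n. \<forall>j<n. \<forall>t<k. d ((i, j), t) mod int CARD('p) = c A ((i, j), t))"
        by (simp add: residue_from_digits_eq_iff c_def)
      also have "\<dots> \<longleftrightarrow> (\<forall>x\<in>J k. d x mod int CARD('p) = c A x)"
        by (auto simp: J_def)
      finally show ?thesis .
    qed
    then show ?thesis by auto
  qed
  have setsQ: "S \<in> sets Q" for S by (simp add: Q_def)
  have F: "F \<in> measurable D L"
  proof (rule measurable_sigma_sets)
    show "sets L = sigma_sets (carrier_mat n n) (all_balls n)" using L sigma_open_mat by simp
    show "all_balls n \<subseteq> Pow (carrier_mat n n)" by (rule all_balls_subset)
    show "F \<in> space D \<rightarrow> carrier_mat n n" by (auto simp: F_def)
    fix S :: "'p padic_int Matrix.mat set"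
    assume "S \<in> all_balls n"
    then consider "S = {}" | A k where "S = cong_ball n A k" by (auto simp: all_balls_def balls_def)
    then show "F -` S \<inter> space D \<in> sets D"
    proof cases
      case 2
      have "{d \<in> space D. \<forall>x\<in>J k. d x \<in> {a. a mod int CARD('p) = c A x}} \<in> sets D"
      proof (rule sets.sets_Collect_finite_All)
        fix x assume "x \<in> J k"
        then show "{d \<in> space D. d x \<in> {a. a mod int CARD('p) = c A x}} \<in> sets D"
          using J(1)[of k] unfolding D_def by (intro sets_Collect_single' setsQ) auto
      qed (rule J(2))
      then show ?thesis using 2 pre by simp
    qed simp
  qed
  have digit: "emeasure Q {a. a mod int CARD('p) = c A x} = ennreal (1 / real CARD('p))" for A x
  proof -
    have "emeasure Q {a. a mod int CARD('p) = c A x} = emeasure Q {c A x}"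
      unfolding Q_def
    proof (rule emeasure_eq_AE)
      show "AE a in measure_pmf (pmf_of_set {0..<int CARD('p)}).
          a \<in> {a. a mod int CARD('p) = c A x} \<longleftrightarrow> a \<in> {c A x}"
        using ne by (auto simp: AE_measure_pmf_iff set_pmf_of_set mod_pos_pos_trivial)
    qed simp_all
    then show ?thesis using Q c by simp
  qed
  have "uniform_on_balls n (distr D L F)"
    unfolding uniform_on_balls_def
  proof (intro conjI allI ballI)
    have "prob_space D" unfolding D_def by (rule P.P.prob_space_axioms)
    then show "prob_space (distr D L F)" by (rule prob_space.prob_space_distr[OF _ F])
    fix k and A :: "'p padic_int Matrix.mat"
    have "emeasure (distr D L F) (cong_ball n B k) = (\<Prod>x\<in>J k. ennreal (1 / real CARD('p)))" for B
    proof -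
      have "emeasure (distr D L F) (cong_ball n B k) = emeasure D (F -` cong_ball n B k \<inter> space D)"
        using F ball_in_sets[OF L(2)] by (intro emeasure_distr) auto
      also have "\<dots> = (\<Prod>x\<in>J k. emeasure Q {a. a mod int CARD('p) = c B x})"
        unfolding pre unfolding D_def using J by (intro P.emeasure_PiM_Collect setsQ) auto
      finally show ?thesis by (simp only: digit)
    qed
    then show "emeasure (distr D L F) (cong_ball n A k)
        = emeasure (distr D L F) (cong_ball n (0\<^sub>m n n) k)" by simp
  qed (simp_all add: L)
  then show ?thesis by blast
qed

theorem ex1_haar: "\<exists>!M :: 'p :: prime_card padic_int Matrix.mat measure. is_haar n M"
  unfolding is_haar_iff_uniform_on_balls
  using ex_uniform_on_balls uniform_on_balls_unique by (rule ex_ex1I)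

lemma is_haar_haar: "is_haar n (haar n)"
  unfolding haar_def by (rule theI'[OF ex1_haar])

definition eigenvalue_count ::
  "'p :: prime_card padic_closure set \<Rightarrow> 'p padic_int Matrix.mat \<Rightarrow> nat" where
  "eigenvalue_count U A =
     (let A' = map_mat embed_int A
      in \<Sum>x\<in>{x \<in> U. eigenvalue A' x}. Polynomial.order x (char_poly A'))"

definition expected_count :: "nat \<Rightarrow> 'p :: prime_card padic_closure set \<Rightarrow> real" where
  "expected_count n U = (LINT A|haar n. real (eigenvalue_count U A))"

definition q_pochhammer_inf :: "real \<Rightarrow> real \<Rightarrow> real" where
  "q_pochhammer_inf a q = (\<Prod>k. 1 - a * q ^ k)"

end

theory Submission
  imports Defs "HOL-Real_Asymp.Real_Asymp" "Berlekamp_Zassenhaus.Unique_Factorization_Poly"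
begin

text \<open>
  An eigenvalue generates an extension whose degree is the degree of its minimal polynomial over
  \<open>Z_p\<close>, so the sum counts the eigenvalues in the irreducible factors of degree at most \<open>r\<close> of the
  characteristic polynomial. By Hensel's lemma each such factor reduces to a power of an irreducible
  polynomial over \<open>GF(p)\<close>. Hence, up to an error whose expectation is a tail of a convergent
  series, the count is the total degree of the irreducible factors of degree at most \<open>r\<close> of the
  characteristic polynomial of a uniform matrix over \<open>GF(p)\<close>.

  Splitting off the cyclic subspace generated by a fixed nonzero vector writes this polynomial as the
  product of a uniform monic polynomial of degree \<open>n - J\<close> and the characteristic polynomial of a uniform
  \<open>J \<times> J\<close> matrix, where \<open>J < m\<close> has probability \<open>\<Prod>i\<in>{m..<n}. 1 - p^(-i)\<close>. A uniform monic polynomial of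
  degree \<open>k \<ge> r\<close> contributes \<open>r + o(1)\<close>, because every \<open>\<phi> ^ e\<close> of degree at most \<open>k\<close> divides it with
  probability \<open>p^(-e * degree \<phi>)\<close>; the second factor contributes \<open>J\<close> up to a vanishing error, and the
  expectation of \<open>J\<close> tends to the series in the statement.

  The root counts are measurable since a polynomial \<open>p\<close>-adically close to an irreducible one has its roots
  in the same fields, and since \<open>Z_p\<close> is compact. The same stability shows that only countably many
  fields occur.
\<close>

hide_const (open) Polynomials.degree Polynomials.lead_coeff UnivPoly.coeff UnivPoly.up_ring.monom
  Divisibility.irreducible Divisibility.prime module.smult
  Unique_Factorization.comm_monoid_mult_class.coprime
unbundle no vec_syntax
no_notation fps_nth (infixl "$" 75)

section \<open>Digits and reduction of \<open>p\<close>-adic integers\<close>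

text \<open>Bounds on divisibility must be uniform in \<open>n\<close>, although the characteristic
  polynomial of a uniform matrix is not uniform. With \<open>q\<close> elements in the residue
  field, the weight \<open>q ^ (degree \<phi> * multiplicity \<phi> f)\<close> is the critical one:
  it balances the probability of divisibility by each power of \<open>\<phi>\<close>, so its
  expectation over uniform monic polynomials grows only linearly in the degree. The bound
  \<open>q ^ - j\<close> on the probability of codimension \<open>j\<close> absorbs this growth and
  leaves a constant, \<open>exp 4\<close>. The main term \<open>r\<close> requires no enumeration of
  irreducible polynomials: the average at a degree \<open>k \<ge> r\<close> contains the one at
  degree \<open>r\<close>, where every factor is small and the value is exactly \<open>r\<close>.
  Over \<open>Z_p\<close> limits are extracted by sequential compactness, so approximations at
  different precisions need not be coherent. Roots of nearby polynomials have the form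
  \<open>T(x)\<close> with \<open>T\<close> congruent to the variable modulo the prime; comparing
  reductions then shows that nearby polynomials stay irreducible.\<close>

lemma residue_of_int: "residue (of_int a :: 'p :: prime_card padic_int) k = a mod int CARD('p) ^ k"
proof -
  have n: "residue (of_nat m :: 'p padic_int) k = int m mod int CARD('p) ^ k" for m
    by (induction m) (auto simp: zero_padic_int.rep_eq one_padic_int.rep_eq residue_add mod_simps)
  have u: "residue (- x :: 'p padic_int) k = (- residue x k) mod int CARD('p) ^ k" for x
    by (simp add: uminus_padic_int.rep_eq)
  show ?thesis
    by (cases a rule: int_cases2) (auto simp: n u mod_simps)
qed

lemma residue_diff: "residue (x - y :: 'p :: prime_card padic_int) k
    = (residue x k - residue y k) mod int CARD('p) ^ k"
proof -
  have "residue (x - y) k = (residue x k + residue (- y) k) mod int CARD('p) ^ k"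
    by (simp add: residue_add diff_conv_add_uminus del: add_uminus_conv_diff)
  then show ?thesis by (simp add: uminus_padic_int.rep_eq mod_simps)
qed

lemma residue_mult: "residue (x * y :: 'p :: prime_card padic_int) k
    = (residue x k * residue y k) mod int CARD('p) ^ k"
  by (simp add: times_padic_int.rep_eq)

lemma compatible_shift:
  fixes x :: "nat \<Rightarrow> int"
  assumes x: "\<forall>k. x k \<in> {0..<int CARD('p :: prime_card) ^ k} \<and> x (Suc k) mod int CARD('p) ^ k = x k"
  shows "(x (Suc j + k) div int CARD('p) ^ k) mod int CARD('p) ^ j
    = (x (j + k) div int CARD('p) ^ k) mod int CARD('p) ^ j"
proof -
  let ?q = "int CARD('p)"
  have "x (Suc (j + k)) mod ?q ^ (j + k) = x (j + k)" using x by blast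
  then have *: "x (Suc j + k) mod (?q ^ k * ?q ^ j) = x (j + k)"
    by (simp add: power_add mult.commute)
  have q: "0 < ?q ^ k" by (simp del: zero_less_power add: zero_less_power)
  have "x (j + k) = ?q ^ k * ((x (Suc j + k) div ?q ^ k) mod ?q ^ j) + x (Suc j + k) mod ?q ^ k"
    unfolding *[symmetric] by (rule zmod_zmult2_eq) simp
  then have "x (j + k) div ?q ^ k = (x (Suc j + k) div ?q ^ k) mod ?q ^ j"
    using q by (simp del: zero_less_power)
  then show ?thesis by simp
qed

text \<open>Drops the lowest \<open>k\<close> digits. Division loses \<open>k\<close> digits of
  precision, so the residue at level \<open>j\<close> is read off at level \<open>j + k\<close>. On
  multiples of the \<open>k\<close>-th power this is the exact quotient, the witness in
  \<open>prime_power_dvd_iff\<close>.\<close>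

lift_definition padic_shift :: "nat \<Rightarrow> 'p :: prime_card padic_int \<Rightarrow> 'p padic_int" is
  "\<lambda>k x j. (x (j + k) div int CARD('p) ^ k) mod int CARD('p) ^ j"
  by (rule compatible_mod) (rule compatible_shift, blast)

lemma prime_power_dvd_iff:
  fixes x :: "'p :: prime_card padic_int"
  shows "of_nat CARD('p) ^ k dvd x \<longleftrightarrow> residue x k = 0"
proof
  let ?q = "int CARD('p)"
  have r: "residue (of_nat CARD('p) ^ k :: 'p padic_int) j = ?q ^ k mod ?q ^ j" for j
    using residue_of_int[where 'p = 'p, of "?q ^ k" j] by simp
  {
    assume "of_nat CARD('p) ^ k dvd x"
    then obtain y where "x = of_nat CARD('p) ^ k * y" by (elim dvdE)
    then show "residue x k = 0" by (simp add: residue_mult r)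
  next
    assume 0: "residue x k = 0"
    have "x = of_nat CARD('p) ^ k * padic_shift k x"
    proof (rule residue_eqI)
      fix j
      have d: "?q ^ k dvd residue x (j + k)"
        using residue_mod[of k "j + k" x] 0 by auto
      have "residue (of_nat CARD('p) ^ k * padic_shift k x) j
          = (?q ^ k * (residue x (j + k) div ?q ^ k)) mod ?q ^ j"
        by (simp add: residue_mult r padic_shift.rep_eq mod_simps)
      also have "\<dots> = residue x (j + k) mod ?q ^ j" using d by simp
      finally show "residue x j = residue (of_nat CARD('p) ^ k * padic_shift k x) j"
        by (simp add: residue_mod)
    qed
    then show "of_nat CARD('p) ^ k dvd x" by (metis dvd_triv_left)
  }
qed

lemma residue_eq_iff_dvd:
  fixes x :: "'p :: prime_card padic_int"
  shows "residue x k = residue y k \<longleftrightarrow> of_nat CARD('p) ^ k dvd x - y"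
proof -
  have "residue x k = residue y k" if "(residue x k - residue y k) mod int CARD('p) ^ k = 0"
    using that residue_mod[of k k x] residue_mod[of k k y] by (metis mod_eq_dvd_iff dvd_eq_mod_eq_0 order_refl)
  then show ?thesis by (auto simp: prime_power_dvd_iff residue_diff)
qed

lemma padic_eq_0_iff_dvd:
  fixes x :: "'p :: prime_card padic_int"
  shows "x = 0 \<longleftrightarrow> (\<forall>k. of_nat CARD('p) ^ k dvd x)"
  by (metis prime_power_dvd_iff residue_eqI zero_padic_int.rep_eq dvd_0_right)

definition red :: "'p :: prime_card padic_int \<Rightarrow> 'p mod_ring" where
  "red x = of_int (residue x 1)"

lemma of_int_mod_ring_eq_iff:
  "(of_int a :: 'p :: prime_card mod_ring) = of_int b \<longleftrightarrow> a mod int CARD('p) = b mod int CARD('p)"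
  by (metis of_int_mod_ring.rep_eq of_int_of_int_mod_ring to_int_mod_ring.rep_eq to_int_mod_ring_hom.injectivity Rep_mod_ring_inject)

interpretation red_hom: comm_ring_hom "red :: 'p :: prime_card padic_int \<Rightarrow> 'p mod_ring"
proof
  fix x y :: "'p padic_int"
  show "red (x + y) = red x + red y" "red (x * y) = red x * red y"
    unfolding red_def of_int_add[symmetric] of_int_mult[symmetric] of_int_mod_ring_eq_iff
    by (simp_all add: residue_add residue_mult)
  have "of_int (1 mod int CARD('p)) = (of_int 1 :: 'p mod_ring)"
    unfolding of_int_mod_ring_eq_iff by simp
  then show "red (1 :: 'p padic_int) = 1" "red (0 :: 'p padic_int) = 0"
    by (simp_all add: red_def one_padic_int.rep_eq zero_padic_int.rep_eq)
qed

lemma red_eq_0_iff: "red (x :: 'p :: prime_card padic_int) = 0 \<longleftrightarrow> of_nat CARD('p) dvd x"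
proof -
  have "red x = of_int 0 \<longleftrightarrow> residue x 1 = 0"
    unfolding red_def of_int_mod_ring_eq_iff using residue_range[of x 1] by simp
  then show ?thesis using prime_power_dvd_iff[of 1 x] by simp
qed

lemma surj_red: "surj (red :: 'p :: prime_card padic_int \<Rightarrow> _)"
proof (rule surjI)
  fix a :: "'p mod_ring"
  have "red (of_int (to_int_mod_ring a) :: 'p padic_int) = of_int (to_int_mod_ring a)"
    unfolding red_def of_int_mod_ring_eq_iff by (simp add: residue_of_int)
  then show "red (of_int (to_int_mod_ring a) :: 'p padic_int) = a"
    by (simp add: of_int_of_int_mod_ring)
qed

lemma of_nat_power_dvd_poly_iff:
  "(of_nat q ^ k :: 'a :: idom poly) dvd f \<longleftrightarrow> (\<forall>i. of_nat q ^ k dvd poly.coeff f i)"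
proof -
  have eq: "(of_nat q ^ k :: 'a poly) = [:of_nat q ^ k:]"
    by (simp add: of_nat_poly poly_const_pow)
  show ?thesis unfolding eq by (rule Polynomial.const_poly_dvd_iff)
qed

interpretation red_poly_hom: map_poly_comm_ring_hom "red :: 'p :: prime_card padic_int \<Rightarrow> 'p mod_ring" ..

lemma map_poly_red_eq_0_iff:
  fixes f :: "'p :: prime_card padic_int poly"
  shows "map_poly red f = 0 \<longleftrightarrow> of_nat CARD('p) dvd f"
  using of_nat_power_dvd_poly_iff[of "CARD('p)" 1 f]
  by (simp add: poly_eq_iff coeff_map_poly red_eq_0_iff)

lemma map_poly_red_eq_iff:
  fixes f g :: "'p :: prime_card padic_int poly"
  shows "map_poly red f = map_poly red g \<longleftrightarrow> of_nat CARD('p) dvd f - g"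
  unfolding map_poly_red_eq_0_iff[symmetric] by (simp add: red_poly_hom.hom_minus)

section \<open>Convergence and sequential compactness over \<open>Z_p\<close>\<close>

text \<open>Divisibility by powers of the prime replaces a metric, so that one notion serves scalars
  and polynomials; for the latter it means congruence of all coefficients at once.\<close>

definition padic_conv :: "nat \<Rightarrow> (nat \<Rightarrow> 'a :: comm_ring_1) \<Rightarrow> 'a \<Rightarrow> bool" where
  "padic_conv q x l \<longleftrightarrow> (\<forall>k. \<forall>\<^sub>F m in sequentially. of_nat q ^ k dvd x m - l)"

lemma padic_conv_eventually:
  "padic_conv q x l \<Longrightarrow> \<forall>\<^sub>F m in sequentially. of_nat q ^ k dvd x m - l"
  by (simp add: padic_conv_def)

lemma padic_conv_subseq:
  assumes "padic_conv q x l" "strict_mono s"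
  shows "padic_conv q (\<lambda>m. x (s m)) l"
  unfolding padic_conv_def
  using assms(1)[THEN padic_conv_eventually] by (intro allI eventually_subseq[OF assms(2)])

lemma padic_conv_const: "padic_conv q (\<lambda>_. l) l"
  by (simp add: padic_conv_def)

lemma padic_conv_add:
  assumes "padic_conv q x l" "padic_conv q y m"
  shows "padic_conv q (\<lambda>i. x i + y i) (l + m)"
  unfolding padic_conv_def
proof
  fix k
  show "\<forall>\<^sub>F i in sequentially. of_nat q ^ k dvd x i + y i - (l + m)"
    using assms[THEN padic_conv_eventually, of k]
  proof eventually_elim
    case (elim i)
    then show ?case using dvd_add[OF elim] by (simp add: add_diff_add)
  qed
qed

lemma padic_conv_mult:
  assumes "padic_conv q x l" "padic_conv q y m"
  shows "padic_conv q (\<lambda>i. x i * y i) (l * m)"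
  unfolding padic_conv_def
proof
  fix k
  show "\<forall>\<^sub>F i in sequentially. of_nat q ^ k dvd x i * y i - l * m"
    using assms[THEN padic_conv_eventually, of k]
  proof eventually_elim
    case (elim i)
    have "x i * y i - l * m = (x i - l) * y i + l * (y i - m)" by (simp add: algebra_simps)
    then show ?case using elim by simp
  qed
qed

text \<open>The difference of the limits is divisible by each power for all large indices, and this
  claim does not mention the index. The last hypothesis says that the ring is separated;
  \<open>padic_int_separated\<close> and \<open>padic_poly_separated\<close> discharge it.\<close>

lemma padic_conv_approx:
  assumes "padic_conv q x l" "padic_conv q y m" "\<And>k. of_nat q ^ k dvd x k - y k"
    "\<And>z :: 'a :: comm_ring_1. (\<And>k. of_nat q ^ k dvd z) \<Longrightarrow> z = 0"
  shows "l = (m :: 'a)"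
proof -
  have "of_nat q ^ k dvd l - m" for k
  proof -
    have "\<forall>\<^sub>F i in sequentially. of_nat q ^ k dvd l - m"
      using assms(1,2)[THEN padic_conv_eventually, of k] eventually_ge_at_top[of k]
    proof eventually_elim
      case (elim i)
      have "of_nat q ^ k dvd x i - y i" using assms(3)[of i] elim le_imp_power_dvd dvd_trans by blast
      moreover have "l - m = - (x i - l) + (x i - y i) + (y i - m)" by simp
      ultimately show ?case using elim by (metis dvd_add dvd_minus_iff)
    qed
    then show ?thesis by simp
  qed
  then show ?thesis using assms(4)[of "l - m"] by simp
qed

lemma padic_int_separated:
  fixes z :: "'p :: prime_card padic_int"
  assumes "\<And>k. of_nat CARD('p) ^ k dvd z"
  shows "z = 0"
  using assms padic_eq_0_iff_dvd by blast

lemma padic_poly_separated: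
  fixes z :: "'p :: prime_card padic_int poly"
  assumes "\<And>k. of_nat CARD('p) ^ k dvd z"
  shows "z = 0"
  using assms padic_int_separated unfolding of_nat_power_dvd_poly_iff
  by (metis poly_eq_iff coeff_0)

text \<open>Diagonal argument: by pigeonhole there are nested infinite index sets on which the
  residues at level \<open>k\<close> agree, and \<open>s\<close> picks one index from each. The
  residue of the limit at level \<open>k\<close> is that of the \<open>k\<close>-th chosen
  term.\<close>

lemma padic_compact:
  fixes x :: "nat \<Rightarrow> 'p :: prime_card padic_int"
  shows "\<exists>s l. strict_mono s \<and> padic_conv CARD('p) (\<lambda>m. x (s m)) l"
proof -
  define P where "P k I \<longleftrightarrow> infinite I \<and> (\<forall>i\<in>I. \<forall>j\<in>I. residue (x i) k = residue (x j) k)"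
    for k and I :: "nat set"
  have step: "\<exists>J. P (Suc k) J \<and> J \<subseteq> I" if "P k I" for k I
  proof -
    have inf: "infinite I" using that by (simp add: P_def)
    have "finite ((\<lambda>i. residue (x i) (Suc k)) ` I)"
      by (rule finite_subset[of _ "{0..<int CARD('p) ^ Suc k}"]) (use residue_range in blast, simp)
    then obtain a where "infinite {i\<in>I. residue (x i) (Suc k) = a}"
      using pigeonhole_infinite[OF inf, of "\<lambda>i. residue (x i) (Suc k)"] by blast
    then show ?thesis by (intro exI[of _ "{i\<in>I. residue (x i) (Suc k) = a}"]) (auto simp: P_def)
  qed
  have "residue (x i) 0 = 0" for i using residue_range[of "x i" 0] by simp
  then have "P 0 UNIV" by (simp add: P_def)
  have "\<exists>I. \<forall>k. P k (I k) \<and> I (Suc k) \<subseteq> I k"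
  proof (rule dependent_nat_choice)
    show "\<exists>I. P 0 I" using \<open>P 0 UNIV\<close> by (rule exI)
    show "\<exists>J. P (Suc k) J \<and> J \<subseteq> I" if "P k I" for I k using that by (rule step)
  qed
  then obtain I where I: "\<And>k. P k (I k)" "\<And>k. I (Suc k) \<subseteq> I k"
    by blast
  have mono: "I l \<subseteq> I k" if "k \<le> l" for k l
    using that by (induction l rule: dec_induct) (use I(2) in blast)+
  have inf: "infinite (I k)" for k using I(1) by (simp add: P_def)
  have "\<exists>s. \<forall>k. s k \<in> I k \<and> s k < s (Suc k)"
  proof (rule dependent_nat_choice)
    show "\<exists>i. i \<in> I 0" using infinite_imp_nonempty[OF inf] by blast
    show "\<exists>j. j \<in> I (Suc k) \<and> i < j" for i k
      using inf[of "Suc k"] unfolding infinite_nat_iff_unbounded by blast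
  qed
  then obtain s where s: "\<And>k. s k \<in> I k" "strict_mono s" by (auto simp: strict_mono_Suc_iff)
  have agree: "residue (x (s m)) k = residue (x (s k)) k" if "k \<le> m" for k m
    using I(1)[of k] s(1)[of m] s(1)[of k] mono[OF that] unfolding P_def by blast
  define l where "l = (Abs_padic_int (\<lambda>k. residue (x (s k)) k) :: 'p padic_int)"
  have "residue (x (s (Suc k))) (Suc k) mod int CARD('p) ^ k = residue (x (s k)) k" for k
    using residue_mod[of k "Suc k" "x (s (Suc k))"] agree[of k "Suc k"] by simp
  then have l: "residue l k = residue (x (s k)) k" for k
    unfolding l_def using residue_range by (subst Abs_padic_int_inverse) auto
  have "padic_conv CARD('p) (\<lambda>m. x (s m)) l"
    unfolding padic_conv_def residue_eq_iff_dvd[symmetric] l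
  proof
    fix k
    show "\<forall>\<^sub>F m in sequentially. residue (x (s m)) k = residue (x (s k)) k"
      using eventually_ge_at_top[of k] by eventually_elim (rule agree)
  qed
  then show ?thesis using s(2) by blast
qed

text \<open>The constant coefficient is split off and the sequence thinned twice, first for the
  shifted polynomial and then for that coefficient.\<close>

lemma padic_poly_compact:
  fixes f :: "nat \<Rightarrow> 'p :: prime_card padic_int poly"
  assumes "\<And>m. degree (f m) \<le> n"
  shows "\<exists>s l. strict_mono s \<and> padic_conv CARD('p) (\<lambda>m. f (s m)) l"
  using assms
proof (induction n arbitrary: f)
  case 0
  obtain s l where s: "strict_mono s" "padic_conv CARD('p) (\<lambda>m. poly.coeff (f (s m)) 0) l"
    using padic_compact[of "\<lambda>m. poly.coeff (f m) 0"] by blast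
  have "poly.coeff (f m) i = 0" if "i > 0" for m i
    using 0[of m] that by (intro coeff_eq_0) simp
  then have "poly.coeff (f (s m) - [:l:]) i = (if i = 0 then poly.coeff (f (s m)) 0 - l else 0)" for m i
    by (simp add: coeff_pCons split: nat.splits)
  then have "padic_conv CARD('p) (\<lambda>m. f (s m)) [:l:]"
    using s(2) unfolding padic_conv_def of_nat_power_dvd_poly_iff by simp
  then show ?case using s(1) by blast
next
  case (Suc n)
  define c g where "c m = poly.coeff (f m) 0" and "g m = poly_shift 1 (f m)" for m
  have f: "f m = [:c m:] + [:0, 1:] * g m" for m
    by (rule poly_eqI) (auto simp: c_def g_def coeff_poly_shift coeff_pCons split: nat.splits)
  have "degree (g m) \<le> n" for m
    using Suc.prems[of m] by (intro degree_le) (auto simp: g_def coeff_poly_shift coeff_eq_0)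
  then obtain s l where s: "strict_mono s" "padic_conv CARD('p) (\<lambda>m. g (s m)) l"
    using Suc.IH by blast
  obtain s' l' where s': "strict_mono s'" "padic_conv CARD('p) (\<lambda>m. c (s (s' m))) l'"
    using padic_compact[of "\<lambda>m. c (s m)"] by blast
  have "padic_conv CARD('p) (\<lambda>m. [:c (s (s' m)):]) [:l':]"
    using s'(2) unfolding padic_conv_def of_nat_power_dvd_poly_iff
    by (simp add: coeff_pCons split: nat.splits)
  moreover have "padic_conv CARD('p) (\<lambda>m. [:0, 1:] * g (s (s' m))) ([:0, 1:] * l)"
    by (intro padic_conv_mult padic_conv_const padic_conv_subseq[OF s(2) s'(1)])
  ultimately have "padic_conv CARD('p) (\<lambda>m. f (s (s' m))) ([:l':] + [:0, 1:] * l)"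
    unfolding f by (rule padic_conv_add)
  moreover have "strict_mono (\<lambda>m. s (s' m))" using s(1) s'(1) by (simp add: strict_mono_def)
  ultimately show ?case by blast
qed

text \<open>Guarantees that limits of monic polynomials of fixed degree are again monic of that
  degree.\<close>

lemma padic_conv_coeff:
  fixes f :: "nat \<Rightarrow> 'p :: prime_card padic_int poly"
  assumes "padic_conv CARD('p) f l" "\<And>m. poly.coeff (f m) i = c"
  shows "poly.coeff l i = c"
proof -
  have "of_nat CARD('p) ^ k dvd c - poly.coeff l i" for k
  proof -
    have "\<forall>\<^sub>F m in sequentially. of_nat CARD('p) ^ k dvd c - poly.coeff l i"
      using padic_conv_eventually[OF assms(1), of k]
    proof eventually_elim
      case (elim m)
      then show ?case using assms(2)[of m] unfolding of_nat_power_dvd_poly_iff coeff_diff by blast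
    qed
    then show ?thesis by simp
  qed
  then have "c - poly.coeff l i = 0" by (rule padic_int_separated)
  then show ?thesis by simp
qed

definition monic_of_degree :: "nat \<Rightarrow> 'a :: comm_ring_1 poly set" where
  "monic_of_degree n = {f. degree f = n \<and> Polynomial.lead_coeff f = 1}"

lemma monic_of_degree_iff:
  "f \<in> monic_of_degree n \<longleftrightarrow> poly.coeff f n = 1 \<and> (\<forall>i>n. poly.coeff f i = 0)"
proof
  assume f: "poly.coeff f n = 1 \<and> (\<forall>i>n. poly.coeff f i = 0)"
  then have "degree f = n" by (intro antisym degree_le le_degree) auto
  then show "f \<in> monic_of_degree n" using f by (simp add: monic_of_degree_def)
qed (auto simp: monic_of_degree_def coeff_eq_0)

lemma padic_conv_monic:
  fixes f :: "nat \<Rightarrow> 'p :: prime_card padic_int poly"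
  assumes "padic_conv CARD('p) f l" "\<And>m. f m \<in> monic_of_degree n"
  shows "l \<in> monic_of_degree n"
  using assms padic_conv_coeff[OF assms(1)] by (auto simp: monic_of_degree_iff)

lemma padic_poly_list_compact:
  fixes f :: "nat \<Rightarrow> 'p :: prime_card padic_int poly list"
  assumes "\<And>m. length (f m) = L" "\<And>m g. g \<in> set (f m) \<Longrightarrow> degree g \<le> n"
  shows "\<exists>s l. strict_mono s \<and> length l = L \<and> (\<forall>i<L. padic_conv CARD('p) (\<lambda>m. f (s m) ! i) (l ! i))"
  using assms
proof (induction L arbitrary: f)
  case 0
  show ?case by (rule exI[of _ id], rule exI[of _ "[]"]) (auto simp: strict_mono_def)
next
  case (Suc L)
  define h t where "h m = hd (f m)" and "t m = tl (f m)" for m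
  have f: "f m = h m # t m" for m using Suc.prems(1)[of m] by (cases "f m") (auto simp: h_def t_def)
  have "length (t m) = L" "g \<in> set (t m) \<Longrightarrow> degree g \<le> n" "degree (h m) \<le> n" for m g
    using Suc.prems(1)[of m] Suc.prems(2)[of _ m] f[of m] by auto
  note t = this
  obtain s l where s: "strict_mono s" "length l = L"
      "\<And>i. i < L \<Longrightarrow> padic_conv CARD('p) (\<lambda>m. t (s m) ! i) (l ! i)"
    using Suc.IH[of t] t(1,2) by blast
  obtain s' a where s': "strict_mono s'" "padic_conv CARD('p) (\<lambda>m. h (s (s' m))) a"
    using padic_poly_compact[of "\<lambda>m. h (s m)"] t(3) by blast
  have "padic_conv CARD('p) (\<lambda>m. f (s (s' m)) ! i) ((a # l) ! i)" if "i < Suc L" for i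
  proof (cases i)
    case 0
    then show ?thesis using s'(2) by (simp add: f)
  next
    case (Suc j)
    then show ?thesis using padic_conv_subseq[OF s(3) s'(1), of j] that by (simp add: f)
  qed
  moreover have "strict_mono (\<lambda>m. s (s' m))" using s(1) s'(1) by (simp add: strict_mono_def)
  ultimately show ?case using s(2) by (intro exI[of _ "\<lambda>m. s (s' m)"] exI[of _ "a # l"]) auto
qed

text \<open>Inverses modulo every power exist by Bezout over the integers; a limit point of these
  approximate inverses is an inverse.\<close>

lemma padic_unit:
  fixes u :: "'p :: prime_card padic_int"
  assumes "red u \<noteq> 0"
  shows "u dvd 1"
proof -
  have "\<exists>v. of_nat CARD('p) ^ k dvd u * v - 1" for k
  proof -
    have pr: "Factorial_Ring.prime (int CARD('p))" using prime_card[where ?'a = 'p] by simp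
    have "residue u 1 \<noteq> 0"
      using assms prime_power_dvd_iff[of 1 u] by (simp add: red_eq_0_iff)
    then have "\<not> int CARD('p) dvd residue u 1"
      using residue_range[of u 1] zdvd_not_zless[of "residue u 1" "int CARD('p)"] by auto
    moreover have "residue u k mod int CARD('p) = residue u 1" if "k > 0"
      using residue_mod[of 1 k u] that by simp
    ultimately have "k > 0 \<Longrightarrow> \<not> int CARD('p) dvd residue u k"
      by (metis dvd_mod_iff dvd_refl)
    then have "coprime (residue u k) (int CARD('p) ^ k)"
      using pr prime_imp_power_coprime[of "int CARD('p)" "residue u k" k]
      by (cases "k = 0") (auto simp: coprime_commute)
    then obtain b where b: "[residue u k * b = 1] (mod int CARD('p) ^ k)"
      using cong_solve_coprime_int by blast
    have "residue (u * of_int b) k = residue (1 :: 'p padic_int) k"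
      using b by (simp add: residue_mult residue_of_int one_padic_int.rep_eq mod_simps cong_def)
    then show ?thesis using residue_eq_iff_dvd by blast
  qed
  then obtain v where v: "\<And>k. of_nat CARD('p) ^ k dvd u * v k - 1" by metis
  obtain s l where s: "strict_mono s" "padic_conv CARD('p) (\<lambda>m. v (s m)) l"
    using padic_compact by blast
  have "u * l = 1"
  proof (rule padic_conv_approx)
    show "padic_conv CARD('p) (\<lambda>m. u * v (s m)) (u * l)"
      by (intro padic_conv_mult padic_conv_const s(2))
    show "padic_conv CARD('p) (\<lambda>_. 1) 1" by (rule padic_conv_const)
    show "of_nat CARD('p) ^ k dvd u * v (s k) - 1" for k
      using v[of "s k"] le_imp_power_dvd[OF seq_suble[OF s(1), of k]] dvd_trans by blast
  qed (rule padic_int_separated)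
  then show ?thesis by (metis dvd_triv_left)
qed

section \<open>Krylov decomposition of a uniform matrix over a finite field\<close>

lemma mult_mat_unit_vec:
  fixes A :: "'a :: semiring_1 mat"
  assumes "A \<in> carrier_mat m n" "i < n"
  shows "A *\<^sub>v unit_vec n i = col A i"
  using assms by (intro eq_vecI) auto

definition companion :: "nat \<Rightarrow> 'a :: comm_ring_1 Matrix.vec \<Rightarrow> 'a Matrix.mat" where
  "companion k v = Matrix.mat k k (\<lambda>(i, j). if Suc j = k then v $ i else if i = Suc j then 1 else 0)"

definition vec_poly :: "nat \<Rightarrow> 'a :: comm_ring_1 Matrix.vec \<Rightarrow> 'a poly" where
  "vec_poly k v = monom 1 k - (\<Sum>i<k. monom (v $ i) i)"

lemma coeff_vec_poly:
  "poly.coeff (vec_poly k v) i = (if i = k then 1 else if i < k then - (v $ i) else 0)"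
  by (simp add: vec_poly_def coeff_sum)

lemma companion_carrier [simp]: "companion k v \<in> carrier_mat k k"
  by (simp add: companion_def)

text \<open>Laplace expansion along the top row, whose only nonzero entries are in columns
  \<open>0\<close> and \<open>k\<close>. The first minor belongs to the companion matrix of the
  shifted vector \<open>w\<close>; the second is triangular with diagonal \<open>-1\<close>, and its
  sign cancels that of the cofactor.\<close>

lemma char_poly_companion:
  fixes v :: "'a :: idom Matrix.vec"
  assumes "k > 0"
  shows "char_poly (companion k v) = vec_poly k v"
  using assms
proof (induction k arbitrary: v)
  case (Suc k)
  show ?case
  proof (cases "k = 0")
    case True
    have "char_poly_matrix (companion 1 v) = Matrix.mat 1 1 (\<lambda>_. [:- (v $ 0), 1:])"
      by (intro eq_matI) (auto simp: char_poly_matrix_def companion_def)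
    then have "char_poly (companion 1 v) = [:- (v $ 0), 1:]"
      by (simp add: char_poly_def det_single)
    also have "\<dots> = vec_poly 1 v"
      by (intro poly_eqI) (simp add: coeff_vec_poly coeff_pCons split: nat.splits)
    finally show ?thesis using True by simp
  next
    case False
    define A where "A = char_poly_matrix (companion (Suc k) v)"
    have A: "A \<in> carrier_mat (Suc k) (Suc k)" by (simp add: A_def)
    have A_ij: "A $$ (i, j) = (if i = j then [:0, 1:] else 0)
        - (if j = k then [:v $ i:] else if i = Suc j then 1 else 0)" if "i \<le> k" "j \<le> k" for i j
      using that by (auto simp: A_def char_poly_matrix_def companion_def one_pCons simp del: pCons_one)
    define w where "w = Matrix.vec k (\<lambda>i. v $ Suc i)"
    have del0: "mat_delete A 0 0 = char_poly_matrix (companion k w)"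
    proof (rule eq_matI)
      fix i j assume ij: "i < dim_row (char_poly_matrix (companion k w))"
        "j < dim_col (char_poly_matrix (companion k w))"
      have c: "char_poly_matrix (companion k w) \<in> carrier_mat k k" by simp
      have ij': "i < k" "j < k" using ij c by auto
      have "mat_delete A 0 0 $$ (i, j) = A $$ (Suc i, Suc j)"
        using A ij' by (simp add: mat_delete_def)
      then show "mat_delete A 0 0 $$ (i, j) = char_poly_matrix (companion k w) $$ (i, j)"
        using ij' by (auto simp: A_ij w_def char_poly_matrix_def companion_def one_pCons simp del: pCons_one)
    qed (use A in \<open>auto simp: mat_delete_def char_poly_matrix_def companion_def\<close>)
    have delk: "det (mat_delete A 0 k) = (- 1) ^ k"
    proof -
      have c: "mat_delete A 0 k \<in> carrier_mat k k"
        using mat_delete_carrier[OF A] by simp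
      have e: "mat_delete A 0 k $$ (i, j) = A $$ (Suc i, j)" if "i < k" "j < k" for i j
        using A that by (simp add: mat_delete_def)
      have "upper_triangular (mat_delete A 0 k)"
        using c by (auto simp: upper_triangular_def e A_ij)
      then have "det (mat_delete A 0 k) = prod_list (diag_mat (mat_delete A 0 k))"
        using c by (rule det_upper_triangular)
      also have "\<dots> = (\<Prod>i<k. mat_delete A 0 k $$ (i, i))"
        unfolding prod_list_diag_prod carrier_matD(1)[OF c] by (simp add: atLeast0LessThan)
      also have "\<dots> = (\<Prod>i<k. - 1)" by (rule prod.cong) (auto simp: e A_ij)
      finally show ?thesis by simp
    qed
    have "char_poly (companion (Suc k) v) = (\<Sum>j<Suc k. A $$ (0, j) * cofactor A 0 j)"
      unfolding char_poly_def A_def[symmetric] by (rule laplace_expansion_row[OF A]) simp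
    also have "\<dots> = (\<Sum>j\<in>{0, k}. A $$ (0, j) * cofactor A 0 j)"
      by (intro sum.mono_neutral_right) (auto simp: A_ij)
    also have "\<dots> = [:0, 1:] * char_poly (companion k w) - [:v $ 0:]"
    proof -
      have "cofactor A 0 k = 1" by (simp add: cofactor_def delk power_add[symmetric] mult_2[symmetric])
      then show ?thesis using False
        by (simp add: A_ij cofactor_def del0 char_poly_def)
    qed
    also have "\<dots> = vec_poly (Suc k) v"
      using False Suc.IH[of w]
      by (intro poly_eqI) (auto simp: coeff_vec_poly coeff_pCons w_def split: nat.splits)
    finally show ?thesis .
  qed
qed simp

lemma char_poly_four_block_lower_left_zero:
  fixes A :: "'a :: idom Matrix.mat"
  assumes "A \<in> carrier_mat n n" "B \<in> carrier_mat n m" "C \<in> carrier_mat m m"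
  shows "char_poly (four_block_mat A B (0\<^sub>m m n) C) = char_poly A * char_poly C"
proof -
  have "char_poly_matrix (four_block_mat A B (0\<^sub>m m n) C)
      = four_block_mat (char_poly_matrix A) (map_mat (\<lambda>a. [:- a:]) B) (0\<^sub>m m n) (char_poly_matrix C)"
    using assms by (intro eq_matI) (auto simp: char_poly_matrix_def)
  then show ?thesis
    unfolding char_poly_def using assms
    by (simp add: det_four_block_mat_lower_left_zero[of _ n _ m])
qed

lemma bij_betw_vec_poly:
  "bij_betw (vec_poly k) (carrier_vec k :: 'a :: comm_ring_1 Matrix.vec set) (monic_of_degree k)"
proof (rule bij_betw_byWitness)
  let ?g = "\<lambda>f :: 'a poly. Matrix.vec k (\<lambda>i. - poly.coeff f i)"
  show "\<forall>v\<in>carrier_vec k. ?g (vec_poly k v) = v"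
    by (auto simp: coeff_vec_poly intro!: eq_vecI)
  show "\<forall>f\<in>monic_of_degree k. vec_poly k (?g f) = f"
    by (auto simp: poly_eq_iff coeff_vec_poly monic_of_degree_iff)
qed (auto simp: monic_of_degree_iff coeff_vec_poly)

lemma bij_betw_carrier_mat_PiE:
  "bij_betw (\<lambda>f. Matrix.mat m n f) (PiE ({..<m} \<times> {..<n}) (\<lambda>_. UNIV)) (carrier_mat m n)"
proof (rule bij_betw_byWitness)
  let ?g = "\<lambda>A. restrict (\<lambda>ij. A $$ ij) ({..<m} \<times> {..<n})"
  show "\<forall>f\<in>PiE ({..<m} \<times> {..<n}) (\<lambda>_. UNIV). ?g (Matrix.mat m n f) = f"
    by (intro ballI extensionalityI[OF restrict_extensional]) (auto simp: PiE_iff)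
  show "\<forall>A\<in>carrier_mat m n. Matrix.mat m n (?g A) = A"
    by (auto intro!: eq_matI)
  show "(\<lambda>f. Matrix.mat m n f) ` PiE ({..<m} \<times> {..<n}) (\<lambda>_. UNIV) \<subseteq> carrier_mat m n"
    by (intro image_subsetI mat_carrier)
  show "?g ` carrier_mat m n \<subseteq> PiE ({..<m} \<times> {..<n}) (\<lambda>_. UNIV)"
    by (intro image_subsetI) (simp add: restrict_PiE_iff)
qed

lemma finite_carrier_mat [simp]: "finite (carrier_mat m n :: 'a :: finite Matrix.mat set)"
  using bij_betw_finite[OF bij_betw_carrier_mat_PiE[of m n, where 'a = 'a]]
  by (simp add: finite_PiE)

lemma card_carrier_mat: "card (carrier_mat m n :: 'a :: finite Matrix.mat set) = CARD('a) ^ (m * n)"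
  using bij_betw_same_card[OF bij_betw_carrier_mat_PiE[of m n, where 'a = 'a]]
  by (simp add: card_PiE)

lemma bij_betw_carrier_vec_PiE:
  "bij_betw (\<lambda>f. Matrix.vec n f) (PiE {..<n} (\<lambda>_. UNIV)) (carrier_vec n)"
proof (rule bij_betw_byWitness)
  let ?g = "\<lambda>v. restrict (\<lambda>i. v $ i) {..<n}"
  show "\<forall>f\<in>PiE {..<n} (\<lambda>_. UNIV). ?g (Matrix.vec n f) = f"
    by (intro ballI extensionalityI[OF restrict_extensional]) (auto simp: PiE_iff)
  show "\<forall>v\<in>carrier_vec n. Matrix.vec n (?g v) = v"
    by (auto intro!: eq_vecI)
  show "(\<lambda>f. Matrix.vec n f) ` PiE {..<n} (\<lambda>_. UNIV) \<subseteq> carrier_vec n"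
    by (intro image_subsetI vec_carrier)
  show "?g ` carrier_vec n \<subseteq> PiE {..<n} (\<lambda>_. UNIV)"
    by (intro image_subsetI) (simp add: restrict_PiE_iff)
qed

lemma finite_carrier_vec [simp]: "finite (carrier_vec n :: 'a :: finite Matrix.vec set)"
  using bij_betw_finite[OF bij_betw_carrier_vec_PiE[of n, where 'a = 'a]]
  by (simp add: finite_PiE)

lemma card_carrier_vec: "card (carrier_vec n :: 'a :: finite Matrix.vec set) = CARD('a) ^ n"
  using bij_betw_same_card[OF bij_betw_carrier_vec_PiE[of n, where 'a = 'a]]
  by (simp add: card_PiE)

lemma finite_monic_of_degree [simp]: "finite (monic_of_degree n :: 'a :: {finite, comm_ring_1} poly set)"
  using bij_betw_finite[OF bij_betw_vec_poly[of n, where 'a = 'a]] by simp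

lemma card_monic_of_degree:
  "card (monic_of_degree n :: 'a :: {finite, comm_ring_1} poly set) = CARD('a) ^ n"
  using bij_betw_same_card[OF bij_betw_vec_poly[of n, where 'a = 'a]] by (simp add: card_carrier_vec)

text \<open>Matrices for which the Krylov vectors of the first unit vector, up to the
  \<open>k\<close>-th power of \<open>A\<close>, are the first \<open>k + 1\<close> unit vectors.
  For \<open>k = 0\<close> this is every matrix.\<close>

definition shift_mats :: "nat \<Rightarrow> nat \<Rightarrow> 'a :: field Matrix.mat set" where
  "shift_mats n k = {A \<in> carrier_mat n n. \<forall>j<k. col A j = unit_vec n (Suc j)}"

text \<open>As \<open>w $ j\<close> is nonzero, \<open>w\<close> may replace the unit vector at
  \<open>j\<close> in the standard basis (matrix \<open>E\<close>). Swapping positions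
  \<open>m\<close> and \<open>j\<close> (matrix \<open>P\<close>) moves \<open>w\<close> to position
  \<open>m\<close>; both positions are at least \<open>m\<close>, so the earlier basis vectors stay
  fixed.\<close>

lemma ex_basis_change:
  fixes w :: "'a :: field Matrix.vec"
  assumes w: "w \<in> carrier_vec n" and j: "m \<le> j" "j < n" "w $ j \<noteq> 0"
  obtains R S where "R \<in> carrier_mat n n" "S \<in> carrier_mat n n" "R * S = 1\<^sub>m n" "S * R = 1\<^sub>m n"
    "\<And>i. i < m \<Longrightarrow> col R i = unit_vec n i" "col R m = w"
    "\<And>i. i < m \<Longrightarrow> col S i = unit_vec n i" "S *\<^sub>v w = unit_vec n m"
proof -
  define E where "E = Matrix.mat n n (\<lambda>(a, b). if b = j then w $ a else if a = b then 1 else 0)"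
  define E' where "E' = Matrix.mat n n (\<lambda>(a, b). if b = j then (if a = j then 1 else - (w $ a)) / w $ j
     else if a = b then 1 else 0)"
  define P where "P = (swaprows_mat n m j :: 'a Matrix.mat)"
  have c: "E \<in> carrier_mat n n" "E' \<in> carrier_mat n n" "P \<in> carrier_mat n n"
    by (auto simp: E_def E'_def P_def)
  have colE: "col E b = (if b = j then w else unit_vec n b)" if "b < n" for b
    using that w by (auto intro!: eq_vecI simp: E_def)
  have "E * E' = 1\<^sub>m n"
  proof (rule eq_matI)
    fix a b assume ab: "a < dim_row (1\<^sub>m n :: 'a Matrix.mat)" "b < dim_col (1\<^sub>m n :: 'a Matrix.mat)"
    have "(E * E') $$ (a, b) = (\<Sum>i\<in>{0..<n}. E $$ (a, i) * E' $$ (i, b))"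
      using ab c by (simp add: scalar_prod_def)
    also have "\<dots> = E $$ (a, j) * E' $$ (j, b) + (\<Sum>i\<in>{0..<n} - {j}. E $$ (a, i) * E' $$ (i, b))"
      using j by (intro sum.remove) auto
    also have "(\<Sum>i\<in>{0..<n} - {j}. E $$ (a, i) * E' $$ (i, b))
        = (\<Sum>i\<in>{0..<n} - {j}. if i = a then E' $$ (i, b) else 0)"
      using ab by (intro sum.cong) (auto simp: E_def)
    also have "\<dots> = (if a = j then 0 else E' $$ (a, b))"
      using ab by simp
    finally show "(E * E') $$ (a, b) = 1\<^sub>m n $$ (a, b)"
      using ab j by (auto simp: E_def E'_def)
  qed (use c in auto)
  then have E: "E * E' = 1\<^sub>m n" "E' * E = 1\<^sub>m n"
    using mat_mult_left_right_inverse[OF c(1,2)] by auto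
  have P: "P * P = 1\<^sub>m n"
    unfolding P_def using j by (intro swaprows_mat_inv) auto
  have colP: "col P b = unit_vec n (if b = m then j else if b = j then m else b)" if "b < n" for b
    using that j by (auto intro!: eq_vecI simp: P_def swaprows_mat_def)
  define R S where "R = E * P" and "S = P * E'"
  have cRS: "R \<in> carrier_mat n n" "S \<in> carrier_mat n n" using c by (auto simp: R_def S_def)
  have RS: "R * S = 1\<^sub>m n"
  proof -
    have "R * S = E * (P * P) * E'" unfolding R_def S_def using c by (simp add: assoc_mult_mat[of _ n n _ n _ n])
    then show ?thesis using c by (simp add: P E)
  qed
  then have SR: "S * R = 1\<^sub>m n" using mat_mult_left_right_inverse[OF cRS] by simp
  have colR: "col R b = col E (if b = m then j else if b = j then m else b)" if "b < n" for b
    unfolding R_def using that c j colP[OF that] by (auto simp: col_mult2[of _ n n _ n] mult_mat_unit_vec[of _ n n])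
  have R: "col R i = unit_vec n i" if "i < m" for i using colR[of i] colE[of i] that j by simp
  have Rm: "col R m = w" using colR[of m] colE[of j] j by simp
  have S: "col S i = S *\<^sub>v (R *\<^sub>v unit_vec n i)" if "i < m" for i
    using R[OF that] cRS that j by (simp add: mult_mat_unit_vec[of _ n n])
  have inv: "S *\<^sub>v (R *\<^sub>v x) = x" if "x \<in> carrier_vec n" for x
    using assoc_mult_mat_vec[OF cRS(2,1) that] SR that by simp
  show thesis
  proof (rule that[OF cRS RS SR R Rm])
    show "col S i = unit_vec n i" if "i < m" for i using S[OF that] inv by simp
    have "S *\<^sub>v w = S *\<^sub>v (R *\<^sub>v unit_vec n m)"
      using Rm cRS j by (simp add: mult_mat_unit_vec[of _ n n])
    then show "S *\<^sub>v w = unit_vec n m" using inv by simp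
  qed
qed

text \<open>If the next Krylov vector \<open>w\<close> leaves the span of the first
  \<open>k + 1\<close> unit vectors, a change of basis fixing these turns it into the next unit
  vector. Conjugation is a bijection that keeps the characteristic polynomial, so the sum does not
  depend on \<open>w\<close>.\<close>

lemma sum_shift_mats_col:
  fixes h :: "'a :: {finite, field} poly \<Rightarrow> real"
  assumes w: "w \<in> carrier_vec n" and j: "k < j" "j < n" "w $ j \<noteq> 0"
  shows "(\<Sum>A\<in>{A \<in> shift_mats n k. col A k = w}. h (char_poly A)) = (\<Sum>A\<in>shift_mats n (Suc k). h (char_poly A))"
proof -
  obtain R S where c: "R \<in> carrier_mat n n" "S \<in> carrier_mat n n" and RS: "R * S = 1\<^sub>m n" "S * R = 1\<^sub>m n"
    and R: "\<And>i. i < Suc k \<Longrightarrow> col R i = unit_vec n i" "col R (Suc k) = w"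
    and S: "\<And>i. i < Suc k \<Longrightarrow> col S i = unit_vec n i" "S *\<^sub>v w = unit_vec n (Suc k)"
    using ex_basis_change[OF w, of "Suc k" j] j by auto
  have col3: "col (U * A * V) i = U *\<^sub>v (A *\<^sub>v col V i)"
    if "U \<in> carrier_mat n n" "A \<in> carrier_mat n n" "V \<in> carrier_mat n n" "i < n" for U A V :: "'a Matrix.mat" and i
  proof -
    have "col (U * A * V) i = (U * A) *\<^sub>v col V i" using that by (intro col_mult2[of _ n n _ n]) auto
    also have "\<dots> = U *\<^sub>v (A *\<^sub>v col V i)" using that by (intro assoc_mult_mat_vec[of _ n n _ n]) auto
    finally show ?thesis .
  qed
  have cancel: "U * (V * A * U) * V = A"
    if "U \<in> carrier_mat n n" "A \<in> carrier_mat n n" "V \<in> carrier_mat n n" "U * V = 1\<^sub>m n" for U A V :: "'a Matrix.mat"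
  proof -
    have "U * (V * A * U) * V = U * V * A * (U * V)"
      using that(1-3) by (simp add: assoc_mult_mat[of _ n n _ n _ n])
    then show ?thesis using that by simp
  qed
  show ?thesis
  proof (rule sum.reindex_bij_witness[where i = "\<lambda>B. R * B * S" and j = "\<lambda>A. S * A * R"])
    fix A assume "A \<in> {A \<in> shift_mats n k. col A k = w}"
    then have A: "A \<in> carrier_mat n n" "col A k = w" "\<And>i. i < k \<Longrightarrow> col A i = unit_vec n (Suc i)"
      by (auto simp: shift_mats_def)
    show "R * (S * A * R) * S = A" using c A RS by (intro cancel) auto
    have "col (S * A * R) i = unit_vec n (Suc i)" if "i < Suc k" for i
    proof -
      have "col (S * A * R) i = S *\<^sub>v (A *\<^sub>v unit_vec n i)"
        using col3[OF c(2) A(1) c(1), of i] R(1)[OF that] that j by simp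
      also have "A *\<^sub>v unit_vec n i = col A i" using A(1) that j by (intro mult_mat_unit_vec) auto
      also have "S *\<^sub>v col A i = unit_vec n (Suc i)"
      proof (cases "i = k")
        case False
        then show ?thesis using A(3)[of i] that j S(1)[of "Suc i"] c by (simp add: mult_mat_unit_vec[of _ n n])
      qed (simp add: A S)
      finally show ?thesis .
    qed
    then show "S * A * R \<in> shift_mats n (Suc k)" using c A by (auto simp: shift_mats_def)
    have "similar_mat (S * A * R) A"
      using c A RS by (intro similar_matI[of _ _ S R n]) auto
    then show "h (char_poly (S * A * R)) = h (char_poly A)" by (simp add: char_poly_similar)
  next
    fix B :: "'a Matrix.mat" assume "B \<in> shift_mats n (Suc k)"
    then have B: "B \<in> carrier_mat n n" "\<And>i. i < Suc k \<Longrightarrow> col B i = unit_vec n (Suc i)"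
      by (auto simp: shift_mats_def)
    show "S * (R * B * S) * R = B" using c B RS by (intro cancel) auto
    have *: "col (R * B * S) i = R *\<^sub>v unit_vec n (Suc i)" if "i < Suc k" for i
    proof -
      have "col (R * B * S) i = R *\<^sub>v (B *\<^sub>v unit_vec n i)"
        using col3[OF c(1) B(1) c(2), of i] S(1)[OF that] that j by simp
      also have "B *\<^sub>v unit_vec n i = col B i" using B(1) that j by (intro mult_mat_unit_vec) auto
      finally show ?thesis using B(2)[OF that] by simp
    qed
    have "col (R * B * S) i = unit_vec n (Suc i)" if "i < k" for i
      using *[of i] that R(1)[of "Suc i"] c j by (simp add: mult_mat_unit_vec[of _ n n])
    moreover have "col (R * B * S) k = w"
      using *[of k] R(2) c j by (simp add: mult_mat_unit_vec[of _ n n])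
    ultimately show "R * B * S \<in> {A \<in> shift_mats n k. col A k = w}"
      using c B by (auto simp: shift_mats_def)
  qed
qed

definition avg :: "'b set \<Rightarrow> ('b \<Rightarrow> real) \<Rightarrow> real" where
  "avg S f = (\<Sum>x\<in>S. f x) / real (card S)"

lemma avg_mono: "(\<And>x. x \<in> S \<Longrightarrow> f x \<le> g x) \<Longrightarrow> avg S f \<le> avg S g"
  unfolding avg_def by (intro divide_right_mono sum_mono) auto

lemma avg_cong: "(\<And>x. x \<in> S \<Longrightarrow> f x = g x) \<Longrightarrow> avg S f = avg S g"
  unfolding avg_def by (simp cong: sum.cong)

lemma avg_add: "avg S (\<lambda>x. f x + g x) = avg S f + avg S g"
  by (simp add: avg_def sum.distrib add_divide_distrib)

lemma avg_cmult: "avg S (\<lambda>x. c * f x) = c * avg S f"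
  by (simp add: avg_def sum_distrib_left)

lemma avg_sum: "avg S (\<lambda>x. \<Sum>i\<in>I. f i x) = (\<Sum>i\<in>I. avg S (f i))"
  unfolding avg_def sum_divide_distrib by (rule sum.swap)

lemma avg_const: "finite S \<Longrightarrow> S \<noteq> {} \<Longrightarrow> avg S (\<lambda>_. c) = c"
  by (simp add: avg_def)

lemma card_zero_tail:
  assumes "m \<le> n"
  shows "card {w \<in> carrier_vec n. \<forall>j. m \<le> j \<and> j < n \<longrightarrow> w $ j = (0 :: 'a :: {finite, zero})} = CARD('a) ^ m"
proof -
  have "bij_betw (\<lambda>v. Matrix.vec n (\<lambda>i. if i < m then v $ i else 0)) (carrier_vec m)
      {w \<in> carrier_vec n. \<forall>j. m \<le> j \<and> j < n \<longrightarrow> w $ j = (0 :: 'a)}"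
  proof (rule bij_betw_byWitness[where f' = "\<lambda>w. Matrix.vec m (\<lambda>i. w $ i)"])
    show "\<forall>w\<in>{w \<in> carrier_vec n. \<forall>j. m \<le> j \<and> j < n \<longrightarrow> w $ j = (0 :: 'a)}.
        Matrix.vec n (\<lambda>i. if i < m then Matrix.vec m (\<lambda>i. w $ i) $ i else 0) = w"
      by (auto intro!: eq_vecI)
  qed (use assms in \<open>auto intro!: eq_vecI\<close>)
  from bij_betw_same_card[OF this] show ?thesis by (simp add: card_carrier_vec)
qed

text \<open>Here the next Krylov vector stays in the span of the first \<open>k + 1\<close> unit
  vectors, which is therefore invariant. The matrix is block triangular with a companion block and
  arbitrary \<open>B\<close> and \<open>C\<close>; the power in front counts the choices of
  \<open>B\<close>.\<close>

lemma sum_shift_mats_block: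
  fixes h :: "'a :: {finite, field} poly \<Rightarrow> real"
  assumes n: "n = Suc k + m"
  shows "(\<Sum>A\<in>{A \<in> shift_mats n k. \<forall>j. Suc k \<le> j \<and> j < n \<longrightarrow> col A k $ j = 0}. h (char_poly A))
    = real (CARD('a) ^ (Suc k * m)) *
      (\<Sum>v\<in>carrier_vec (Suc k). \<Sum>C\<in>carrier_mat m m. h (vec_poly (Suc k) v * char_poly C))"
proof -
  let ?S = "{A \<in> shift_mats n k. \<forall>j. Suc k \<le> j \<and> j < n \<longrightarrow> col A k $ j = 0} :: 'a Matrix.mat set"
  let ?F = "\<lambda>(v, C, B). four_block_mat (companion (Suc k) v) B (0\<^sub>m m (Suc k)) C :: 'a Matrix.mat"
  let ?G = "\<lambda>A :: 'a Matrix.mat. (Matrix.vec (Suc k) (\<lambda>i. A $$ (i, k)),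
      Matrix.mat m m (\<lambda>(i, j). A $$ (i + Suc k, j + Suc k)),
      Matrix.mat (Suc k) m (\<lambda>(i, j). A $$ (i, j + Suc k)))"
  let ?P = "carrier_vec (Suc k) \<times> carrier_mat m m \<times> carrier_mat (Suc k) m
    :: ('a Matrix.vec \<times> 'a Matrix.mat \<times> 'a Matrix.mat) set"
  have col: "A $$ (i, j) = col A j $ i" if "A \<in> carrier_mat n n" "i < n" "j < n" for A :: "'a Matrix.mat" and i j
    using that by simp
  have "(\<Sum>A\<in>?S. h (char_poly A)) = (\<Sum>x\<in>?P. h (vec_poly (Suc k) (fst x) * char_poly (fst (snd x))))"
  proof (rule sum.reindex_bij_witness[where i = ?F and j = ?G])
    fix A assume "A \<in> ?S"
    then have A: "A \<in> carrier_mat n n" "\<And>j. j < k \<Longrightarrow> col A j = unit_vec n (Suc j)"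
      "\<And>j. Suc k \<le> j \<Longrightarrow> j < n \<Longrightarrow> col A k $ j = 0"
      by (auto simp: shift_mats_def)
    have entry: "A $$ (i, j) = (if i = Suc j then 1 else 0)" if "i < n" "j < k" for i j
      using A(2)[OF that(2)] that col[OF A(1), of i j] n by auto
    have tail: "A $$ (i, k) = 0" if "Suc k \<le> i" "i < n" for i
      using A(3)[OF that] that A(1) n by simp
    show FG: "?F (?G A) = A"
    proof (rule eq_matI)
      fix i j assume "i < dim_row A" "j < dim_col A"
      then have "i < n" "j < n" using A(1) by auto
      then show "?F (?G A) $$ (i, j) = A $$ (i, j)"
        using n entry[of i j] tail[of i] by (cases "j = k") (auto simp: companion_def)
    qed (use A n in \<open>auto simp: companion_def\<close>)
    show "?G A \<in> ?P" by auto
    have "char_poly (?F (?G A)) = vec_poly (Suc k) (fst (?G A)) * char_poly (fst (snd (?G A)))"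
      using char_poly_four_block_lower_left_zero[OF companion_carrier[of "Suc k" "fst (?G A)"], of "snd (snd (?G A))" m "fst (snd (?G A))"]
      by (simp add: char_poly_companion)
    then show "h (vec_poly (Suc k) (fst (?G A)) * char_poly (fst (snd (?G A)))) = h (char_poly A)"
      using FG by simp
  next
    fix x assume "x \<in> ?P"
    then obtain v C B where x: "x = (v, C, B)" and c: "v \<in> carrier_vec (Suc k)" "C \<in> carrier_mat m m"
      "B \<in> carrier_mat (Suc k) m" by (cases x) auto
    show "?G (?F x) = x"
      unfolding x using c by (auto intro!: eq_vecI eq_matI simp: companion_def)
    show "?F x \<in> ?S"
      unfolding x using c n
      by (auto simp: shift_mats_def companion_def intro!: eq_vecI)
  qed
  also have "\<dots> = (\<Sum>v\<in>carrier_vec (Suc k). \<Sum>C\<in>carrier_mat m m. \<Sum>B\<in>(carrier_mat (Suc k) m :: 'a Matrix.mat set).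
      h (vec_poly (Suc k) v * char_poly C))"
    by (simp only: sum.cartesian_product' fst_conv snd_conv)
  finally show ?thesis
    by (simp add: card_carrier_mat sum_distrib_left)
qed

lemma finite_shift_mats [simp]: "finite (shift_mats n k :: 'a :: {finite, field} Matrix.mat set)"
  by (rule finite_subset[OF _ finite_carrier_mat[of n n]]) (auto simp: shift_mats_def)

text \<open>The matrices are split by whether column \<open>k\<close> stays in the span of the first
  \<open>k + 1\<close> unit vectors. The columns outside the span number
  \<open>q ^ n - q ^ (k + 1)\<close>, and each gives the same sum.\<close>

lemma sum_shift_mats_step:
  fixes h :: "'a :: {finite, field} poly \<Rightarrow> real"
  assumes n: "n = Suc k + m"
  shows "(\<Sum>A\<in>shift_mats n k. h (char_poly A))
    = real (CARD('a) ^ (Suc k * m)) *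
      (\<Sum>v\<in>carrier_vec (Suc k). \<Sum>C\<in>carrier_mat m m. h (vec_poly (Suc k) v * char_poly C))
    + (real (CARD('a)) ^ n - real (CARD('a)) ^ Suc k) * (\<Sum>A\<in>shift_mats n (Suc k). h (char_poly A))"
proof -
  let ?Z = "{w \<in> carrier_vec n. \<forall>j. Suc k \<le> j \<and> j < n \<longrightarrow> w $ j = (0 :: 'a)}"
  let ?h = "\<lambda>A. h (char_poly A)" and ?S = "shift_mats n k :: 'a Matrix.mat set"
  have colc: "col A k \<in> carrier_vec n" if "A \<in> ?S" for A
    using that n by (intro col_carrier_vec[of k n]) (auto simp: shift_mats_def)
  have "(\<Sum>A\<in>?S. ?h A) = (\<Sum>A\<in>{A \<in> ?S. col A k \<in> ?Z}. ?h A) + (\<Sum>A\<in>{A \<in> ?S. col A k \<notin> ?Z}. ?h A)"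
    by (subst sum.union_disjoint[symmetric]) (auto intro!: sum.cong)
  also have "{A \<in> ?S. col A k \<in> ?Z} = {A \<in> ?S. \<forall>j. Suc k \<le> j \<and> j < n \<longrightarrow> col A k $ j = 0}"
    using colc by auto
  also have "(\<Sum>A\<in>{A \<in> ?S. col A k \<notin> ?Z}. ?h A)
      = (\<Sum>w\<in>carrier_vec n - ?Z. \<Sum>A\<in>{A \<in> {A \<in> ?S. col A k \<notin> ?Z}. col A k = w}. ?h A)"
    using colc by (intro sum.group[symmetric]) auto
  also have "\<dots> = (\<Sum>w\<in>carrier_vec n - ?Z. \<Sum>A\<in>shift_mats n (Suc k). ?h A)"
  proof (rule sum.cong)
    fix w assume w: "w \<in> carrier_vec n - ?Z"
    then obtain j where j: "k < j" "j < n" "w $ j \<noteq> 0" by (auto simp: Suc_le_eq)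
    have "{A \<in> {A \<in> ?S. col A k \<notin> ?Z}. col A k = w} = {A \<in> ?S. col A k = w}" using w by auto
    then show "(\<Sum>A\<in>{A \<in> {A \<in> ?S. col A k \<notin> ?Z}. col A k = w}. ?h A) = (\<Sum>A\<in>shift_mats n (Suc k). ?h A)"
      using sum_shift_mats_col[OF _ j, of h] w by simp
  qed simp
  also have "\<dots> = real (card (carrier_vec n - ?Z)) * (\<Sum>A\<in>shift_mats n (Suc k). ?h A)" by simp
  also have "card (carrier_vec n - ?Z) = CARD('a) ^ n - CARD('a) ^ Suc k"
    using card_zero_tail[of "Suc k" n, where 'a = 'a] n
    by (subst card_Diff_subset) (auto simp: card_carrier_vec finite_subset[OF _ finite_carrier_vec[of n]])
  also have "real (CARD('a) ^ n - CARD('a) ^ Suc k) = real CARD('a) ^ n - real CARD('a) ^ Suc k"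
    using n by (subst of_nat_diff) (auto intro!: power_increasing simp: Suc_le_eq)
  finally show ?thesis unfolding sum_shift_mats_block[OF n] .
qed

definition mat_avg :: "nat \<Rightarrow> ('a :: {finite, field} poly \<Rightarrow> real) \<Rightarrow> real" where
  "mat_avg n h = avg (carrier_mat n n) (\<lambda>A. h (char_poly A))"

definition poly_avg :: "nat \<Rightarrow> ('a :: {finite, field} poly \<Rightarrow> real) \<Rightarrow> real" where
  "poly_avg n h = avg (monic_of_degree n) h"

lemma krylov_sum:
  fixes h :: "'a :: {finite, field} poly \<Rightarrow> real"
  shows "(\<Sum>v\<in>carrier_vec k. \<Sum>C\<in>carrier_mat m m. h (vec_poly k v * char_poly C))
    = real CARD('a) ^ (k + m * m) * poly_avg k (\<lambda>f. mat_avg m (\<lambda>g. h (f * g)))"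
proof -
  have "(\<Sum>v\<in>carrier_vec k. \<Sum>C\<in>carrier_mat m m. h (vec_poly k v * char_poly C))
      = (\<Sum>f\<in>monic_of_degree k. \<Sum>C\<in>carrier_mat m m. h (f * char_poly C))"
    by (rule sum.reindex_bij_betw[OF bij_betw_vec_poly])
  then show ?thesis
    by (simp add: poly_avg_def mat_avg_def avg_def card_carrier_mat card_monic_of_degree power_add
        sum_divide_distrib[symmetric])
qed

text \<open>The denominator of \<open>u k\<close> is the number of matrices in
  \<open>shift_mats n k\<close>, so the counts become probabilities: column \<open>k\<close> stays
  in the span with probability \<open>t ^ m\<close>.\<close>

lemma shift_mats_avg_step:
  fixes h :: "'a :: {finite, field} poly \<Rightarrow> real"
  assumes n: "n = Suc k + m"
  defines "t \<equiv> 1 / real CARD('a)"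
    and "u \<equiv> \<lambda>k. (\<Sum>A\<in>shift_mats n k. h (char_poly A)) / real CARD('a) ^ (n * (n - k))"
  shows "u k = t ^ m * poly_avg (Suc k) (\<lambda>f. mat_avg m (\<lambda>g. h (f * g))) + (1 - t ^ m) * u (Suc k)"
proof -
  define q where "q = real CARD('a)"
  have q: "q > 0" by (simp add: q_def)
  let ?G = "poly_avg (Suc k) (\<lambda>f. mat_avg m (\<lambda>g. h (f * g)))"
  have nk: "n - k = Suc m" "n - Suc k = m" using n by auto
  have U: "(\<Sum>A\<in>shift_mats n (Suc k). h (char_poly A)) = q ^ (n * m) * u (Suc k)"
    using q by (simp add: u_def nk q_def)
  have uk: "u k = (\<Sum>A\<in>shift_mats n k. h (char_poly A)) / q ^ (n * Suc m)"
    by (simp add: u_def nk q_def)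
  have "u k = (q ^ (Suc k * m) * (q ^ (Suc k + m * m) * ?G) + (q ^ n - q ^ Suc k) * (q ^ (n * m) * u (Suc k)))
      / q ^ (n * Suc m)"
    unfolding uk sum_shift_mats_step[OF n, of h] krylov_sum U q_def[symmetric]
    by (simp add: q_def)
  also have "\<dots> = q ^ (Suc k * m) * q ^ (Suc k + m * m) / q ^ (n * Suc m) * ?G
      + (q ^ n - q ^ Suc k) * q ^ (n * m) / q ^ (n * Suc m) * u (Suc k)"
    by (simp add: add_divide_distrib)
  also have "q ^ (Suc k * m) * q ^ (Suc k + m * m) / q ^ (n * Suc m) = t ^ m"
  proof -
    have "q ^ (n * Suc m) = q ^ (Suc k * m) * q ^ (Suc k + m * m) * q ^ m"
      unfolding power_add[symmetric] by (simp add: n algebra_simps)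
    then show ?thesis using q by (simp add: t_def q_def[symmetric] power_one_over field_simps)
  qed
  also have "(q ^ n - q ^ Suc k) * q ^ (n * m) / q ^ (n * Suc m) = 1 - t ^ m"
  proof -
    have "q ^ (n * Suc m) = q ^ n * q ^ (n * m)" by (simp add: power_add)
    moreover have "q ^ n = q ^ Suc k * q ^ m" by (simp add: n power_add)
    ultimately show ?thesis using q by (simp add: t_def q_def[symmetric] power_one_over field_simps)
  qed
  finally show ?thesis .
qed

text \<open>The cyclic subspace generated by a fixed nonzero vector has codimension \<open>j\<close> with probability
  \<open>t ^ j * (\<Prod>i\<in>{j<..<n}. 1 - t ^ i)\<close>.\<close>

lemma mat_avg_krylov_split:
  fixes h :: "'a :: {finite, field} poly \<Rightarrow> real"
  assumes "n > 0"
  defines "t \<equiv> 1 / real CARD('a)"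
  shows "mat_avg n h = (\<Sum>j<n. t ^ j * (\<Prod>i\<in>{j<..<n}. 1 - t ^ i) *
    poly_avg (n - j) (\<lambda>f. mat_avg j (\<lambda>g. h (f * g))))"
proof -
  define u where "u k = (\<Sum>A\<in>shift_mats n k. h (char_poly A)) / real CARD('a) ^ (n * (n - k))" for k
  let ?G = "\<lambda>j. poly_avg (n - j) (\<lambda>f. mat_avg j (\<lambda>g. h (f * g)))"
  have step: "u k = t ^ m * ?G m + (1 - t ^ m) * u (Suc k)" if "n = Suc k + m" for k m
  proof -
    have "n - m = Suc k" using that by simp
    then show ?thesis unfolding u_def t_def using shift_mats_avg_step[OF that, of h] by simp
  qed
  have "u (n - Suc l) = (\<Sum>j<Suc l. t ^ j * (\<Prod>i\<in>{j<..<Suc l}. 1 - t ^ i) * ?G j)" if "l < n" for l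
    using that
  proof (induction l)
    case 0
    \<comment> \<open>For \<open>m = 0\<close> the factor \<open>1 - t ^ 0\<close> vanishes, which
      removes \<open>u n\<close>: a whole basis has been reached and no further step is
      possible.\<close>
    show ?case using step[of "n - 1" 0] 0 by simp
  next
    case (Suc l)
    have "u (n - Suc (Suc l)) = t ^ Suc l * ?G (Suc l) + (1 - t ^ Suc l) * u (Suc (n - Suc (Suc l)))"
      using Suc.prems by (intro step) auto
    also have "Suc (n - Suc (Suc l)) = n - Suc l" using Suc.prems by simp
    also have "u (n - Suc l) = (\<Sum>j<Suc l. t ^ j * (\<Prod>i\<in>{j<..<Suc l}. 1 - t ^ i) * ?G j)"
      using Suc by simp
    also have "(1 - t ^ Suc l) * (\<Sum>j<Suc l. t ^ j * (\<Prod>i\<in>{j<..<Suc l}. 1 - t ^ i) * ?G j)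
        = (\<Sum>j<Suc l. t ^ j * (\<Prod>i\<in>{j<..<Suc (Suc l)}. 1 - t ^ i) * ?G j)"
      unfolding sum_distrib_left
    proof (rule sum.cong)
      fix j assume "j \<in> {..<Suc l}"
      then have "{j<..<Suc (Suc l)} = insert (Suc l) {j<..<Suc l}" by auto
      then show "(1 - t ^ Suc l) * (t ^ j * (\<Prod>i\<in>{j<..<Suc l}. 1 - t ^ i) * ?G j)
          = t ^ j * (\<Prod>i\<in>{j<..<Suc (Suc l)}. 1 - t ^ i) * ?G j" by simp
    qed simp
    moreover have "{Suc l<..<Suc (Suc l)} = {}" by auto
    ultimately show ?case by (simp add: add.commute)
  qed
  from this[of "n - 1"] have "u 0 = (\<Sum>j<n. t ^ j * (\<Prod>i\<in>{j<..<n}. 1 - t ^ i) * ?G j)"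
    using assms(1) by simp
  moreover have "u 0 = mat_avg n h"
    by (simp add: u_def mat_avg_def avg_def shift_mats_def card_carrier_mat)
  ultimately show ?thesis by simp
qed

section \<open>Irreducible factors of random characteristic polynomials\<close>

lemma monic_of_degree_mult:
  fixes f g :: "'a :: idom poly"
  assumes "f \<in> monic_of_degree m" "g \<in> monic_of_degree n"
  shows "f * g \<in> monic_of_degree (m + n)"
  using assms by (auto simp: monic_of_degree_def Polynomial.lead_coeff_mult degree_mult_eq_0 degree_monic_mult)
    (metis degree_mult_eq leading_coeff_0_iff zero_neq_one)

lemma monic_of_degree_nonzero: "f \<in> monic_of_degree n \<Longrightarrow> f \<noteq> 0"
  by (auto simp: monic_of_degree_def)

lemma monic_of_degree_0 [simp]: "monic_of_degree 0 = {1}"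
  by (auto simp: monic_of_degree_def elim: degree_eq_zeroE)

lemma monic_of_degree_power:
  fixes f :: "'a :: idom poly"
  assumes "f \<in> monic_of_degree m"
  shows "f ^ e \<in> monic_of_degree (m * e)"
proof (induction e)
  case (Suc e)
  then show ?case using monic_of_degree_mult[OF assms Suc] by (simp add: add.commute)
qed simp

lemma monic_of_degree_cofactor:
  fixes f g :: "'a :: idom poly"
  assumes "f \<in> monic_of_degree m" "f * g \<in> monic_of_degree n"
  shows "m \<le> n" "g \<in> monic_of_degree (n - m)"
proof -
  have nz: "f \<noteq> 0" "g \<noteq> 0" using monic_of_degree_nonzero[OF assms(2)] by auto
  have "m + degree g = n" using assms nz by (auto simp: monic_of_degree_def degree_mult_eq)
  moreover have "Polynomial.lead_coeff g = 1"
    using assms Polynomial.lead_coeff_mult[of f g] by (auto simp: monic_of_degree_def)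
  ultimately show "m \<le> n" "g \<in> monic_of_degree (n - m)" by (auto simp: monic_of_degree_def)
qed

lemma char_poly_monic: "A \<in> carrier_mat n n \<Longrightarrow> char_poly A \<in> monic_of_degree n"
  using degree_monic_char_poly[of A n] by (auto simp: monic_of_degree_def)

lemma mat_avg_mono:
  assumes "\<And>f. f \<in> monic_of_degree n \<Longrightarrow> h f \<le> h' f"
  shows "mat_avg n h \<le> mat_avg n h'"
  unfolding mat_avg_def using assms char_poly_monic by (intro avg_mono) blast

lemma mat_avg_cong:
  assumes "\<And>f. f \<in> monic_of_degree n \<Longrightarrow> h f = h' f"
  shows "mat_avg n h = mat_avg n h'"
  unfolding mat_avg_def using assms char_poly_monic by (intro avg_cong) blast

lemma poly_avg_mono:
  assumes "\<And>f. f \<in> monic_of_degree n \<Longrightarrow> h f \<le> h' f"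
  shows "poly_avg n h \<le> poly_avg n h'"
  unfolding poly_avg_def using assms by (rule avg_mono)

lemma poly_avg_cong:
  assumes "\<And>f. f \<in> monic_of_degree n \<Longrightarrow> h f = h' f"
  shows "poly_avg n h = poly_avg n h'"
  unfolding poly_avg_def using assms by (rule avg_cong)

lemma carrier_mat_nonempty: "carrier_mat m n \<noteq> {}"
  using zero_carrier_mat by blast

lemma monic_of_degree_nonempty: "monic_of_degree n \<noteq> ({} :: 'a :: comm_ring_1 poly set)"
proof -
  have "monom 1 n \<in> (monic_of_degree n :: 'a poly set)" by (simp add: monic_of_degree_iff)
  then show ?thesis by blast
qed

lemma mat_avg_const [simp]: "mat_avg n (\<lambda>_. c) = c"
  by (simp add: mat_avg_def avg_const carrier_mat_nonempty)

lemma poly_avg_const [simp]: "poly_avg n (\<lambda>_. c) = c"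
  by (simp add: poly_avg_def avg_const monic_of_degree_nonempty)

lemma mat_avg_0: "mat_avg 0 h = h 1" for h :: "'a :: {finite, field} poly \<Rightarrow> real"
proof -
  have "mat_avg 0 h = mat_avg 0 (\<lambda>_ :: 'a poly. h 1)" by (rule mat_avg_cong) simp
  then show ?thesis by simp
qed

lemma mat_avg_add: "mat_avg n (\<lambda>f. h f + h' f) = mat_avg n h + mat_avg n h'"
  by (simp add: mat_avg_def avg_add)

lemma poly_avg_add: "poly_avg n (\<lambda>f. h f + h' f) = poly_avg n h + poly_avg n h'"
  by (simp add: poly_avg_def avg_add)

lemma mat_avg_cmult: "mat_avg n (\<lambda>f. c * h f) = c * mat_avg n h"
  by (simp add: mat_avg_def avg_cmult)

lemma poly_avg_cmult: "poly_avg n (\<lambda>f. c * h f) = c * poly_avg n h"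
  by (simp add: poly_avg_def avg_cmult)

lemma mat_avg_sum: "mat_avg n (\<lambda>f. \<Sum>i\<in>I. h i f) = (\<Sum>i\<in>I. mat_avg n (h i))"
  by (simp add: mat_avg_def avg_sum)

lemma poly_avg_sum: "poly_avg n (\<lambda>f. \<Sum>i\<in>I. h i f) = (\<Sum>i\<in>I. poly_avg n (h i))"
  by (simp add: poly_avg_def avg_sum)

lemma poly_avg_mat_avg_swap:
  "poly_avg k (\<lambda>f. mat_avg m (\<lambda>g. h f g)) = mat_avg m (\<lambda>g. poly_avg k (\<lambda>f. h f g))"
  unfolding poly_avg_def mat_avg_def avg_def sum_divide_distrib
  by (subst sum.swap) (simp add: mult.commute)

definition krylov_prob :: "real \<Rightarrow> nat \<Rightarrow> nat \<Rightarrow> real" where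
  "krylov_prob t n j = t ^ j * (\<Prod>i\<in>{j<..<n}. 1 - t ^ i)"

lemma krylov_prob_nonneg: "0 \<le> t \<Longrightarrow> t \<le> 1 \<Longrightarrow> 0 \<le> krylov_prob t n j"
  by (auto simp: krylov_prob_def power_le_one intro!: mult_nonneg_nonneg prod_nonneg)

lemma krylov_prob_le: "0 \<le> t \<Longrightarrow> t \<le> 1 \<Longrightarrow> krylov_prob t n j \<le> t ^ j"
  unfolding krylov_prob_def
  by (rule mult_left_le) (auto intro!: prod_le_1 simp: power_le_one)

text \<open>Monic representatives, so that every class of associated factors is counted
  once.\<close>

definition irr_polys :: "nat \<Rightarrow> 'a :: field poly set" where
  "irr_polys r = {\<phi>. irreducible \<phi> \<and> Polynomial.lead_coeff \<phi> = 1 \<and> degree \<phi> \<le> r}"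

definition small_part :: "nat \<Rightarrow> 'a :: field_gcd poly \<Rightarrow> nat" where
  "small_part r f = (\<Sum>\<phi>\<in>irr_polys r. degree \<phi> * multiplicity \<phi> f)"

text \<open>A power \<open>\<phi> ^ e\<close> of degree at most \<open>r\<close> lifts to factors of degree at most \<open>r\<close> only, so the
  degrees of the lifts matter exactly when \<open>r < degree \<phi> * multiplicity \<phi> f\<close>.\<close>

definition bad_part :: "nat \<Rightarrow> 'a :: field_gcd poly \<Rightarrow> nat" where
  "bad_part r f = (\<Sum>\<phi>\<in>{\<phi> \<in> irr_polys r. r < degree \<phi> * multiplicity \<phi> f}. degree \<phi> * multiplicity \<phi> f)"

lemma finite_irr_polys [simp]: "finite (irr_polys r :: 'a :: {finite, field} poly set)"
proof (rule finite_subset)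
  show "irr_polys r \<subseteq> (\<Union>d\<le>r. monic_of_degree d :: 'a poly set)"
    by (auto simp: irr_polys_def monic_of_degree_def)
qed simp

lemma irreducible_degree_pos: "irreducible (\<phi> :: 'a :: field poly) \<Longrightarrow> degree \<phi> > 0"
  using is_unit_iff_degree[of \<phi>] by (auto simp: irreducible_def)

lemma monic_irreducible_factor_exists:
  fixes f :: "'a :: field_gcd poly"
  assumes "degree f > 0"
  obtains \<phi> where "irreducible \<phi>" "Polynomial.lead_coeff \<phi> = 1" "\<phi> dvd f"
proof -
  have "f \<noteq> 0" "\<not> f dvd 1" using assms by (auto simp: is_unit_iff_degree)
  then obtain p where p: "prime p" "p dvd f" using prime_divisor_exists by blast
  have nz: "p \<noteq> 0" "Polynomial.lead_coeff p \<noteq> 0" using p by auto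
  let ?\<phi> = "smult (inverse (Polynomial.lead_coeff p)) p"
  have "irreducible p" using p(1) by (blast intro: Factorial_Ring.prime_elem_imp_irreducible prime_imp_prime_elem)
  then have "irreducible ?\<phi>" using nz by (simp add: irreducible_smult_field)
  moreover have "?\<phi> dvd f" using p nz by (simp add: smult_dvd_iff)
  moreover have "Polynomial.lead_coeff ?\<phi> = 1" using nz by simp
  ultimately show thesis using that by blast
qed

lemma monic_irreducible_dvd_imp_eq:
  fixes \<phi> \<psi> :: "'a :: field_gcd poly"
  assumes "irreducible \<phi>" "Polynomial.lead_coeff \<phi> = 1" "irreducible \<psi>" "Polynomial.lead_coeff \<psi> = 1" "\<phi> dvd \<psi>"
  shows "\<phi> = \<psi>"
proof -
  obtain c where c: "\<psi> = \<phi> * c" using assms(5) by (elim dvdE)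
  then have "c dvd 1" using assms(1,3) irreducibleD irreducible_not_unit by blast
  then have "degree c = 0" using assms c by (auto simp: is_unit_iff_degree)
  then obtain a where a: "c = [:a:]" by (elim degree_eq_zeroE)
  then have "a = 1" using c assms(2,4) Polynomial.lead_coeff_mult[of \<phi> c] by simp
  then show ?thesis using c a by simp
qed

lemma multiplicity_monic_irreducible:
  fixes \<phi> \<psi> :: "'a :: field_gcd poly"
  assumes "irreducible \<phi>" "Polynomial.lead_coeff \<phi> = 1" "irreducible \<psi>" "Polynomial.lead_coeff \<psi> = 1"
  shows "multiplicity \<phi> \<psi> = (if \<phi> = \<psi> then 1 else 0)"
proof (cases "\<phi> = \<psi>")
  case True
  then show ?thesis using assms by (auto simp: irreducible_def multiplicity_self)
next
  case False
  then have "\<not> \<phi> dvd \<psi>" using monic_irreducible_dvd_imp_eq assms by blast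
  then show ?thesis using False by (simp add: not_dvd_imp_multiplicity_0)
qed

lemma small_part_mult:
  fixes f g :: "'a :: field_gcd poly"
  assumes "f \<noteq> 0" "g \<noteq> 0"
  shows "small_part r (f * g) = small_part r f + small_part r g"
  unfolding small_part_def sum.distrib[symmetric]
proof (rule sum.cong)
  fix \<phi> :: "'a poly" assume "\<phi> \<in> irr_polys r"
  then have "prime_elem \<phi>" by (simp add: irr_polys_def irreducible_imp_prime_elem)
  then show "degree \<phi> * multiplicity \<phi> (f * g) = degree \<phi> * multiplicity \<phi> f + degree \<phi> * multiplicity \<phi> g"
    using assms by (simp add: prime_elem_multiplicity_mult_distrib algebra_simps)
qed simp

lemma small_part_irreducible:
  fixes \<phi> :: "'a :: {finite, field_gcd} poly"
  assumes "irreducible \<phi>" "Polynomial.lead_coeff \<phi> = 1"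
  shows "small_part r \<phi> = (if degree \<phi> \<le> r then degree \<phi> else 0)"
proof -
  have "small_part r \<phi> = (\<Sum>\<psi>\<in>irr_polys r. if \<psi> = \<phi> then degree \<phi> else 0)"
    unfolding small_part_def using assms
    by (intro sum.cong) (auto simp: irr_polys_def multiplicity_monic_irreducible)
  also have "\<dots> = (if \<phi> \<in> irr_polys r then degree \<phi> else 0)" by simp
  finally show ?thesis using assms by (simp add: irr_polys_def)
qed

text \<open>Induction on the degree, splitting off one monic irreducible factor at a time; when
  \<open>n \<le> r\<close> no factor can be too large.\<close>

lemma small_part_bounds:
  fixes f :: "'a :: {finite, field_gcd} poly"
  assumes "f \<in> monic_of_degree n"
  shows "small_part r f \<le> n" "n \<le> r \<Longrightarrow> small_part r f = n"
proof -
  have "small_part r f \<le> n \<and> (n \<le> r \<longrightarrow> small_part r f = n)"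
    using assms
  proof (induction n arbitrary: f rule: less_induct)
    case (less n)
    show ?case
    proof (cases "n = 0")
      case True
      then show ?thesis using less.prems by (simp add: small_part_def)
    next
      case False
      then have "degree f > 0" using less.prems by (simp add: monic_of_degree_def)
      then obtain \<phi> where \<phi>: "irreducible \<phi>" "Polynomial.lead_coeff \<phi> = 1" "\<phi> dvd f"
        by (rule monic_irreducible_factor_exists)
      then obtain g where g: "f = \<phi> * g" by (elim dvdE)
      let ?d = "degree \<phi>"
      have d: "?d > 0" using \<phi> by (simp add: irreducible_degree_pos)
      have \<phi>m: "\<phi> \<in> monic_of_degree ?d" using \<phi> by (simp add: monic_of_degree_def)
      then have c: "?d \<le> n" "g \<in> monic_of_degree (n - ?d)"
        using monic_of_degree_cofactor[of \<phi> ?d g n] less.prems g by auto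
      have "small_part r f = small_part r \<phi> + small_part r g"
        unfolding g using \<phi>m c by (intro small_part_mult) (auto simp: monic_of_degree_nonzero)
      then show ?thesis
        using less.IH[of "n - ?d" g] c d small_part_irreducible[OF \<phi>(1,2), of r] by auto
    qed
  qed
  then show "small_part r f \<le> n" "n \<le> r \<Longrightarrow> small_part r f = n" by blast+
qed

text \<open>Multiples of \<open>\<phi> ^ e\<close> correspond to their monic cofactors of degree
  \<open>k - d * e\<close>.\<close>

lemma poly_avg_power_dvd:
  fixes \<phi> :: "'a :: {finite, field_gcd} poly"
  assumes \<phi>: "\<phi> \<in> monic_of_degree d"
  shows "poly_avg k (\<lambda>f. of_bool (\<phi> ^ e dvd f)) = (if d * e \<le> k then (1 / real CARD('a)) ^ (d * e) else 0)"
proof -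
  have \<phi>e: "\<phi> ^ e \<in> monic_of_degree (d * e)" using \<phi> by (rule monic_of_degree_power)
  have nz: "\<phi> ^ e \<noteq> 0" using monic_of_degree_nonzero[OF \<phi>e] .
  have sum: "(\<Sum>f\<in>monic_of_degree k. of_bool (\<phi> ^ e dvd f)) = real (card {f \<in> monic_of_degree k. \<phi> ^ e dvd f})"
    by (simp add: of_bool_def sum.If_cases Int_def)
  have "{f \<in> monic_of_degree k. \<phi> ^ e dvd f}
      = (if d * e \<le> k then (\<lambda>g. \<phi> ^ e * g) ` monic_of_degree (k - d * e) else {})"
  proof (intro equalityI subsetI)
    fix f assume "f \<in> {f \<in> monic_of_degree k. \<phi> ^ e dvd f}"
    then obtain g where "f = \<phi> ^ e * g" "\<phi> ^ e * g \<in> monic_of_degree k" by (auto elim!: dvdE)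
    then show "f \<in> (if d * e \<le> k then (\<lambda>g. \<phi> ^ e * g) ` monic_of_degree (k - d * e) else {})"
      using monic_of_degree_cofactor[OF \<phi>e, of g k] by auto
  next
    fix f assume "f \<in> (if d * e \<le> k then (\<lambda>g. \<phi> ^ e * g) ` monic_of_degree (k - d * e) else {})"
    then obtain g where "d * e \<le> k" "f = \<phi> ^ e * g" "g \<in> monic_of_degree (k - d * e)"
      by (auto split: if_splits)
    then show "f \<in> {f \<in> monic_of_degree k. \<phi> ^ e dvd f}"
      using monic_of_degree_mult[OF \<phi>e, of g "k - d * e"] by auto
  qed
  moreover have "inj_on (\<lambda>g. \<phi> ^ e * g) S" for S using nz by (auto intro: inj_onI)
  ultimately have "card {f \<in> monic_of_degree k. \<phi> ^ e dvd f} = (if d * e \<le> k then CARD('a) ^ (k - d * e) else 0)"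
    by (simp add: card_image card_monic_of_degree)
  then have avg: "poly_avg k (\<lambda>f. of_bool (\<phi> ^ e dvd f))
      = real (if d * e \<le> k then CARD('a) ^ (k - d * e) else 0) / real CARD('a) ^ k"
    unfolding poly_avg_def avg_def sum card_monic_of_degree by (simp only: of_nat_power)
  show ?thesis
  proof (cases "d * e \<le> k")
    case True
    then have "real CARD('a) ^ k = real CARD('a) ^ (k - d * e) * real CARD('a) ^ (d * e)"
      by (simp only: power_add[symmetric] le_add_diff_inverse2)
    then show ?thesis unfolding avg using True by (simp only: if_True of_nat_power) (simp add: power_one_over)
  qed (simp add: avg)
qed

lemma multiplicity_le_degree:
  fixes \<phi> :: "'a :: field_gcd poly"
  assumes "irreducible \<phi>" "f \<in> monic_of_degree n"
  shows "degree \<phi> * multiplicity \<phi> f \<le> n" "multiplicity \<phi> f \<le> n"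
proof -
  have "\<phi> ^ multiplicity \<phi> f dvd f" by (rule multiplicity_dvd)
  then have "degree (\<phi> ^ multiplicity \<phi> f) \<le> degree f"
    using monic_of_degree_nonzero[OF assms(2)] by (intro dvd_imp_degree_le) auto
  moreover have "\<phi> \<noteq> 0" using assms by auto
  ultimately show *: "degree \<phi> * multiplicity \<phi> f \<le> n"
    using assms(2) by (simp add: degree_power_eq monic_of_degree_def mult.commute)
  have "1 * multiplicity \<phi> f \<le> degree \<phi> * multiplicity \<phi> f"
    using irreducible_degree_pos[OF assms(1)] by (intro mult_right_mono) auto
  then show "multiplicity \<phi> f \<le> n" using * by linarith
qed

lemma power_dvd_iff_multiplicity:
  fixes \<phi> :: "'a :: field_gcd poly"
  assumes "irreducible \<phi>" "f \<noteq> 0"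
  shows "\<phi> ^ e dvd f \<longleftrightarrow> e \<le> multiplicity \<phi> f"
  using assms by (intro power_dvd_iff_le_multiplicity) (auto simp: irreducible_def)

text \<open>Reduces expectations of multiplicities to probabilities of divisibility.\<close>

lemma multiplicity_eq_sum:
  fixes \<phi> :: "'a :: field_gcd poly"
  assumes "irreducible \<phi>" "f \<in> monic_of_degree n"
  shows "real (multiplicity \<phi> f) = (\<Sum>e\<in>{1..n}. of_bool (\<phi> ^ e dvd f))"
proof -
  have "{1..n} \<inter> {e. e \<le> multiplicity \<phi> f} = {1..multiplicity \<phi> f}"
    using multiplicity_le_degree(2)[OF assms] by auto
  then show ?thesis
    using assms(1) monic_of_degree_nonzero[OF assms(2)]
    by (simp add: power_dvd_iff_multiplicity of_bool_def sum.If_cases)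
qed

text \<open>The weight is bounded by \<open>1\<close> plus a sum in which the term at the actual
  multiplicity already suffices. After averaging, \<open>?Q ^ e\<close> cancels the probability of
  divisibility by \<open>\<phi> ^ e\<close>, so each of the \<open>k\<close> terms is at most
  \<open>1\<close>.\<close>

lemma poly_avg_multiplicity_weight:
  fixes \<phi> :: "'a :: {finite, field_gcd} poly"
  assumes \<phi>: "irreducible \<phi>" "\<phi> \<in> monic_of_degree d"
  shows "poly_avg k (\<lambda>f. (real CARD('a) ^ d) ^ multiplicity \<phi> f) \<le> 1 + real k"
proof -
  let ?Q = "real CARD('a) ^ d"
  have "?Q ^ multiplicity \<phi> f \<le> 1 + (\<Sum>e\<in>{1..k}. ?Q ^ e * of_bool (\<phi> ^ e dvd f))"
    if f: "f \<in> monic_of_degree k" for f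
  proof (cases "multiplicity \<phi> f = 0")
    case True
    then show ?thesis by (auto intro!: sum_nonneg)
  next
    case False
    let ?m = "multiplicity \<phi> f"
    have "?m \<in> {1..k}" using False multiplicity_le_degree(2)[OF \<phi>(1) f] by auto
    then have "?Q ^ ?m * of_bool (\<phi> ^ ?m dvd f) \<le> (\<Sum>e\<in>{1..k}. ?Q ^ e * of_bool (\<phi> ^ e dvd f))"
      by (intro member_le_sum) auto
    then show ?thesis by (simp add: multiplicity_dvd)
  qed
  then have "poly_avg k (\<lambda>f. ?Q ^ multiplicity \<phi> f)
      \<le> poly_avg k (\<lambda>f. 1 + (\<Sum>e\<in>{1..k}. ?Q ^ e * of_bool (\<phi> ^ e dvd f)))"
    by (rule poly_avg_mono)
  also have "\<dots> = 1 + (\<Sum>e\<in>{1..k}. ?Q ^ e * poly_avg k (\<lambda>f. of_bool (\<phi> ^ e dvd f)))"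
    by (simp only: poly_avg_add poly_avg_sum poly_avg_cmult poly_avg_const)
  also have "\<dots> \<le> 1 + (\<Sum>e\<in>{1..k}. 1)"
  proof (intro add_left_mono sum_mono)
    fix e
    show "?Q ^ e * poly_avg k (\<lambda>f. of_bool (\<phi> ^ e dvd f)) \<le> 1"
      by (simp add: poly_avg_power_dvd[OF \<phi>(2)] power_mult power_one_over)
  qed
  finally show ?thesis by simp
qed

lemma mat_avg_recursion:
  fixes h :: "'a :: {finite, field} poly \<Rightarrow> real"
  assumes "n > 0"
  shows "mat_avg n h = (\<Sum>j<n. krylov_prob (1 / real CARD('a)) n j *
    poly_avg (n - j) (\<lambda>f. mat_avg j (\<lambda>g. h (f * g))))"
  using mat_avg_krylov_split[OF assms, of h] by (simp add: krylov_prob_def)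

lemma card_ge_2: "CARD('a :: {finite, zero_neq_one}) \<ge> 2"
proof -
  have "card {0, 1 :: 'a} \<le> CARD('a)" by (intro card_mono) auto
  then show ?thesis by simp
qed

text \<open>The limit \<open>4\<close> is the exponent of the constant \<open>exp 4\<close> in the
  bounds below.\<close>

lemma sum_linear_geometric: "(\<Sum>j<n. (real j + 1) / 2 ^ j) = 4 - (2 * real n + 4) / 2 ^ n"
  by (induction n) (auto simp: field_simps)

text \<open>A discrete Gronwall argument for the partial sums \<open>\<Sum>j<n. t ^ j * w j\<close> of the
  expectations \<open>w j\<close> of \<open>q ^ (d * multiplicity \<phi> f)\<close>.\<close>

lemma sum_mat_avg_weight_le:
  fixes \<phi> :: "'a :: {finite, field_gcd} poly"
  assumes \<phi>: "irreducible \<phi>" "\<phi> \<in> monic_of_degree d"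
  shows "(\<Sum>j<n. (1 / real CARD('a)) ^ j * mat_avg j (\<lambda>f. (real CARD('a) ^ d) ^ multiplicity \<phi> f)) \<le> exp 4"
proof -
  define t where "t = 1 / real CARD('a)"
  define Q where "Q = real CARD('a) ^ d"
  define w where "w j = mat_avg j (\<lambda>f :: 'a poly. Q ^ multiplicity \<phi> f)" for j
  have t: "0 \<le> t" "t \<le> 1 / 2" using card_ge_2[where 'a = 'a] by (auto simp: t_def field_simps)
  have Q: "Q \<ge> 0" by (simp add: Q_def)
  have w0: "w j \<ge> 0" for j
    using mat_avg_mono[of j "\<lambda>_. 0" "\<lambda>f :: 'a poly. Q ^ multiplicity \<phi> f"] Q by (simp add: w_def)
  have prime: "prime_elem \<phi>" using \<phi> by (simp add: irreducible_imp_prime_elem)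
  \<comment> \<open>Additivity of the multiplicity makes the weight multiplicative, so the uniform
    factor splits off with expectation at most \<open>1 + n\<close>, and the Krylov probabilities
    are at most \<open>t ^ j\<close>.\<close>
  have w: "w n \<le> (1 + real n) * (\<Sum>j<n. t ^ j * w j)" if "n > 0" for n
  proof -
    have "w n = (\<Sum>j<n. krylov_prob t n j *
        poly_avg (n - j) (\<lambda>f. mat_avg j (\<lambda>g. Q ^ multiplicity \<phi> (f * g))))"
      unfolding w_def t_def by (rule mat_avg_recursion[OF that])
    also have "\<dots> = (\<Sum>j<n. krylov_prob t n j * (poly_avg (n - j) (\<lambda>f. Q ^ multiplicity \<phi> f) * w j))"
    proof (intro sum.cong arg_cong2[where f = "(*)"] refl)
      fix j
      have "poly_avg (n - j) (\<lambda>f. mat_avg j (\<lambda>g. Q ^ multiplicity \<phi> (f * g)))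
          = poly_avg (n - j) (\<lambda>f. mat_avg j (\<lambda>g. Q ^ multiplicity \<phi> f * Q ^ multiplicity \<phi> g))"
        by (intro poly_avg_cong mat_avg_cong)
          (simp add: prime_elem_multiplicity_mult_distrib[OF prime] monic_of_degree_nonzero power_add)
      then show "poly_avg (n - j) (\<lambda>f. mat_avg j (\<lambda>g. Q ^ multiplicity \<phi> (f * g)))
          = poly_avg (n - j) (\<lambda>f. Q ^ multiplicity \<phi> f) * w j"
        by (simp add: mat_avg_cmult w_def poly_avg_cmult mult.commute[of _ "mat_avg j _"])
    qed
    also have "\<dots> \<le> (\<Sum>j<n. t ^ j * ((1 + real n) * w j))"
    proof (intro sum_mono mult_mono krylov_prob_le mult_right_mono w0)
      fix j
      show "poly_avg (n - j) (\<lambda>f. Q ^ multiplicity \<phi> f) \<le> 1 + real n"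
        using poly_avg_multiplicity_weight[OF \<phi>, of "n - j"] unfolding Q_def by linarith
      have "0 \<le> poly_avg (n - j) (\<lambda>f. Q ^ multiplicity \<phi> f)"
        using poly_avg_mono[of "n - j" "\<lambda>_. 0" "\<lambda>f :: 'a poly. Q ^ multiplicity \<phi> f"] Q by simp
      then show "0 \<le> poly_avg (n - j) (\<lambda>f. Q ^ multiplicity \<phi> f) * w j" using w0 by simp
    qed (use t in auto)
    finally show ?thesis by (simp add: sum_distrib_left mult_ac)
  qed
  have "(\<Sum>j<n. t ^ j * w j) \<le> exp (\<Sum>j<n. (real j + 1) / 2 ^ j)"
  proof (induction n)
    case (Suc n)
    show ?case
    proof (cases "n = 0")
      case True
      then show ?thesis by (simp add: w_def mat_avg_0)
    next
      case False
      let ?S = "\<Sum>j<n. t ^ j * w j" and ?c = "(real n + 1) / 2 ^ n"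
      have "t ^ n \<le> (1 / 2) ^ n" using t by (intro power_mono)
      then have tn: "t ^ n * (1 + real n) \<le> ?c"
        using mult_right_mono[of "t ^ n" "(1 / 2) ^ n" "1 + real n"] by (simp add: power_one_over add.commute)
      have S0: "?S \<ge> 0" using t w0 by (intro sum_nonneg) auto
      have "t ^ n * w n \<le> t ^ n * ((1 + real n) * ?S)"
        using w[of n] False t by (intro mult_left_mono) auto
      also have "\<dots> \<le> ?c * ?S" using mult_right_mono[OF tn S0] by (simp add: mult.assoc)
      finally have "(\<Sum>j<Suc n. t ^ j * w j) \<le> ?S * (1 + ?c)" by (simp add: algebra_simps)
      also have "\<dots> \<le> exp (\<Sum>j<n. (real j + 1) / 2 ^ j) * exp ?c"
        using Suc.IH S0 exp_ge_add_one_self[of ?c] by (intro mult_mono) auto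
      finally show ?thesis by (simp add: exp_add[symmetric])
    qed
  qed simp
  also have "\<dots> \<le> exp 4" unfolding sum_linear_geometric by simp
  finally show ?thesis by (simp add: t_def w_def Q_def)
qed

text \<open>Given the complementary factor \<open>g\<close>, the uniform factor only has to supply
  the missing powers of \<open>\<phi>\<close>, at a probability of at most
  \<open>t ^ (d * e) * Q ^ multiplicity \<phi> g\<close>. Summing over the size of the complementary
  block leaves the weights bounded by \<open>sum_mat_avg_weight_le\<close>. Up to a constant free of
  \<open>n\<close>, \<open>\<phi>\<close> and \<open>e\<close>, the bound is that for uniform
  polynomials.\<close>

lemma mat_avg_power_dvd_le:
  fixes \<phi> :: "'a :: {finite, field_gcd} poly"
  assumes \<phi>: "irreducible \<phi>" "\<phi> \<in> monic_of_degree d" and e: "e > 0"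
  shows "mat_avg n (\<lambda>f. of_bool (\<phi> ^ e dvd f)) \<le> exp 4 * (1 / real CARD('a)) ^ (d * e)"
proof (cases "n = 0")
  case True
  have "\<not> \<phi> dvd 1" using \<phi> irreducible_not_unit by blast
  then have "\<not> \<phi> ^ e dvd 1" using e is_unit_power_iff[of \<phi> e] by blast
  then show ?thesis unfolding True mat_avg_0 of_bool_def by (simp only: if_False) simp
next
  case False
  define t where "t = 1 / real CARD('a)"
  define Q where "Q = real CARD('a) ^ d"
  have t: "0 < t" "t \<le> 1" using card_ge_2[where 'a = 'a] by (auto simp: t_def field_simps)
  have tQ: "t ^ d * Q = 1" by (simp add: t_def Q_def power_one_over)
  have Q1: "Q \<ge> 1" using card_ge_2[where 'a = 'a] by (simp add: Q_def)
  have prime: "prime_elem \<phi>" using \<phi> by (simp add: irreducible_imp_prime_elem)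
  have cofactor: "poly_avg k (\<lambda>f. of_bool (\<phi> ^ e dvd f * g)) \<le> t ^ (d * e) * Q ^ multiplicity \<phi> g"
    if g: "g \<in> monic_of_degree m" for g k m
  proof -
    let ?m = "multiplicity \<phi> g"
    have te: "t ^ (d * e) * Q ^ i = t ^ (d * (e - i))" if "i \<le> e" for i
    proof -
      have "t ^ (d * e) = t ^ (d * (e - i)) * (t ^ d) ^ i"
        using that unfolding power_mult[symmetric] power_add[symmetric] distrib_left[symmetric] by simp
      then show ?thesis by (simp add: mult.assoc power_mult_distrib[symmetric] tQ)
    qed
    \<comment> \<open>The subtraction is truncated: if \<open>g\<close> is already divisible by
      \<open>\<phi> ^ e\<close>, nothing is missing and the bound to be proved is at least
      \<open>1\<close>.\<close>
    have "poly_avg k (\<lambda>f. of_bool (\<phi> ^ e dvd f * g)) \<le> poly_avg k (\<lambda>f. of_bool (\<phi> ^ (e - ?m) dvd f))"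
    proof (rule poly_avg_mono)
      fix f :: "'a poly" assume "f \<in> monic_of_degree k"
      then have "f \<noteq> 0" "g \<noteq> 0" using g monic_of_degree_nonzero by auto
      then show "of_bool (\<phi> ^ e dvd f * g) \<le> (of_bool (\<phi> ^ (e - ?m) dvd f) :: real)"
        by (auto simp: power_dvd_iff_multiplicity[OF \<phi>(1)] prime_elem_multiplicity_mult_distrib[OF prime])
    qed
    also have "\<dots> \<le> t ^ (d * (e - ?m))" using t by (simp add: poly_avg_power_dvd[OF \<phi>(2)] t_def)
    also have "\<dots> \<le> t ^ (d * e) * Q ^ ?m"
    proof (cases "?m \<le> e")
      case False
      then have "Q ^ e \<le> Q ^ ?m" using Q1 by (intro power_increasing) auto
      then have "t ^ (d * e) * Q ^ e \<le> t ^ (d * e) * Q ^ ?m" using t by (intro mult_left_mono) auto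
      then show ?thesis using te[of e] False by simp
    qed (simp add: te)
    finally show ?thesis .
  qed
  have "mat_avg n (\<lambda>f. of_bool (\<phi> ^ e dvd f)) = (\<Sum>j<n. krylov_prob t n j *
      mat_avg j (\<lambda>g. poly_avg (n - j) (\<lambda>f. of_bool (\<phi> ^ e dvd f * g))))"
    using mat_avg_recursion[of n "\<lambda>f. of_bool (\<phi> ^ e dvd f)"] False
    by (simp add: t_def poly_avg_mat_avg_swap)
  also have "\<dots> \<le> (\<Sum>j<n. t ^ j * (t ^ (d * e) * mat_avg j (\<lambda>g. Q ^ multiplicity \<phi> g)))"
  proof (intro sum_mono mult_mono krylov_prob_le)
    fix j
    show "mat_avg j (\<lambda>g. poly_avg (n - j) (\<lambda>f. of_bool (\<phi> ^ e dvd f * g)))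
        \<le> t ^ (d * e) * mat_avg j (\<lambda>g. Q ^ multiplicity \<phi> g)"
      unfolding mat_avg_cmult[symmetric] using cofactor by (rule mat_avg_mono)
    have "mat_avg j (\<lambda>_ :: 'a poly. poly_avg (n - j) (\<lambda>_ :: 'a poly. 0))
        \<le> mat_avg j (\<lambda>g. poly_avg (n - j) (\<lambda>f. of_bool (\<phi> ^ e dvd f * g)))"
      by (intro mat_avg_mono poly_avg_mono) simp
    then show "0 \<le> mat_avg j (\<lambda>g. poly_avg (n - j) (\<lambda>f. of_bool (\<phi> ^ e dvd f * g)))" by simp
  qed (use t in auto)
  also have "\<dots> = t ^ (d * e) * (\<Sum>j<n. t ^ j * mat_avg j (\<lambda>g. Q ^ multiplicity \<phi> g))"
    by (simp add: sum_distrib_left mult_ac)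
  also have "\<dots> \<le> t ^ (d * e) * exp 4"
    using sum_mat_avg_weight_le[OF \<phi>, of n] t by (intro mult_left_mono) (auto simp: t_def Q_def)
  finally show ?thesis by (simp add: t_def mult.commute)
qed

section \<open>The contribution of prime powers of degree above \<open>r\<close>\<close>

text \<open>A union bound over powers \<open>\<phi> ^ e\<close> with
  \<open>degree \<phi> \<le> r < degree (\<phi> ^ e)\<close>: the factor \<open>q ^ d\<close> bounds
  the number of \<open>\<phi>\<close> of degree \<open>d\<close>, and \<open>d * e\<close> is the
  degree charged to the power.\<close>

definition excess :: "real \<Rightarrow> nat \<Rightarrow> nat \<Rightarrow> real" where
  "excess q r n = (\<Sum>d\<in>{1..r}. q ^ d * (\<Sum>e\<in>{e \<in> {1..n}. r < d * e}. real (d * e) * (1 / q) ^ (d * e)))"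

text \<open>One factor \<open>l\<close> is the charged degree \<open>d * e = l\<close>; the other
  bounds the number of pairs with that product. The base \<open>3 / 4\<close> comes from
  \<open>1 / q \<le> 9 / 16\<close>, as only half of the exponent survives.\<close>

definition geom_tail :: "nat \<Rightarrow> real" where
  "geom_tail r = (\<Sum>l. real l ^ 2 * (3 / 4) ^ l) - (\<Sum>l\<le>r. real l ^ 2 * (3 / 4) ^ l)"

lemma summable_sq_geometric: "summable (\<lambda>l. real l ^ 2 * (3 / 4) ^ l)"
proof (rule summable_comparison_test_bigo)
  show "summable (\<lambda>l. norm ((4 / 5 :: real) ^ l))" by (simp add: summable_geometric)
  show "(\<lambda>l. real l ^ 2 * (3 / 4) ^ l) \<in> O(\<lambda>l. (4 / 5 :: real) ^ l)" by real_asymp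
qed

lemma geom_tail_tendsto_0: "geom_tail \<longlonglongrightarrow> 0"
proof -
  have "(\<lambda>r. (\<Sum>l. real l ^ 2 * (3 / 4) ^ l) - (\<Sum>l\<le>r. real l ^ 2 * (3 / 4) ^ l)) \<longlonglongrightarrow>
      (\<Sum>l. real l ^ 2 * (3 / 4) ^ l) - (\<Sum>l. real l ^ 2 * (3 / 4) ^ l)"
    by (intro tendsto_diff tendsto_const summable_LIMSEQ' summable_sq_geometric)
  then show ?thesis unfolding geom_tail_def[abs_def] by simp
qed

lemma sum_le_geom_tail:
  assumes "finite L" "\<And>l. l \<in> L \<Longrightarrow> r < l"
  shows "(\<Sum>l\<in>L. real l ^ 2 * (3 / 4) ^ l) \<le> geom_tail r"
proof -
  have "(\<Sum>l\<in>L. real l ^ 2 * (3 / 4) ^ l) + (\<Sum>l\<le>r. real l ^ 2 * (3 / 4) ^ l)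
      = (\<Sum>l\<in>L \<union> {..r}. real l ^ 2 * (3 / 4) ^ l)"
    using assms by (subst sum.union_disjoint) (auto simp: not_le[symmetric])
  also have "\<dots> \<le> (\<Sum>l. real l ^ 2 * (3 / 4) ^ l)"
    using assms(1) by (intro sum_le_suminf summable_sq_geometric) auto
  finally show ?thesis by (simp add: geom_tail_def)
qed

text \<open>The count \<open>q ^ d\<close> uses up one of the \<open>e\<close> powers, leaving the
  exponent \<open>d * (e - 1)\<close>, which is at least \<open>d * e / 2\<close>. The terms are
  then grouped by \<open>l = d * e\<close>.\<close>

lemma excess_le_geom_tail:
  assumes q: "q \<ge> 2"
  shows "excess q r n \<le> geom_tail r"
proof -
  let ?P = "SIGMA d:{1..r}. {e \<in> {1..n}. r < d * e}"
  let ?g = "\<lambda>l. real l * (3 / 4) ^ l"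
  have "excess q r n \<le> (\<Sum>d\<in>{1..r}. \<Sum>e\<in>{e \<in> {1..n}. r < d * e}. ?g (d * e))"
    unfolding excess_def sum_distrib_left
  proof (intro sum_mono)
    fix d e assume d: "d \<in> {1..r}" and e: "e \<in> {e \<in> {1..n}. r < d * e}"
    \<comment> \<open>\<open>d \<le> r < d * e\<close> excludes \<open>e = 1\<close>.\<close>
    then have "e \<ge> 2" by (cases e rule: nat.exhaust; cases "e - 1") auto
    then obtain i where "e = i + 2" by (metis add.commute le_Suc_ex)
    then have de: "d * e = d + d * (e - 1)" "d * e \<le> 2 * (d * (e - 1))"
      by (auto simp: algebra_simps)
    have "q ^ d * (1 / q) ^ (d * e) = (1 / q) ^ (d * (e - 1))"
      using q unfolding de(1) power_add by (simp add: power_one_over)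
    also have "\<dots> \<le> (9 / 16) ^ (d * (e - 1))"
      using q by (intro power_mono) (auto simp: field_simps)
    also have "\<dots> = (3 / 4) ^ (2 * (d * (e - 1)))"
      by (simp add: power_mult power2_eq_square)
    also have "\<dots> \<le> (3 / 4) ^ (d * e)" using de(2) by (intro power_decreasing) auto
    finally have "real (d * e) * (q ^ d * (1 / q) ^ (d * e)) \<le> ?g (d * e)"
      by (intro mult_left_mono) auto
    then show "q ^ d * (real (d * e) * (1 / q) ^ (d * e)) \<le> ?g (d * e)" by (simp only: mult.left_commute)
  qed
  also have "\<dots> = (\<Sum>x\<in>?P. ?g (fst x * snd x))" by (subst sum.Sigma) (auto simp: split_beta)
  also have "\<dots> = (\<Sum>l\<in>{r<..r * n}. \<Sum>x\<in>{x \<in> ?P. fst x * snd x = l}. ?g (fst x * snd x))"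
    by (intro sum.group[symmetric]) (auto intro!: mult_le_mono)
  also have "\<dots> \<le> (\<Sum>l\<in>{r<..r * n}. real l ^ 2 * (3 / 4) ^ l)"
  proof (rule sum_mono)
    fix l assume l: "l \<in> {r<..r * n}"
    let ?L = "{x \<in> ?P. fst x * snd x = l}"
    have "inj_on fst ?L" by (auto simp: inj_on_def)
    moreover have "fst ` ?L \<subseteq> {1..l}"
    proof
      fix d assume "d \<in> fst ` ?L"
      then obtain e where "1 \<le> d" "1 \<le> e" "d * e = l" by auto
      then show "d \<in> {1..l}" using mult_le_mono2[of 1 e d] by simp
    qed
    ultimately have "card ?L \<le> card {1..l}" by (rule card_inj_on_le) simp
    then have "card ?L \<le> l" by simp
    have "(\<Sum>x\<in>?L. ?g (fst x * snd x)) = real (card ?L) * ?g l" by simp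
    also have "\<dots> \<le> real l * ?g l" using \<open>card ?L \<le> l\<close> by (intro mult_right_mono) auto
    finally show "(\<Sum>x\<in>?L. ?g (fst x * snd x)) \<le> real l ^ 2 * (3 / 4) ^ l"
      by (simp add: power2_eq_square mult.assoc)
  qed
  also have "\<dots> \<le> geom_tail r" by (rule sum_le_geom_tail) auto
  finally show ?thesis .
qed

lemma sum_irr_polys_le:
  assumes "\<And>d. g d \<ge> 0"
  shows "(\<Sum>\<phi>\<in>(irr_polys r :: 'a :: {finite, field_gcd} poly set). g (degree \<phi>)) \<le> (\<Sum>d\<in>{1..r}. real CARD('a) ^ d * g d)"
proof -
  let ?I = "irr_polys r :: 'a poly set"
  have "(\<Sum>\<phi>\<in>?I. g (degree \<phi>)) = (\<Sum>d\<in>{1..r}. \<Sum>\<phi>\<in>{\<phi> \<in> ?I. degree \<phi> = d}. g (degree \<phi>))"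
  proof (rule sum.group[symmetric])
    show "degree ` ?I \<subseteq> {1..r}" by (auto simp: irr_polys_def Suc_le_eq irreducible_degree_pos)
  qed simp_all
  also have "\<dots> \<le> (\<Sum>d\<in>{1..r}. real CARD('a) ^ d * g d)"
  proof (rule sum_mono)
    fix d
    have "card {\<phi> \<in> ?I. degree \<phi> = d} \<le> card (monic_of_degree d :: 'a poly set)"
      by (rule card_mono, simp) (auto simp: irr_polys_def monic_of_degree_def)
    then have "real (card {\<phi> \<in> ?I. degree \<phi> = d}) \<le> real CARD('a) ^ d"
      unfolding card_monic_of_degree of_nat_power[symmetric] by (simp only: of_nat_le_iff)
    then show "(\<Sum>\<phi>\<in>{\<phi> \<in> ?I. degree \<phi> = d}. g (degree \<phi>)) \<le> real CARD('a) ^ d * g d"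
      using assms[of d] by (simp add: mult_right_mono)
  qed
  finally show ?thesis .
qed

text \<open>Each bad \<open>\<phi>\<close> is charged to the single exponent
  \<open>e = multiplicity \<phi> f\<close>, for which \<open>\<phi> ^ e\<close> does divide
  \<open>f\<close>; the indicator sum over all exponents dominates this.\<close>

lemma mat_avg_bad_part_le:
  "mat_avg n (\<lambda>f :: 'a :: {finite, field_gcd} poly. real (bad_part r f)) \<le> exp 4 * excess (real CARD('a)) r n"
proof -
  let ?E = "\<lambda>d. {e \<in> {1..n}. r < d * e}" and ?t = "1 / real CARD('a)"
  have "real (bad_part r f) \<le> (\<Sum>\<phi>\<in>irr_polys r. \<Sum>e\<in>?E (degree \<phi>). real (degree \<phi> * e) * of_bool (\<phi> ^ e dvd f))"
    if f: "f \<in> monic_of_degree n" for f :: "'a poly"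
  proof -
    have "real (bad_part r f) = (\<Sum>\<phi>\<in>{\<phi> \<in> irr_polys r. r < degree \<phi> * multiplicity \<phi> f}. real (degree \<phi> * multiplicity \<phi> f))"
      by (simp add: bad_part_def)
    also have "\<dots> \<le> (\<Sum>\<phi>\<in>{\<phi> \<in> irr_polys r. r < degree \<phi> * multiplicity \<phi> f}.
        \<Sum>e\<in>?E (degree \<phi>). real (degree \<phi> * e) * of_bool (\<phi> ^ e dvd f))"
    proof (rule sum_mono)
      fix \<phi> assume \<phi>: "\<phi> \<in> {\<phi> \<in> irr_polys r. r < degree \<phi> * multiplicity \<phi> f}"
      then have irr: "irreducible \<phi>" by (simp add: irr_polys_def)
      have "multiplicity \<phi> f \<noteq> 0" using \<phi> by (intro notI) simp
      then have "multiplicity \<phi> f \<in> ?E (degree \<phi>)"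
        using multiplicity_le_degree(2)[OF irr f] \<phi> by auto
      then have "real (degree \<phi> * multiplicity \<phi> f) * of_bool (\<phi> ^ multiplicity \<phi> f dvd f)
          \<le> (\<Sum>e\<in>?E (degree \<phi>). real (degree \<phi> * e) * of_bool (\<phi> ^ e dvd f))"
        by (rule member_le_sum) auto
      then show "real (degree \<phi> * multiplicity \<phi> f)
          \<le> (\<Sum>e\<in>?E (degree \<phi>). real (degree \<phi> * e) * of_bool (\<phi> ^ e dvd f))"
        by (simp only: multiplicity_dvd of_bool_def if_True mult_1_right)
    qed
    also have "\<dots> \<le> (\<Sum>\<phi>\<in>irr_polys r. \<Sum>e\<in>?E (degree \<phi>). real (degree \<phi> * e) * of_bool (\<phi> ^ e dvd f))"
      by (intro sum_mono2) (auto intro!: sum_nonneg)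
    finally show ?thesis .
  qed
  then have "mat_avg n (\<lambda>f :: 'a poly. real (bad_part r f))
      \<le> mat_avg n (\<lambda>f :: 'a poly. \<Sum>\<phi>\<in>irr_polys r. \<Sum>e\<in>?E (degree \<phi>). real (degree \<phi> * e) * of_bool (\<phi> ^ e dvd f))"
    by (rule mat_avg_mono)
  also have "\<dots> = (\<Sum>\<phi>\<in>irr_polys r. \<Sum>e\<in>?E (degree \<phi>). real (degree \<phi> * e) * mat_avg n (\<lambda>f :: 'a poly. of_bool (\<phi> ^ e dvd f)))"
    by (simp only: mat_avg_sum mat_avg_cmult)
  also have "\<dots> \<le> (\<Sum>\<phi>\<in>(irr_polys r :: 'a poly set). \<Sum>e\<in>?E (degree \<phi>). real (degree \<phi> * e) * (exp 4 * ?t ^ (degree \<phi> * e)))"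
    by (intro sum_mono mult_left_mono mat_avg_power_dvd_le) (auto simp: irr_polys_def monic_of_degree_def)
  also have "\<dots> \<le> (\<Sum>d\<in>{1..r}. real CARD('a) ^ d * (\<Sum>e\<in>?E d. real (d * e) * (exp 4 * ?t ^ (d * e))))"
    by (rule sum_irr_polys_le) (auto intro!: sum_nonneg)
  also have "\<dots> = exp 4 * excess (real CARD('a)) r n"
    unfolding excess_def sum_distrib_left by (simp only: mult_ac)
  finally show ?thesis .
qed

lemma poly_avg_small_part_le_r:
  assumes "k \<le> r"
  shows "poly_avg k (\<lambda>f :: 'a :: {finite, field_gcd} poly. real (small_part r f)) = real k"
proof -
  have "poly_avg k (\<lambda>f :: 'a poly. real (small_part r f)) = poly_avg k (\<lambda>f :: 'a poly. real k)"
    using assms by (intro poly_avg_cong) (simp add: small_part_bounds)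
  then show ?thesis by simp
qed

lemma poly_avg_small_part_eq:
  "poly_avg k (\<lambda>f :: 'a :: {finite, field_gcd} poly. real (small_part r f))
    = (\<Sum>\<phi>\<in>(irr_polys r :: 'a poly set). \<Sum>e\<in>{e \<in> {1..k}. degree \<phi> * e \<le> k}. real (degree \<phi>) * (1 / real CARD('a)) ^ (degree \<phi> * e))"
proof -
  have "poly_avg k (\<lambda>f :: 'a poly. real (small_part r f))
      = poly_avg k (\<lambda>f :: 'a poly. \<Sum>\<phi>\<in>irr_polys r. \<Sum>e\<in>{1..k}. real (degree \<phi>) * of_bool (\<phi> ^ e dvd f))"
    by (intro poly_avg_cong)
      (auto simp: small_part_def multiplicity_eq_sum irr_polys_def sum_distrib_left intro!: sum.cong)
  also have "\<dots> = (\<Sum>\<phi>\<in>irr_polys r. \<Sum>e\<in>{1..k}. real (degree \<phi>) * poly_avg k (\<lambda>f :: 'a poly. of_bool (\<phi> ^ e dvd f)))"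
    by (simp only: poly_avg_sum poly_avg_cmult)
  also have "\<dots> = (\<Sum>\<phi>\<in>(irr_polys r :: 'a poly set). \<Sum>e\<in>{1..k}. if degree \<phi> * e \<le> k then real (degree \<phi>) * (1 / real CARD('a)) ^ (degree \<phi> * e) else 0)"
    by (intro sum.cong refl) (auto simp: irr_polys_def monic_of_degree_def poly_avg_power_dvd)
  also have "\<dots> = (\<Sum>\<phi>\<in>(irr_polys r :: 'a poly set). \<Sum>e\<in>{e \<in> {1..k}. degree \<phi> * e \<le> k}. real (degree \<phi>) * (1 / real CARD('a)) ^ (degree \<phi> * e))"
    by (rule sum.cong[OF refl], rule sum.inter_filter[symmetric]) simp
  finally show ?thesis .
qed

text \<open>The exact formula for degree \<open>k\<close> splits at
  \<open>degree \<phi> * e \<le> r\<close>. The lower part is the same formula for degree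
  \<open>r\<close>, where all factors are small and the average is \<open>r\<close>. What remains is
  nonnegative and bounded by \<open>excess\<close>.\<close>

lemma poly_avg_small_part_bounds:
  assumes "r \<le> k"
  shows "real r \<le> poly_avg k (\<lambda>f :: 'a :: {finite, field_gcd} poly. real (small_part r f))"
    "poly_avg k (\<lambda>f :: 'a poly. real (small_part r f)) \<le> real r + excess (real CARD('a)) r k"
proof -
  let ?g = "\<lambda>d e. real d * (1 / real CARD('a)) ^ (d * e)"
  let ?I = "irr_polys r :: 'a poly set" and ?E = "\<lambda>d. {e \<in> {1..k}. r < d * e \<and> d * e \<le> k}"
  have "poly_avg k (\<lambda>f :: 'a poly. real (small_part r f))
      = (\<Sum>\<phi>\<in>?I. (\<Sum>e\<in>{e \<in> {1..r}. degree \<phi> * e \<le> r}. ?g (degree \<phi>) e) + (\<Sum>e\<in>?E (degree \<phi>). ?g (degree \<phi>) e))"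
    unfolding poly_avg_small_part_eq
  proof (rule sum.cong)
    fix \<phi> assume "\<phi> \<in> ?I"
    then have d: "degree \<phi> > 0" by (simp add: irr_polys_def irreducible_degree_pos)
    have le: "e \<le> degree \<phi> * e" for e using d by simp
    have "{e \<in> {1..k}. degree \<phi> * e \<le> k} = {e \<in> {1..r}. degree \<phi> * e \<le> r} \<union> ?E (degree \<phi>)"
    proof (rule Set.set_eqI)
      fix e
      show "e \<in> {e \<in> {1..k}. degree \<phi> * e \<le> k} \<longleftrightarrow> e \<in> {e \<in> {1..r}. degree \<phi> * e \<le> r} \<union> ?E (degree \<phi>)"
      proof (cases "degree \<phi> * e \<le> r")
        case True
        then have "e \<le> r" using le[of e] by (rule order_trans[rotated])
        then show ?thesis using True assms by auto
      qed auto
    qed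
    then show "(\<Sum>e\<in>{e \<in> {1..k}. degree \<phi> * e \<le> k}. ?g (degree \<phi>) e)
        = (\<Sum>e\<in>{e \<in> {1..r}. degree \<phi> * e \<le> r}. ?g (degree \<phi>) e) + (\<Sum>e\<in>?E (degree \<phi>). ?g (degree \<phi>) e)"
      by (simp only:) (subst sum.union_disjoint; auto)
  qed simp
  also have "\<dots> = real r + (\<Sum>\<phi>\<in>?I. \<Sum>e\<in>?E (degree \<phi>). ?g (degree \<phi>) e)"
    using poly_avg_small_part_le_r[of r r, where 'a = 'a] unfolding poly_avg_small_part_eq
    by (simp add: sum.distrib)
  finally have eq: "poly_avg k (\<lambda>f :: 'a poly. real (small_part r f))
      = real r + (\<Sum>\<phi>\<in>?I. \<Sum>e\<in>?E (degree \<phi>). ?g (degree \<phi>) e)" .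
  have "0 \<le> (\<Sum>\<phi>\<in>?I. \<Sum>e\<in>?E (degree \<phi>). ?g (degree \<phi>) e)"
    by (intro sum_nonneg) auto
  then show "real r \<le> poly_avg k (\<lambda>f :: 'a poly. real (small_part r f))" unfolding eq by simp
  have "(\<Sum>\<phi>\<in>?I. \<Sum>e\<in>?E (degree \<phi>). ?g (degree \<phi>) e)
      \<le> (\<Sum>d\<in>{1..r}. real CARD('a) ^ d * (\<Sum>e\<in>?E d. ?g d e))"
    by (rule sum_irr_polys_le) (auto intro!: sum_nonneg)
  also have "\<dots> \<le> excess (real CARD('a)) r k"
    unfolding excess_def
  proof (intro sum_mono mult_left_mono)
    fix d assume "d \<in> {1..r}"
    have "(\<Sum>e\<in>?E d. ?g d e) \<le> (\<Sum>e\<in>?E d. real (d * e) * (1 / real CARD('a)) ^ (d * e))"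
    proof (intro sum_mono mult_right_mono)
      fix e assume "e \<in> ?E d"
      then have "d \<le> d * e" using mult_le_mono2[of 1 e d] by simp
      then show "real d \<le> real (d * e)" by (simp only: of_nat_le_iff)
    qed simp
    also have "\<dots> \<le> (\<Sum>e\<in>{e \<in> {1..k}. r < d * e}. real (d * e) * (1 / real CARD('a)) ^ (d * e))"
      by (intro sum_mono2) auto
    finally show "(\<Sum>e\<in>?E d. ?g d e) \<le> (\<Sum>e\<in>{e \<in> {1..k}. r < d * e}. real (d * e) * (1 / real CARD('a)) ^ (d * e))" .
  qed simp
  finally show "poly_avg k (\<lambda>f :: 'a poly. real (small_part r f)) \<le> real r + excess (real CARD('a)) r k"
    unfolding eq by simp
qed

section \<open>The law of the codimension and the Pochhammer series\<close>

definition partial_poch :: "real \<Rightarrow> nat \<Rightarrow> nat \<Rightarrow> real" where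
  "partial_poch t n m = (\<Prod>i\<in>{m..<n}. 1 - t ^ i)"

text \<open>Writing \<open>t ^ j\<close> as \<open>1 - (1 - t ^ j)\<close> gives a difference of
  consecutive products. Thus \<open>partial_poch t n m\<close> is the probability of a codimension
  below \<open>m\<close>.\<close>

lemma krylov_prob_telescope:
  assumes "j < n"
  shows "krylov_prob t n j = partial_poch t n (Suc j) - partial_poch t n j"
proof -
  have "{j..<n} = insert j {j<..<n}" "{Suc j..<n} = {j<..<n}" using assms by auto
  then show ?thesis by (simp add: krylov_prob_def partial_poch_def algebra_simps)
qed

lemma partial_poch_self [simp]: "partial_poch t n n = 1"
  by (simp add: partial_poch_def)

lemma partial_poch_0: "0 < n \<Longrightarrow> partial_poch t n 0 = 0"
  by (auto simp: partial_poch_def intro!: bexI[of _ 0])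

lemma sum_krylov_prob_ge:
  assumes "m \<le> n"
  shows "(\<Sum>j\<in>{m..<n}. krylov_prob t n j) = 1 - partial_poch t n m"
proof -
  have "(\<Sum>j\<in>{m..<n}. krylov_prob t n j) = (\<Sum>j\<in>{m..<n}. partial_poch t n (Suc j) - partial_poch t n j)"
    by (intro sum.cong) (auto simp: krylov_prob_telescope)
  also have "\<dots> = partial_poch t n n - partial_poch t n m" using assms by (rule sum_Suc_diff')
  finally show ?thesis by simp
qed

lemma sum_krylov_prob: "0 < n \<Longrightarrow> (\<Sum>j<n. krylov_prob t n j) = 1"
  using sum_krylov_prob_ge[of 0 n t] by (simp add: partial_poch_0 lessThan_atLeast0)

text \<open>Tail-sum formula for the expectation of the codimension cut off at \<open>s\<close>. The
  cut at \<open>n\<close> gives the upper estimate, the cut at \<open>n - r\<close> the lower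
  one.\<close>

lemma sum_krylov_prob_min:
  assumes "s \<le> n"
  shows "(\<Sum>j<n. krylov_prob t n j * real (min j s)) = (\<Sum>m\<in>{1..s}. 1 - partial_poch t n m)"
proof -
  have "real (min j s) = (\<Sum>m\<in>{1..s}. if m \<le> j then 1 else 0)" for j
  proof -
    have "{1..s} \<inter> {m. m \<le> j} = {1..min j s}" by auto
    then show ?thesis by (simp add: sum.If_cases)
  qed
  then have "(\<Sum>j<n. krylov_prob t n j * real (min j s))
      = (\<Sum>j<n. \<Sum>m\<in>{1..s}. if m \<le> j then krylov_prob t n j else 0)"
    by (simp add: sum_distrib_left if_distrib cong: if_cong)
  also have "\<dots> = (\<Sum>m\<in>{1..s}. \<Sum>j<n. if m \<le> j then krylov_prob t n j else 0)" by (rule sum.swap)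
  also have "\<dots> = (\<Sum>m\<in>{1..s}. \<Sum>j\<in>{m..<n}. krylov_prob t n j)"
  proof (rule sum.cong[OF refl])
    fix m
    have "{..<n} \<inter> {j. m \<le> j} = {m..<n}" by auto
    then show "(\<Sum>j<n. if m \<le> j then krylov_prob t n j else 0) = (\<Sum>j\<in>{m..<n}. krylov_prob t n j)"
      by (simp add: sum.If_cases)
  qed
  also have "\<dots> = (\<Sum>m\<in>{1..s}. 1 - partial_poch t n m)"
    using assms by (intro sum.cong) (auto simp: sum_krylov_prob_ge)
  finally show ?thesis .
qed

context
  fixes t :: real
  assumes t: "0 < t" "t \<le> 1 / 2"
begin

lemma partial_poch_bounds: "0 \<le> partial_poch t n m" "partial_poch t n m \<le> 1"
  using t by (auto simp: partial_poch_def power_le_one intro!: prod_nonneg prod_le_1)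

lemma sum_geometric_tail_le: "(\<Sum>i\<in>{m..<n}. t ^ i) \<le> 2 * t ^ m"
proof (cases "m \<le> n")
  case True
  have "(1 - t) * (\<Sum>i\<in>{m..<n}. t ^ i) = t ^ m - t ^ n"
    using True
  proof (induction n rule: dec_induct)
    case (step i)
    have "(1 - t) * (\<Sum>i\<in>{m..<Suc i}. t ^ i) = (1 - t) * (\<Sum>i\<in>{m..<i}. t ^ i) + (1 - t) * t ^ i"
      using step.hyps by (simp add: distrib_left)
    then show ?case unfolding step.IH by (simp add: algebra_simps)
  qed simp
  also have "\<dots> \<le> t ^ m" using t by simp
  finally have "(1 - t) * (\<Sum>i\<in>{m..<n}. t ^ i) \<le> t ^ m" .
  moreover have "1 / 2 * (\<Sum>i\<in>{m..<n}. t ^ i) \<le> (1 - t) * (\<Sum>i\<in>{m..<n}. t ^ i)"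
    using t by (intro mult_right_mono sum_nonneg) auto
  ultimately show ?thesis by simp
qed (use t in auto)

lemma partial_poch_ge: "1 - 2 * t ^ m \<le> partial_poch t n m"
proof -
  have "1 - (\<Sum>i\<in>{m..<n}. t ^ i) \<le> partial_poch t n m"
    unfolding partial_poch_def using t by (intro Weierstrass_prod_ineq) (auto simp: power_le_one)
  then show ?thesis using sum_geometric_tail_le[of m n] by linarith
qed

lemma partial_poch_split:
  assumes "m \<le> n" "n \<le> N"
  shows "partial_poch t N m = partial_poch t n m * partial_poch t N n"
  unfolding partial_poch_def using assms by (simp add: prod.atLeastLessThan_concat)

lemma partial_poch_tendsto:
  assumes "m > 0"
  shows "(\<lambda>n. partial_poch t n m) \<longlonglongrightarrow> q_pochhammer_inf (t ^ m) t"
proof -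
  have conv: "convergent_prod (\<lambda>k. 1 - t ^ m * t ^ k)"
  proof -
    have "convergent_prod (\<lambda>k. 1 + - (t ^ m * t ^ k))"
    proof (rule summable_imp_convergent_prod_real)
      show "summable (\<lambda>k. \<bar>- (t ^ m * t ^ k)\<bar>)"
        using t by (simp add: abs_mult summable_mult summable_geometric)
      fix k
      have "t ^ (m + k) < 1" using t assms by (intro power_less_one_iff[THEN iffD2]) auto
      then show "- (t ^ m * t ^ k) \<noteq> - 1" by (simp add: power_add)
    qed
    then show ?thesis by simp
  qed
  have "(\<lambda>n. \<Prod>i\<le>n. 1 - t ^ m * t ^ i) \<longlonglongrightarrow> q_pochhammer_inf (t ^ m) t"
    unfolding q_pochhammer_inf_def by (rule convergent_prod_LIMSEQ[OF conv])
  moreover have "(\<Prod>i\<le>n. 1 - t ^ m * t ^ i) = partial_poch t (n + Suc m) m" for n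
  proof -
    have "partial_poch t (n + Suc m) m = (\<Prod>i\<in>{0..<Suc n}. 1 - t ^ (i + m))"
      unfolding partial_poch_def using prod.shift_bounds_nat_ivl[of "\<lambda>i. 1 - t ^ i" 0 m "Suc n"] by simp
    then show ?thesis by (simp add: atLeast0LessThan lessThan_Suc_atMost power_add mult.commute)
  qed
  ultimately have "(\<lambda>n. partial_poch t (n + Suc m) m) \<longlonglongrightarrow> q_pochhammer_inf (t ^ m) t" by simp
  then show ?thesis by (rule LIMSEQ_offset)
qed

text \<open>The infinite product is the finite one times a tail lying between
  \<open>1 - 2 * t ^ n\<close> and \<open>1\<close>. The error does not depend on \<open>m\<close>,
  so summing it over at most \<open>n\<close> values of \<open>m\<close> still gives a vanishing
  total.\<close>

lemma q_pochhammer_inf_bounds: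
  assumes "m > 0" "m \<le> n"
  shows "q_pochhammer_inf (t ^ m) t \<le> partial_poch t n m"
    "partial_poch t n m - 2 * t ^ n \<le> q_pochhammer_inf (t ^ m) t"
proof -
  have 1: "partial_poch t N m \<le> partial_poch t n m" if "N \<ge> n" for N
    unfolding partial_poch_split[OF assms(2) that] using partial_poch_bounds by (intro mult_left_le) auto
  have 2: "partial_poch t n m - 2 * t ^ n \<le> partial_poch t N m" if "N \<ge> n" for N
  proof -
    have "partial_poch t n m * (1 - partial_poch t N n) \<le> 1 - partial_poch t N n"
      using partial_poch_bounds by (intro mult_left_le_one_le) auto
    then show ?thesis
      unfolding partial_poch_split[OF assms(2) that] using partial_poch_ge[of n N] by (simp add: algebra_simps)
  qed
  show "q_pochhammer_inf (t ^ m) t \<le> partial_poch t n m"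
    using partial_poch_tendsto[OF assms(1)] 1 by (intro LIMSEQ_le_const2) auto
  show "partial_poch t n m - 2 * t ^ n \<le> q_pochhammer_inf (t ^ m) t"
    using partial_poch_tendsto[OF assms(1)] 2 by (intro LIMSEQ_le_const) auto
qed

lemma summable_poch: "summable (\<lambda>m. 1 - q_pochhammer_inf (t ^ Suc m) t)"
proof (rule summable_comparison_test)
  \<comment> \<open>The bounds are taken at \<open>n = m\<close>, where the finite product is
    empty.\<close>
  have "\<bar>1 - q_pochhammer_inf (t ^ Suc m) t\<bar> \<le> 2 * t ^ Suc m" for m
    using q_pochhammer_inf_bounds[of "Suc m" "Suc m"] t by (simp add: abs_le_iff)
  then show "\<exists>N. \<forall>m\<ge>N. norm (1 - q_pochhammer_inf (t ^ Suc m) t) \<le> 2 * t ^ Suc m" by auto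
  show "summable (\<lambda>m. 2 * t ^ Suc m)" using t by (simp add: summable_mult summable_geometric)
qed

definition "poch_sum = (\<Sum>m. 1 - q_pochhammer_inf (t ^ Suc m) t)"

lemma sum_partial_poch_upper: "(\<Sum>m\<in>{1..n}. 1 - partial_poch t n m) \<le> poch_sum"
proof -
  have "(\<Sum>m\<in>{1..n}. 1 - partial_poch t n m) \<le> (\<Sum>m\<in>{1..n}. 1 - q_pochhammer_inf (t ^ m) t)"
    using q_pochhammer_inf_bounds(1) by (intro sum_mono) auto
  also have "\<dots> = (\<Sum>m<n. 1 - q_pochhammer_inf (t ^ Suc m) t)"
    using sum.atLeast_Suc_atMost_Suc_shift[of "\<lambda>m. 1 - q_pochhammer_inf (t ^ m) t" 0 "n - 1"]
    by (cases n) (auto simp: atLeast0AtMost lessThan_Suc_atMost)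
  also have "\<dots> \<le> poch_sum"
    unfolding poch_sum_def
  proof (rule sum_le_suminf[OF summable_poch])
    show "0 \<le> 1 - q_pochhammer_inf (t ^ Suc m) t" for m
      using q_pochhammer_inf_bounds(1)[of "Suc m" "Suc m"] by simp
  qed simp
  finally show ?thesis .
qed

lemma sum_partial_poch_lower:
  assumes "s \<le> n"
  shows "(\<Sum>m<s. 1 - q_pochhammer_inf (t ^ Suc m) t) - 2 * real n * t ^ n \<le> (\<Sum>m\<in>{1..s}. 1 - partial_poch t n m)"
proof -
  have "(\<Sum>m<s. 1 - q_pochhammer_inf (t ^ Suc m) t) = (\<Sum>m\<in>{1..s}. 1 - q_pochhammer_inf (t ^ m) t)"
    using sum.atLeast_Suc_atMost_Suc_shift[of "\<lambda>m. 1 - q_pochhammer_inf (t ^ m) t" 0 "s - 1"]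
    by (cases s) (auto simp: atLeast0AtMost lessThan_Suc_atMost)
  also have "\<dots> \<le> (\<Sum>m\<in>{1..s}. (1 - partial_poch t n m) + 2 * t ^ n)"
  proof (rule sum_mono)
    fix m assume "m \<in> {1..s}"
    then show "1 - q_pochhammer_inf (t ^ m) t \<le> (1 - partial_poch t n m) + 2 * t ^ n"
      using q_pochhammer_inf_bounds(2)[of m n] assms by simp
  qed
  also have "\<dots> = (\<Sum>m\<in>{1..s}. 1 - partial_poch t n m) + real s * (2 * t ^ n)"
    by (simp add: sum.distrib)
  also have "real s * (2 * t ^ n) \<le> real n * (2 * t ^ n)"
    using assms t by (intro mult_right_mono) auto
  finally show ?thesis by (simp add: mult_ac)
qed

end

lemma sum_krylov_prob_tail:
  assumes t: "0 < t" "t \<le> 1 / 2"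
  shows "(\<Sum>j\<in>{r<..<n}. krylov_prob t n j * real j) \<le> geom_tail r"
proof -
  have "(\<Sum>j\<in>{r<..<n}. krylov_prob t n j * real j) \<le> (\<Sum>j\<in>{r<..<n}. real j ^ 2 * (3 / 4) ^ j)"
  proof (rule sum_mono)
    fix j
    have "krylov_prob t n j \<le> t ^ j" using t by (intro krylov_prob_le) auto
    also have "\<dots> \<le> (3 / 4) ^ j" using t by (intro power_mono) auto
    finally have "krylov_prob t n j \<le> (3 / 4) ^ j" .
    moreover have "j \<le> j ^ 2" by (cases j) (auto simp: power2_eq_square)
    then have "real j \<le> real j ^ 2" unfolding of_nat_power[symmetric] by (simp only: of_nat_le_iff)
    ultimately have "krylov_prob t n j * real j \<le> (3 / 4) ^ j * real j ^ 2"
      by (intro mult_mono) auto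
    then show "krylov_prob t n j * real j \<le> real j ^ 2 * (3 / 4) ^ j" by (simp add: mult.commute)
  qed
  also have "\<dots> \<le> geom_tail r" by (rule sum_le_geom_tail) auto
  finally show ?thesis .
qed

text \<open>By additivity over the two Krylov factors, the uniform one contributes about
  \<open>r\<close>, and the complementary one its full degree \<open>j\<close> when
  \<open>j \<le> r\<close>. Averaging \<open>j\<close> over the codimension law yields the
  series.\<close>

lemma mat_avg_small_part_bounds:
  fixes r n :: nat
  assumes n: "n > 0"
  defines "t \<equiv> 1 / real CARD('a :: {finite, field_gcd})"
  defines "E \<equiv> mat_avg n (\<lambda>f :: 'a poly. real (small_part r f))"
  shows "E \<le> real r + geom_tail r + poch_sum t"
    "r \<le> n \<Longrightarrow> real r + (\<Sum>m<n - r. 1 - q_pochhammer_inf (t ^ Suc m) t) - 2 * real n * t ^ n - 2 * geom_tail r \<le> E"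
proof -
  let ?Y = "\<lambda>f :: 'a poly. real (small_part r f)" and ?P = "krylov_prob t n"
  have q: "real CARD('a) \<ge> 2" using card_ge_2[where 'a = 'a] by simp
  have t: "0 < t" "t \<le> 1 / 2" using q by (auto simp: t_def field_simps)
  have P0: "?P j \<ge> 0" for j using t by (intro krylov_prob_nonneg) auto
  have E: "E = (\<Sum>j<n. ?P j * (poly_avg (n - j) ?Y + mat_avg j ?Y))"
  proof -
    have "poly_avg (n - j) (\<lambda>f. mat_avg j (\<lambda>g. ?Y (f * g))) = poly_avg (n - j) ?Y + mat_avg j ?Y" for j
    proof -
      have "poly_avg (n - j) (\<lambda>f. mat_avg j (\<lambda>g. ?Y (f * g)))
          = poly_avg (n - j) (\<lambda>f. mat_avg j (\<lambda>g. ?Y f + ?Y g))"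
        by (intro poly_avg_cong mat_avg_cong) (simp add: small_part_mult monic_of_degree_nonzero)
      then show ?thesis by (simp add: mat_avg_add poly_avg_add)
    qed
    then show ?thesis unfolding E_def t_def using mat_avg_recursion[OF n, of ?Y] by simp
  qed
  have M: "0 \<le> mat_avg j ?Y" "mat_avg j ?Y \<le> real j" "j \<le> r \<Longrightarrow> mat_avg j ?Y = real j" for j
  proof -
    show "0 \<le> mat_avg j ?Y" using mat_avg_mono[of j "\<lambda>_. 0" ?Y] by simp
    have "mat_avg j ?Y \<le> mat_avg j (\<lambda>_ :: 'a poly. real j)"
      by (rule mat_avg_mono) (simp add: small_part_bounds(1))
    then show "mat_avg j ?Y \<le> real j" by simp
    show "mat_avg j ?Y = real j" if "j \<le> r"
    proof -
      have "mat_avg j ?Y = mat_avg j (\<lambda>_ :: 'a poly. real j)"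
        using that by (intro mat_avg_cong) (simp add: small_part_bounds(2))
      then show ?thesis by simp
    qed
  qed
  have tail0: "geom_tail r \<ge> 0" using sum_le_geom_tail[of "{}" r] by simp
  have F: "poly_avg k ?Y \<le> real r + geom_tail r" "real (min k r) \<le> poly_avg k ?Y" for k
    using poly_avg_small_part_bounds[of r k, where 'a = 'a] poly_avg_small_part_le_r[of k r, where 'a = 'a]
      excess_le_geom_tail[OF q, of r k] tail0 by (cases "k \<le> r"; simp)+
  \<comment> \<open>\<open>min j n\<close> is just \<open>j\<close> here, written so that the
    tail-sum formula applies with cut-off \<open>n\<close>.\<close>
  have "E \<le> (\<Sum>j<n. ?P j * (real r + geom_tail r) + ?P j * real (min j n))"
    unfolding E distrib_left[symmetric]
  proof (intro sum_mono mult_left_mono P0)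
    fix j assume "j \<in> {..<n}"
    then show "poly_avg (n - j) ?Y + mat_avg j ?Y \<le> real r + geom_tail r + real (min j n)"
      using F(1)[of "n - j"] M(2)[of j] by simp
  qed
  also have "\<dots> = real r + geom_tail r + (\<Sum>m\<in>{1..n}. 1 - partial_poch t n m)"
    using n by (simp only: sum.distrib sum_distrib_right[symmetric] sum_krylov_prob sum_krylov_prob_min mult_1 order_refl)
  also have "\<dots> \<le> real r + geom_tail r + poch_sum t"
    using sum_partial_poch_upper[OF t, of n] by simp
  finally show "E \<le> real r + geom_tail r + poch_sum t" .
  assume rn: "r \<le> n"
  \<comment> \<open>A minorant for each \<open>j\<close>. Cutting \<open>j\<close> off at
    \<open>n - r\<close> accounts for a uniform factor of degree \<open>n - j\<close> below
    \<open>r\<close>. For \<open>j > r\<close> the complementary factor is bounded below only by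
    \<open>0\<close>, and subtracting \<open>2 * j\<close> makes the left side nonpositive.\<close>
  have "real r + (\<Sum>m\<in>{1..n - r}. 1 - partial_poch t n m) - 2 * (\<Sum>j\<in>{r<..<n}. ?P j * real j)
      = (\<Sum>j<n. ?P j * real r + ?P j * real (min j (n - r)) - 2 * (if r < j then ?P j * real j else 0))"
  proof -
    have "{..<n} \<inter> {j. r < j} = {r<..<n}" by auto
    then have "(\<Sum>j\<in>{r<..<n}. ?P j * real j) = (\<Sum>j<n. if r < j then ?P j * real j else 0)"
      by (simp add: sum.If_cases)
    then show ?thesis
      using n by (simp only: sum.distrib sum_subtractf sum_distrib_right[symmetric] sum_distrib_left[symmetric]
          sum_krylov_prob sum_krylov_prob_min mult_1 diff_le_self)
  qed
  also have "\<dots> \<le> E"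
    unfolding E
  proof (rule sum_mono)
    fix j assume j: "j \<in> {..<n}"
    have "real r + real (min j (n - r)) - 2 * (if r < j then real j else 0) \<le> poly_avg (n - j) ?Y + mat_avg j ?Y"
    proof (cases "r < j")
      case True
      have "0 \<le> poly_avg (n - j) ?Y" using F(2)[of "n - j"] by linarith
      then show ?thesis using True M(1)[of j] by simp
    next
      case False
      then have "real (min (n - j) r) + real j \<ge> real r + real (min j (n - r))" using rn j by (auto simp: min_def)
      then show ?thesis using False F(2)[of "n - j"] M(3)[of j] by simp
    qed
    from mult_left_mono[OF this P0[of j]]
    show "?P j * real r + ?P j * real (min j (n - r)) - 2 * (if r < j then ?P j * real j else 0)
        \<le> ?P j * (poly_avg (n - j) ?Y + mat_avg j ?Y)"
      by (simp add: algebra_simps split: if_splits)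
  qed
  finally show "real r + (\<Sum>m<n - r. 1 - q_pochhammer_inf (t ^ Suc m) t) - 2 * real n * t ^ n - 2 * geom_tail r \<le> E"
    using sum_partial_poch_lower[OF t, of "n - r" n] sum_krylov_prob_tail[OF t, of n r] by simp
qed

lemma filterlim_nat_of_real:
  assumes "filterlim (\<lambda>n. real (f n)) at_top F"
  shows "filterlim f at_top F"
  unfolding filterlim_at_top
proof
  fix Z
  have "\<forall>\<^sub>F n in F. real Z \<le> real (f n)" using assms unfolding filterlim_at_top by (rule spec)
  then show "\<forall>\<^sub>F n in F. Z \<le> f n" by eventually_elim simp
qed

lemma small_part_expectation_limit:
  fixes r :: "nat \<Rightarrow> nat" and \<epsilon> :: "nat \<Rightarrow> real"
  defines "t \<equiv> 1 / real CARD('a :: {finite, field_gcd})"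
  assumes r: "filterlim (\<lambda>n. real (r n)) at_top sequentially"
    and nr: "filterlim (\<lambda>n. real n - real (r n)) at_top sequentially"
    and upper: "\<And>n. n > 0 \<Longrightarrow> x n \<le> mat_avg n (\<lambda>f :: 'a poly. real (small_part (r n) f))"
    and lower: "\<And>n. n > 0 \<Longrightarrow> mat_avg n (\<lambda>f :: 'a poly. real (small_part (r n) f))
       - mat_avg n (\<lambda>f :: 'a poly. real (bad_part (r n) f)) \<le> x n"
  shows "(\<lambda>n. x n - (real (r n) + (\<Sum>m. 1 - q_pochhammer_inf (1 / real CARD('a) ^ Suc m) (1 / real CARD('a)))))
    \<longlonglongrightarrow> 0"
proof -
  have q: "real CARD('a) \<ge> 2" using card_ge_2[where 'a = 'a] by simp
  have t: "0 < t" "t \<le> 1 / 2" using q by (auto simp: t_def field_simps)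
  have c: "(\<Sum>m. 1 - q_pochhammer_inf (1 / real CARD('a) ^ Suc m) (1 / real CARD('a))) = poch_sum t"
    unfolding poch_sum_def[OF t] by (simp add: t_def power_one_over)
  let ?s = "\<lambda>k. \<Sum>m<k. 1 - q_pochhammer_inf (t ^ Suc m) t"
  \<comment> \<open>Of the factor \<open>2 + exp 4\<close>, the \<open>2\<close> comes from
    codimensions above \<open>r\<close> and \<open>exp 4\<close> from the bad part.\<close>
  let ?lo = "\<lambda>n. ?s (n - r n) - poch_sum t - 2 * (real n * t ^ n) - (2 + exp 4) * geom_tail (r n)"
  have r_nat: "filterlim r at_top sequentially" using r by (rule filterlim_nat_of_real)
  have nr_nat: "filterlim (\<lambda>n. n - r n) at_top sequentially"
  proof -
    have "\<forall>\<^sub>F n in sequentially. real n - real (r n) \<le> real (n - r n)" by (intro always_eventually) (simp add: of_nat_diff_real)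
    then have "filterlim (\<lambda>n. real (n - r n)) at_top sequentially" using nr by (rule filterlim_at_top_mono[rotated])
    then show ?thesis by (rule filterlim_nat_of_real)
  qed
  have tail: "(\<lambda>n. geom_tail (r n)) \<longlonglongrightarrow> 0"
    using filterlim_compose[OF geom_tail_tendsto_0 r_nat] .
  have "?s \<longlonglongrightarrow> poch_sum t"
    unfolding poch_sum_def[OF t] by (rule summable_LIMSEQ[OF summable_poch[OF t]])
  then have "(\<lambda>n. ?s (n - r n)) \<longlonglongrightarrow> poch_sum t" using nr_nat by (rule filterlim_compose)
  moreover have "(\<lambda>n. real n * t ^ n) \<longlonglongrightarrow> 0"
    using t by (intro powser_times_n_limit_0) auto
  ultimately have "?lo \<longlonglongrightarrow> poch_sum t - poch_sum t - 2 * 0 - (2 + exp 4) * 0"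
    by (intro tendsto_intros tail)
  then have lo: "?lo \<longlonglongrightarrow> 0" by simp
  have ev: "\<forall>\<^sub>F n in sequentially. n > 0 \<and> r n \<le> n"
  proof -
    have "\<forall>\<^sub>F n in sequentially. real n - real (r n) \<ge> 0" using nr unfolding filterlim_at_top by (rule spec)
    then show ?thesis using eventually_gt_at_top[of 0] by eventually_elim auto
  qed
  show ?thesis unfolding c
  proof (rule tendsto_sandwich[OF _ _ lo tail])
    show "\<forall>\<^sub>F n in sequentially. ?lo n \<le> x n - (real (r n) + poch_sum t)"
      using ev
    proof eventually_elim
      case (elim n)
      have "exp 4 * excess (real CARD('a)) (r n) n \<le> exp 4 * geom_tail (r n)"
        using excess_le_geom_tail[OF q] by (intro mult_left_mono) auto
      then have "mat_avg n (\<lambda>f :: 'a poly. real (bad_part (r n) f)) \<le> exp 4 * geom_tail (r n)"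
        using mat_avg_bad_part_le[of n "r n", where 'a = 'a] by linarith
      then show ?case
        using mat_avg_small_part_bounds(2)[of n "r n", where 'a = 'a, folded t_def] lower[of n] elim
        unfolding distrib_right mult.assoc by linarith
    qed
    show "\<forall>\<^sub>F n in sequentially. x n - (real (r n) + poch_sum t) \<le> geom_tail (r n)"
      using ev
    proof eventually_elim
      case (elim n)
      then show ?case
        using mat_avg_small_part_bounds(1)[of n "r n", where 'a = 'a, folded t_def] upper[of n] by simp
    qed
  qed
qed

section \<open>Minimal polynomials of integral elements\<close>

interpretation ac_hom: inj_idom_hom "to_ac :: 'a :: field \<Rightarrow> 'a alg_closure"
  by unfold_locales auto

interpretation ac_poly_hom: map_poly_inj_idom_hom "to_ac :: 'a :: field \<Rightarrow> 'a alg_closure" ..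

interpretation fract_poly_hom: map_poly_inj_idom_hom "to_fract :: 'a :: idom \<Rightarrow> 'a fract" ..

interpretation embed_hom: inj_idom_hom "embed_int :: 'p :: prime_card padic_int \<Rightarrow> _"
  by unfold_locales (auto simp: embed_int_def)

interpretation embed_poly_hom: map_poly_inj_idom_hom "embed_int :: 'p :: prime_card padic_int \<Rightarrow> _" ..

lemma map_poly_embed_int: "map_poly embed_int f = map_poly to_ac (map_poly to_fract f)"
  by (simp add: map_poly_map_poly o_def embed_int_def[abs_def])

lemma fract_poly_clear_denominators:
  fixes S :: "'a :: idom fract poly"
  shows "\<exists>d S'. d \<noteq> 0 \<and> Polynomial.smult (to_fract d) S = map_poly to_fract S'"
proof (induction S)
  case 0
  show ?case by (rule exI[of _ 1], rule exI[of _ 0]) simp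
next
  case (pCons a S)
  then obtain d S' where d: "d \<noteq> 0" "Polynomial.smult (to_fract d) S = map_poly to_fract S'" by blast
  obtain x y where a: "a = Fraction_Field.Fract x y" "y \<noteq> 0" by (cases a) auto
  have ya: "to_fract y * a = to_fract x" using a by (simp add: to_fract_def eq_fract)
  have "Polynomial.smult (to_fract (d * y)) (pCons a S) = pCons (to_fract d * (to_fract y * a)) (Polynomial.smult (to_fract y) (Polynomial.smult (to_fract d) S))"
    by (simp add: mult_ac)
  also have "\<dots> = map_poly to_fract (pCons (d * x) (Polynomial.smult y S'))"
    unfolding d(2) ya by (simp add: to_fract_hom.map_poly_pCons_hom fract_poly_hom.hom_mult to_fract_hom.map_poly_hom_smult)
  finally show ?case using d a by (intro exI[of _ "d * y"] exI[of _ "pCons (d * x) (Polynomial.smult y S')"]) simp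
qed

text \<open>Only \<open>0\<close> is divisible by all powers, so a maximal power can be extracted.
  Nonzero reduction plays the role of primitivity.\<close>

lemma padic_poly_primitive_part:
  fixes f :: "'p :: prime_card padic_int poly"
  assumes "f \<noteq> 0"
  obtains k g where "f = of_nat CARD('p) ^ k * g" "map_poly red g \<noteq> 0"
proof -
  let ?q = "of_nat CARD('p) :: 'p padic_int poly"
  have "\<exists>k. \<not> ?q ^ k dvd f" using padic_poly_separated assms by blast
  then obtain k where k: "\<not> ?q ^ k dvd f" "\<And>j. j < k \<Longrightarrow> ?q ^ j dvd f"
    using exists_least_iff[of "\<lambda>k. \<not> ?q ^ k dvd f"] by blast
  have "k \<noteq> 0" using k(1) by (intro notI) simp
  then obtain j where j: "k = Suc j" by (cases k) auto
  obtain g where g: "f = ?q ^ j * g" using k(2)[of j] j by (auto simp: dvd_def)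
  have "\<not> ?q dvd g"
  proof
    assume "?q dvd g"
    then have "?q ^ j * ?q dvd f" unfolding g by (intro mult_dvd_mono) auto
    then show False using k(1) j by (simp add: mult.commute)
  qed
  then show thesis using that g map_poly_red_eq_0_iff by blast
qed

text \<open>Since \<open>n < CARD('p) ^ n\<close>, the residue at level \<open>n\<close> is
  \<open>n\<close> itself. Characteristic zero is what later keeps derivatives of nonconstant monic
  polynomials nonzero.\<close>

lemma of_nat_padic_nonzero: "n > 0 \<Longrightarrow> (of_nat n :: 'p :: prime_card padic_int) \<noteq> 0"
proof
  assume n: "n > 0" and "(of_nat n :: 'p padic_int) = 0"
  then have "residue (of_int (int n) :: 'p padic_int) n = 0" by (simp add: zero_padic_int.rep_eq)
  then have "int n mod int CARD('p) ^ n = 0" by (simp only: residue_of_int)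
  moreover have "n < CARD('p) ^ n"
    using card_ge_2[where 'a = "'p mod_ring"] by (intro less_exp[THEN less_le_trans] power_mono) auto
  then have "int n < int CARD('p) ^ n" by (metis of_nat_less_iff of_nat_power)
  ultimately show False using n by simp
qed

lemma fract_poly_scale_primitive:
  fixes S :: "'p :: prime_card padic poly"
  assumes "S \<noteq> 0"
  obtains c g where "c \<noteq> 0" "Polynomial.smult c S = map_poly to_fract g" "map_poly red g \<noteq> 0"
proof -
  let ?q = "of_nat CARD('p) :: 'p padic_int"
  obtain d f where d: "d \<noteq> 0" "Polynomial.smult (to_fract d) S = map_poly to_fract f"
    using fract_poly_clear_denominators[of S] by blast
  have "map_poly to_fract f \<noteq> 0" using d assms by (metis smult_eq_0_iff to_fract_eq_0_iff)
  then have "f \<noteq> 0" by auto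
  then obtain k g where g: "f = of_nat CARD('p) ^ k * g" "map_poly red g \<noteq> 0"
    by (rule padic_poly_primitive_part)
  have "of_nat CARD('p) ^ k * g = Polynomial.smult (?q ^ k) g"
    by (simp add: of_nat_poly poly_const_pow)
  then have f: "map_poly to_fract f = Polynomial.smult (to_fract (?q ^ k)) (map_poly to_fract g)"
    unfolding g(1) by (simp only: to_fract_hom.map_poly_hom_smult)
  have q: "to_fract (?q ^ k) \<noteq> 0" using of_nat_padic_nonzero[of "CARD('p)", where 'p = 'p] by simp
  let ?c = "to_fract d / to_fract (?q ^ k)"
  have "Polynomial.smult ?c S = Polynomial.smult (inverse (to_fract (?q ^ k))) (Polynomial.smult (to_fract d) S)"
    by (simp add: divide_inverse mult.commute)
  also have "\<dots> = map_poly to_fract g" unfolding d(2) f using q by simp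
  finally show thesis using that[of ?c g] d(1) q g(2) by simp
qed

lemma lead_coeff_smult_monic:
  fixes G :: "'a :: idom poly"
  assumes "Polynomial.lead_coeff G = 1"
  shows "Polynomial.lead_coeff (Polynomial.smult c G) = c"
  using assms by (cases "c = 0") simp_all

lemma monic_fract_poly_integral:
  fixes G :: "'p :: prime_card padic poly"
  assumes "Polynomial.lead_coeff G = 1" "Polynomial.smult c G = map_poly to_fract g"
    and unit: "red (Polynomial.lead_coeff g) \<noteq> 0"
  shows "\<exists>g'. Polynomial.lead_coeff g' = 1 \<and> G = map_poly to_fract g'"
proof -
  obtain u where "1 = Polynomial.lead_coeff g * u" using padic_unit[OF unit] by (elim dvdE)
  then have u: "u * Polynomial.lead_coeff g = 1" by (subst mult.commute) (rule sym)
  have c: "c = to_fract (Polynomial.lead_coeff g)"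
    using lead_coeff_smult_monic[OF assms(1), of c] unfolding assms(2) to_fract_hom.hom_lead_coeff by (rule sym)
  have "to_fract u * c = 1" unfolding c to_fract_mult[symmetric] u by simp
  then have "G = Polynomial.smult (to_fract u) (Polynomial.smult c G)" by simp
  also have "\<dots> = map_poly to_fract (Polynomial.smult u g)"
    unfolding assms(2) by (simp only: to_fract_hom.map_poly_hom_smult)
  finally have G: "G = map_poly to_fract (Polynomial.smult u g)" .
  have "u \<noteq> 0" using u by auto
  then have "Polynomial.lead_coeff (Polynomial.smult u g) = 1" using u by simp
  then show ?thesis using G by blast
qed

text \<open>Both factors are scaled to nonzero reduction. Over the residue field the product of the
  reductions is nonzero, so the total scaling \<open>w\<close>, the product of the two leading
  coefficients, is a unit. Dividing by these units makes the factors monic and integral.\<close>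

lemma gauss_lemma:
  fixes f :: "'p :: prime_card padic_int poly"
  assumes f: "Polynomial.lead_coeff f = 1" and GH: "map_poly to_fract f = G * H"
    and G: "Polynomial.lead_coeff G = 1"
  shows "\<exists>g h. f = g * h \<and> Polynomial.lead_coeff g = 1 \<and> Polynomial.lead_coeff h = 1 \<and>
    G = map_poly to_fract g \<and> H = map_poly to_fract h"
proof -
  have H: "Polynomial.lead_coeff H = 1"
    using f G arg_cong[OF GH, of Polynomial.lead_coeff] by (simp add: to_fract_hom.hom_lead_coeff Polynomial.lead_coeff_mult)
  have nz: "G \<noteq> 0" "H \<noteq> 0" using G H by auto
  obtain c g where g: "c \<noteq> 0" "Polynomial.smult c G = map_poly to_fract g" "map_poly red g \<noteq> 0"
    using fract_poly_scale_primitive[OF nz(1)] .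
  obtain c' h where h: "c' \<noteq> 0" "Polynomial.smult c' H = map_poly to_fract h" "map_poly red h \<noteq> 0"
    using fract_poly_scale_primitive[OF nz(2)] .
  define w where "w = Polynomial.lead_coeff g * Polynomial.lead_coeff h"
  have "c = to_fract (Polynomial.lead_coeff g)"
    using lead_coeff_smult_monic[OF G, of c] unfolding g(2) to_fract_hom.hom_lead_coeff by (rule sym)
  moreover have "c' = to_fract (Polynomial.lead_coeff h)"
    using lead_coeff_smult_monic[OF H, of c'] unfolding h(2) to_fract_hom.hom_lead_coeff by (rule sym)
  ultimately have cc': "c * c' = to_fract w" by (simp add: w_def)
  have "map_poly to_fract (g * h) = Polynomial.smult (c * c') (G * H)"
    unfolding fract_poly_hom.hom_mult g(2)[symmetric] h(2)[symmetric] by (simp add: mult.commute)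
  also have "\<dots> = map_poly to_fract (Polynomial.smult w f)"
    unfolding cc' GH[symmetric] by (simp only: to_fract_hom.map_poly_hom_smult)
  finally have gh: "g * h = Polynomial.smult w f" by (simp only: fract_poly_hom.eq_iff)
  have "map_poly red (g * h) \<noteq> 0" using g(3) h(3) by (simp add: red_poly_hom.hom_mult)
  then have "red w \<noteq> 0" unfolding gh red_hom.map_poly_hom_smult by auto
  then have units: "red (Polynomial.lead_coeff g) \<noteq> 0" "red (Polynomial.lead_coeff h) \<noteq> 0"
    by (auto simp: w_def red_hom.hom_mult)
  obtain g' where g': "Polynomial.lead_coeff g' = 1" "G = map_poly to_fract g'"
    using monic_fract_poly_integral[OF G g(2) units(1)] by blast
  obtain h' where h': "Polynomial.lead_coeff h' = 1" "H = map_poly to_fract h'"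
    using monic_fract_poly_integral[OF H h(2) units(2)] by blast
  have "map_poly to_fract f = map_poly to_fract (g' * h')"
    unfolding GH g'(2) h'(2) by (simp only: fract_poly_hom.hom_mult)
  then have "f = g' * h'" by (simp only: fract_poly_hom.eq_iff)
  then show ?thesis using g' h' by blast
qed

definition ac_eval :: "'p :: prime_card padic poly \<Rightarrow> 'p padic_closure \<Rightarrow> 'p padic_closure" where
  "ac_eval S x = poly (map_poly to_ac S) x"

lemma ac_eval_simps [simp]:
  "ac_eval (S + T) x = ac_eval S x + ac_eval T x" "ac_eval (S - T) x = ac_eval S x - ac_eval T x"
  "ac_eval (S * T) x = ac_eval S x * ac_eval T x" "ac_eval 0 x = 0" "ac_eval 1 x = 1"
  "ac_eval (- S) x = - ac_eval S x" "ac_eval [:c:] x = to_ac c" "ac_eval (Polynomial.smult c S) x = to_ac c * ac_eval S x"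
  by (simp_all add: ac_eval_def ac_poly_hom.hom_add ac_poly_hom.hom_minus ac_poly_hom.hom_mult ac_poly_hom.hom_uminus
      ac_hom.map_poly_hom_smult ac_hom.map_poly_pCons_hom)

text \<open>Integral coefficients allow reduction modulo the prime; divisibility over the fraction
  field is the minimality that determines the field degree.\<close>

definition is_min_poly :: "'p :: prime_card padic_int poly \<Rightarrow> 'p padic_closure \<Rightarrow> bool" where
  "is_min_poly g x \<longleftrightarrow> Polynomial.lead_coeff g = 1 \<and> poly (map_poly embed_int g) x = 0 \<and>
     (\<forall>S. ac_eval S x = 0 \<longrightarrow> map_poly to_fract g dvd S)"

definition monic_irred :: "'p :: prime_card padic_int poly \<Rightarrow> bool" where
  "monic_irred g \<longleftrightarrow> Polynomial.lead_coeff g = 1 \<and> degree g > 0 \<and>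
     (\<forall>a b. Polynomial.lead_coeff a = 1 \<longrightarrow> Polynomial.lead_coeff b = 1 \<longrightarrow> g = a * b \<longrightarrow> a = 1 \<or> b = 1)"

lemma monic_degree_0: "Polynomial.lead_coeff f = 1 \<Longrightarrow> degree f = 0 \<Longrightarrow> f = 1"
  by (elim degree_eq_zeroE) simp

text \<open>A nonzero annihilator of least degree over the fraction field, made monic, divides all
  others by Euclidean division; Gauss's lemma moves it to \<open>Z_p\<close>.\<close>

lemma ex_min_poly_dvd:
  fixes f :: "'p :: prime_card padic_int poly"
  assumes f: "Polynomial.lead_coeff f = 1" "poly (map_poly embed_int f) x = 0"
  obtains g h where "is_min_poly g x" "f = g * h" "Polynomial.lead_coeff h = 1"
proof -
  let ?V = "\<lambda>S :: 'p padic poly. S \<noteq> 0 \<and> ac_eval S x = 0"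
  have V: "?V (map_poly to_fract f)" using f by (auto simp: ac_eval_def map_poly_embed_int)
  define d where "d = (LEAST d. \<exists>S. ?V S \<and> degree S = d)"
  have ex: "\<exists>S. ?V S \<and> degree S = degree (map_poly to_fract f)" using V by blast
  have "\<exists>S. ?V S \<and> degree S = d" unfolding d_def by (rule LeastI[of _ "degree (map_poly to_fract f)"]) (rule ex)
  then obtain S where S: "S \<noteq> 0" "ac_eval S x = 0" "degree S = d" by blast
  define M where "M = Polynomial.smult (inverse (Polynomial.lead_coeff S)) S"
  have M: "Polynomial.lead_coeff M = 1" "ac_eval M x = 0" "degree M = d" using S by (auto simp: M_def)
  have M0: "M \<noteq> 0" using M(1) by auto
  have dvd: "M dvd R" if "ac_eval R x = 0" for R
  proof (rule ccontr)
    assume "\<not> M dvd R"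
    then have r: "R mod M \<noteq> 0" by (simp add: dvd_eq_mod_eq_0)
    have "R mod M = R - R div M * M" by (simp add: minus_div_mult_eq_mod)
    then have "ac_eval (R mod M) x = 0" using that M(2) by simp
    then have "d \<le> degree (R mod M)" unfolding d_def using r by (intro Least_le) blast
    moreover have "degree (R mod M) < degree M" using r M0 degree_mod_less by blast
    ultimately show False using M(3) by simp
  qed
  then obtain H where "map_poly to_fract f = M * H" using V by (auto elim: dvdE)
  then obtain g h where gh: "f = g * h" "Polynomial.lead_coeff g = 1" "Polynomial.lead_coeff h = 1" "M = map_poly to_fract g"
    using gauss_lemma[OF f(1) _ M(1)] by blast
  have "is_min_poly g x"
    unfolding is_min_poly_def using gh M(2) dvd by (auto simp: ac_eval_def map_poly_embed_int)
  then show thesis using that gh by blast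
qed

text \<open>The minimal polynomial of a root is a monic factor other than \<open>1\<close>, hence
  all of \<open>g\<close>. Irreducibility among monic integral factorizations thus already gives
  minimality over the fraction field.\<close>

lemma monic_irred_min_poly:
  assumes g: "monic_irred g" and x: "poly (map_poly embed_int g) x = 0"
  shows "is_min_poly g x"
proof -
  have "Polynomial.lead_coeff g = 1" using g by (simp add: monic_irred_def)
  then obtain m h where m: "is_min_poly m x" "g = m * h" "Polynomial.lead_coeff h = 1"
    using x by (rule ex_min_poly_dvd)
  then have "m = 1 \<or> h = 1" using g unfolding monic_irred_def is_min_poly_def by blast
  moreover have "m \<noteq> 1" using m(1) by (auto simp: is_min_poly_def)
  ultimately show ?thesis using m by simp
qed

lemma min_poly_irred:
  assumes "is_min_poly g x"
  shows "monic_irred g"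
  unfolding monic_irred_def
proof (intro conjI allI impI)
  show g: "Polynomial.lead_coeff g = 1" using assms by (simp add: is_min_poly_def)
  show "degree g > 0"
  proof (rule ccontr)
    assume "\<not> degree g > 0"
    then have "g = 1" using g monic_degree_0 by blast
    then show False using assms by (simp add: is_min_poly_def)
  qed
  have aux: "b = 1" if ab: "Polynomial.lead_coeff a = 1" "Polynomial.lead_coeff b = 1" "g = a * b"
    and a: "poly (map_poly embed_int a) x = 0" for a b
  proof -
    have nz: "a \<noteq> 0" "b \<noteq> 0" using ab by auto
    have "ac_eval (map_poly to_fract a) x = 0" using a by (simp add: ac_eval_def map_poly_embed_int)
    then have "map_poly to_fract g dvd map_poly to_fract a" using assms by (simp add: is_min_poly_def)
    then have "degree g \<le> degree a" using nz dvd_imp_degree_le[of "map_poly to_fract g" "map_poly to_fract a"] by simp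
    then have "degree b = 0" using ab nz by (simp add: degree_mult_eq)
    then show "b = 1" using ab monic_degree_0 by blast
  qed
  fix a b assume ab: "Polynomial.lead_coeff a = 1" "Polynomial.lead_coeff b = 1" "g = a * b"
  have "poly (map_poly embed_int a) x * poly (map_poly embed_int b) x = 0"
    using assms unfolding is_min_poly_def ab(3) by (simp add: embed_poly_hom.hom_mult)
  then show "a = 1 \<or> b = 1" using aux[of a b] aux[of b a] ab by (auto simp: mult.commute)
qed

definition gen_field :: "'p :: prime_card padic_closure \<Rightarrow> 'p padic_closure set" where
  "gen_field x = range (\<lambda>S. ac_eval S x)"

lemma gen_field_subset:
  assumes "intermediate_field K" "x \<in> K"
  shows "gen_field x \<subseteq> K"
proof -
  have "ac_eval S x \<in> K" for S
  proof (induction S)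
    case 0
    have "to_ac 0 \<in> K" using assms(1) unfolding intermediate_field_def by blast
    then show ?case by simp
  next
    case (pCons a S)
    have "ac_eval (pCons a S) x = to_ac a + x * ac_eval S x"
      by (simp add: ac_eval_def ac_hom.map_poly_pCons_hom)
    moreover have "to_ac a \<in> K" using assms(1) unfolding intermediate_field_def by blast
    ultimately show ?case using pCons assms unfolding intermediate_field_def by simp
  qed
  then show ?thesis by (auto simp: gen_field_def)
qed

lemma gen_field_self: "x \<in> gen_field x"
  unfolding gen_field_def by (rule range_eqI[of _ _ "[:0, 1:]"]) (simp add: ac_eval_def ac_hom.map_poly_pCons_hom)

lemma intermediate_gen_field:
  assumes g: "is_min_poly g x"
  shows "intermediate_field (gen_field x)"
  unfolding intermediate_field_def
proof (intro conjI ballI)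
  show "range to_ac \<subseteq> gen_field x"
  proof
    fix y :: "'a padic_closure" assume "y \<in> range to_ac"
    then obtain c where "y = to_ac c" by blast
    then have "y = ac_eval [:c:] x" by simp
    then show "y \<in> gen_field x" unfolding gen_field_def by blast
  qed
  fix y z assume "y \<in> gen_field x" "z \<in> gen_field x"
  then obtain S T where ST: "y = ac_eval S x" "z = ac_eval T x" by (auto simp: gen_field_def)
  have "y + z = ac_eval (S + T) x" "y - z = ac_eval (S - T) x" "y * z = ac_eval (S * T) x"
    using ST by simp_all
  then show "y + z \<in> gen_field x" "y - z \<in> gen_field x" "y * z \<in> gen_field x"
    unfolding gen_field_def by blast+
  show "inverse y \<in> gen_field x"
  proof (cases "y = 0")
    case True
    then have "inverse y = ac_eval 0 x" by simp
    then show ?thesis unfolding gen_field_def by blast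
  next
    case False
    define M where "M = map_poly to_fract g"
    \<comment> \<open>\<open>D\<close> divides \<open>M\<close> and does not vanish at
      \<open>x\<close>, so the cofactor of \<open>D\<close> in \<open>M\<close> does; by minimality
      it has full degree and \<open>D\<close> is constant. The Bezout identity evaluated at
      \<open>x\<close> then gives the inverse.\<close>
    define D where "D = gcd M S"
    obtain a b where ab: "a * M + b * S = D" using bezout_coefficients_fst_snd unfolding D_def by blast
    have Mx: "ac_eval M x = 0" using g by (simp add: is_min_poly_def ac_eval_def M_def map_poly_embed_int)
    have M0: "M \<noteq> 0" using g by (auto simp: is_min_poly_def M_def)
    have "ac_eval D x = ac_eval b x * y" unfolding ab[symmetric] using Mx ST by simp
    have dvd: "M dvd R" if "ac_eval R x = 0" for R using that g by (simp add: is_min_poly_def M_def)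
    have Dx: "ac_eval D x \<noteq> 0"
    proof
      assume "ac_eval D x = 0"
      then have "M dvd S" using dvd[of D] by (auto simp: D_def)
      then obtain R where "S = M * R" by (elim dvdE)
      then have "y = 0" using ST Mx by simp
      then show False using False by simp
    qed
    have "D dvd M" by (simp add: D_def)
    then obtain D' where D': "M = D * D'" by (elim dvdE)
    then have "ac_eval D' x = 0" using Mx Dx by simp
    then have "degree M \<le> degree D'" using dvd[of D'] D' M0 by (intro dvd_imp_degree_le) auto
    then have "degree D = 0" using D' M0 by (simp add: degree_mult_eq)
    then obtain c where c: "D = [:c:]" by (elim degree_eq_zeroE)
    then have "c \<noteq> 0" using Dx by auto
    have "to_ac c = ac_eval b x * y" using \<open>ac_eval D x = ac_eval b x * y\<close> c by simp
    then have "y * ac_eval (Polynomial.smult (inverse c) b) x = inverse (to_ac c) * to_ac c"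
      by (simp add: mult_ac)
    also have "\<dots> = 1" using \<open>c \<noteq> 0\<close> by simp
    finally have "inverse y = ac_eval (Polynomial.smult (inverse c) b) x" by (rule inverse_unique)
    then show ?thesis unfolding gen_field_def by blast
  qed
qed

lemma ac_eval_eq_sum:
  assumes "\<And>i. i \<ge> d \<Longrightarrow> poly.coeff S i = 0"
  shows "ac_eval S x = (\<Sum>i<d. to_ac (poly.coeff S i) * x ^ i)"
proof -
  have "ac_eval S x = (\<Sum>i\<le>degree (map_poly to_ac S). to_ac (poly.coeff S i) * x ^ i)"
    by (simp add: ac_eval_def poly_altdef ac_hom.coeff_map_poly_hom)
  also have "\<dots> = (\<Sum>i<d. to_ac (poly.coeff S i) * x ^ i)"
    using assms
    by (intro sum.mono_neutral_cong) (auto simp: not_le coeff_eq_0 not_less)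
  finally show ?thesis .
qed

lemma min_poly_small_degree:
  assumes g: "is_min_poly g x" and S: "\<And>i. i \<ge> degree g \<Longrightarrow> poly.coeff S i = 0" "ac_eval S x = 0"
  shows "S = 0"
proof (rule ccontr)
  assume "S \<noteq> 0"
  moreover have "map_poly to_fract g dvd S" using g S(2) by (simp add: is_min_poly_def)
  ultimately have "degree g \<le> degree S" using dvd_imp_degree_le[of "map_poly to_fract g" S] by simp
  then have "poly.coeff S (degree S) = 0" by (rule S(1))
  then show False using \<open>S \<noteq> 0\<close> by simp
qed

lemma power_eq_min_poly:
  assumes g: "is_min_poly g x"
  shows "inj_on (\<lambda>i. x ^ i) {..<degree g}"
proof (rule inj_onI)
  fix i j assume ij: "i \<in> {..<degree g}" "j \<in> {..<degree g}" "x ^ i = x ^ j"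
  have m: "ac_eval (Polynomial.monom 1 k) x = x ^ k" for k
    by (simp add: ac_eval_def ac_hom.map_poly_hom_monom poly_monom)
  have "Polynomial.monom 1 i - Polynomial.monom 1 j = (0 :: 'a padic poly)"
    using ij by (intro min_poly_small_degree[OF g]) (auto simp: m)
  then have "poly.coeff (Polynomial.monom 1 i - Polynomial.monom 1 j :: 'a padic poly) i = 0" by simp
  then show "i = j" by (simp split: if_splits)
qed

lemma powers_independent:
  assumes g: "is_min_poly g x"
  shows "padic_vs.independent ((\<lambda>i. x ^ i) ` {..<degree g})"
proof
  let ?d = "degree g" and ?B = "(\<lambda>i. x ^ i) ` {..<degree g}"
  assume "padic_vs.dependent ?B"
  then obtain u where u: "\<exists>v\<in>?B. u v \<noteq> 0" "(\<Sum>v\<in>?B. to_ac (u v) * v) = 0"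
    unfolding padic_vs.dependent_finite[OF finite_imageI[OF finite_lessThan]] by blast
  define S where "S = (\<Sum>i<?d. Polynomial.monom (u (x ^ i)) i)"
  have c: "poly.coeff S i = (if i < ?d then u (x ^ i) else 0)" for i
    by (simp add: S_def coeff_sum)
  have "ac_eval S x = (\<Sum>i<?d. to_ac (u (x ^ i)) * x ^ i)"
    by (subst ac_eval_eq_sum[of ?d]) (simp_all add: c)
  also have "\<dots> = (\<Sum>v\<in>?B. to_ac (u v) * v)"
    using power_eq_min_poly[OF g] by (simp add: sum.reindex)
  finally have "S = 0" using u(2) by (intro min_poly_small_degree[OF g]) (auto simp: c)
  then have "u (x ^ i) = 0" if "i < ?d" for i using c[of i] that by simp
  then show False using u(1) by auto
qed

lemma gen_field_span:
  assumes g: "is_min_poly g x"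
  shows "gen_field x = padic_vs.span ((\<lambda>i. x ^ i) ` {..<degree g})"
proof
  let ?B = "(\<lambda>i. x ^ i) ` {..<degree g}"
  show "gen_field x \<subseteq> padic_vs.span ?B"
  proof
    fix y assume "y \<in> gen_field x"
    then obtain S where S: "y = ac_eval S x" by (auto simp: gen_field_def)
    define M where "M = map_poly to_fract g"
    have M: "M \<noteq> 0" "degree M = degree g" "ac_eval M x = 0"
      using g by (auto simp: M_def is_min_poly_def ac_eval_def map_poly_embed_int)
    have "ac_eval (S div M * M + S mod M) x = ac_eval (S mod M) x" by (simp only: ac_eval_simps M(3) mult_zero_right add_0_left)
    then have y: "y = ac_eval (S mod M) x" unfolding S by (simp only: div_mult_mod_eq)
    have "poly.coeff (S mod M) i = 0" if "i \<ge> degree g" for i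
      using degree_mod_less[OF M(1), of S] M(2) that by (cases "S mod M = 0") (auto intro: coeff_eq_0)
    then have sum: "ac_eval (S mod M) x = (\<Sum>i<degree g. to_ac (poly.coeff (S mod M) i) * x ^ i)"
      by (rule ac_eval_eq_sum)
    show "y \<in> padic_vs.span ?B"
      unfolding y sum by (intro padic_vs.span_sum padic_vs.span_scale padic_vs.span_base imageI)
  qed
  show "padic_vs.span ?B \<subseteq> gen_field x"
  proof (rule padic_vs.span_minimal)
    have K: "intermediate_field (gen_field x)" by (rule intermediate_gen_field[OF g])
    have "x ^ i \<in> gen_field x" for i
      unfolding gen_field_def
      by (rule range_eqI[of _ _ "Polynomial.monom 1 i"]) (simp add: ac_eval_def ac_hom.map_poly_hom_monom poly_monom)
    then show "?B \<subseteq> gen_field x" by auto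
    have ac: "to_ac c \<in> gen_field x" for c using K unfolding intermediate_field_def by blast
    show "padic_vs.subspace (gen_field x)"
      unfolding padic_vs.subspace_def using K ac[of 0] ac unfolding intermediate_field_def by simp
  qed
qed

lemma finite_extension_gen_field:
  assumes g: "is_min_poly g x"
  shows "finite_extension (gen_field x)" "ext_degree (gen_field x) = degree g"
proof -
  let ?B = "(\<lambda>i. x ^ i) ` {..<degree g}"
  have "finite ?B" by simp
  then show "finite_extension (gen_field x)"
    unfolding finite_extension_def using intermediate_gen_field[OF g] gen_field_span[OF g] by blast
  have "padic_vs.dim (gen_field x) = card ?B"
    using padic_vs.dim_span_eq_card_independent[OF powers_independent[OF g]] unfolding gen_field_span[OF g] .
  then show "ext_degree (gen_field x) = degree g"
    using card_image[OF power_eq_min_poly[OF g]] by (simp add: ext_degree_def)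
qed

text \<open>An \<open>x\<close> generating a proper subfield is excluded by that very subfield. The
  new elements of different fields are thus fibres of \<open>gen_field\<close>, and summing over
  fields partitions the roots.\<close>

lemma new_elements_iff:
  assumes g: "is_min_poly g x" and K: "intermediate_field K"
  shows "x \<in> new_elements K \<longleftrightarrow> gen_field x = K"
proof
  assume "x \<in> new_elements K"
  then have x: "x \<in> K" "\<not> gen_field x \<subset> K"
    using intermediate_gen_field[OF g] gen_field_self[of x] unfolding new_elements_def by blast+
  then show "gen_field x = K" using gen_field_subset[OF K x(1)] by blast
next
  assume "gen_field x = K"
  then show "x \<in> new_elements K"
    using gen_field_self[of x] gen_field_subset[of _ x] unfolding new_elements_def by blast
qed

section \<open>Counting roots by the fields they generate\<close>

text \<open>Filtering the multiset of roots counts multiplicities and is additive over products for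
  every predicate \<open>P\<close>.\<close>

definition root_count :: "('p :: prime_card padic_closure \<Rightarrow> bool) \<Rightarrow> 'p padic_int poly \<Rightarrow> nat" where
  "root_count P f = size (filter_mset P (proots (map_poly embed_int f)))"

lemma root_count_mult:
  "f \<noteq> 0 \<Longrightarrow> g \<noteq> 0 \<Longrightarrow> root_count P (f * g) = root_count P f + root_count P g"
  by (simp add: root_count_def embed_poly_hom.hom_mult proots_mult)

lemma root_count_1 [simp]: "root_count P 1 = 0"
  by (simp add: root_count_def)

lemma monic_prod_list:
  fixes gs :: "'a :: idom poly list"
  assumes "\<And>g. g \<in> set gs \<Longrightarrow> Polynomial.lead_coeff g = 1"
  shows "Polynomial.lead_coeff (prod_list gs) = 1"
  using assms by (induction gs) (auto simp: Polynomial.lead_coeff_mult)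

lemma root_count_prod_list:
  assumes "\<And>g. g \<in> set gs \<Longrightarrow> Polynomial.lead_coeff g = 1"
  shows "root_count P (prod_list gs) = (\<Sum>g\<leftarrow>gs. root_count P g)"
  using assms
proof (induction gs)
  case (Cons g gs)
  have "Polynomial.lead_coeff g = 1" "Polynomial.lead_coeff (prod_list gs) = 1"
    using Cons.prems monic_prod_list[of gs] by auto
  then have "g \<noteq> 0" "prod_list gs \<noteq> 0" by (metis leading_coeff_0_iff zero_neq_one)+
  then show ?case using Cons by (simp add: root_count_mult)
qed simp

lemma size_proots_alg_closed:
  fixes p :: "'a :: alg_closed_field poly"
  assumes "p \<noteq> 0"
  shows "size (proots p) = degree p"
  using assms
proof (induction "degree p" arbitrary: p)
  case 0
  then obtain c where "p = [:c:]" by (metis degree_eq_zeroE)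
  then show ?case by simp
next
  case (Suc n)
  then have "degree p > 0" by simp
  then obtain z where "poly p z = 0" using alg_closed_imp_poly_has_root by blast
  then have "[:- z, 1:] dvd p" by (simp add: poly_eq_0_iff_dvd)
  then obtain s where s: "p = [:- z, 1:] * s" by (elim dvdE)
  then have "s \<noteq> 0" using Suc.prems by auto
  have "degree p = Suc (degree s)" unfolding s using \<open>s \<noteq> 0\<close> by (subst degree_mult_eq) auto
  then have "size (proots s) = n" using Suc \<open>s \<noteq> 0\<close> by simp
  moreover have "proots p = {#z#} + proots s"
    unfolding s using \<open>s \<noteq> 0\<close> by (subst proots_mult) (simp_all only: proots_linear_factor minus_minus pCons_eq_0_iff one_neq_zero simp_thms)
  ultimately show ?case using Suc by simp
qed

lemma root_count_le_degree: "root_count P f \<le> degree f"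
  unfolding root_count_def
  by (rule order_trans[OF size_filter_mset_lesseq]) (use size_proots_le[of "map_poly embed_int f"] in simp)

lemma root_count_irred_cong:
  assumes g: "monic_irred g" and P: "\<And>x. is_min_poly g x \<Longrightarrow> P x = Q x"
  shows "root_count P g = root_count Q g"
proof -
  have nz: "map_poly embed_int g \<noteq> 0" using g by (auto simp: monic_irred_def)
  have "filter_mset P (proots (map_poly embed_int g)) = filter_mset Q (proots (map_poly embed_int g))"
    using P monic_irred_min_poly[OF g] nz by (intro filter_mset_cong) (auto simp: set_count_proots)
  then show ?thesis by (simp add: root_count_def)
qed

lemma root_count_all: "f \<noteq> 0 \<Longrightarrow> root_count (\<lambda>_. True) f = degree f"
  by (simp add: root_count_def size_proots_alg_closed)

lemma root_count_none: "root_count (\<lambda>_. False) f = 0"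
  by (simp add: root_count_def)

text \<open>All roots of an irreducible polynomial generate fields of the same degree, so either all
  of them count or none.\<close>

lemma root_count_small_degree_irred:
  assumes g: "monic_irred g"
  shows "root_count (\<lambda>x. ext_degree (gen_field x) \<le> r) g = (if degree g \<le> r then degree g else 0)"
proof -
  have "root_count (\<lambda>x. ext_degree (gen_field x) \<le> r) g = root_count (\<lambda>_. degree g \<le> r) g"
    by (rule root_count_irred_cong[OF g]) (simp add: finite_extension_gen_field)
  moreover have "g \<noteq> 0" using g by (auto simp: monic_irred_def)
  ultimately show ?thesis by (simp add: root_count_all root_count_none)
qed

text \<open>Integrality of the eigenvalues is automatic, the monic characteristic polynomial being
  the witness, so only the generated field matters.\<close>

lemma eigenvalue_count_eq:
  fixes A :: "'p :: prime_card padic_int Matrix.mat"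
  assumes A: "A \<in> carrier_mat n n" and K: "intermediate_field K"
  shows "eigenvalue_count (new_integers K) A = root_count (\<lambda>x. gen_field x = K) (char_poly A)"
proof -
  let ?E = "map_poly embed_int (char_poly A)"
  have hom: "char_poly (map_mat embed_int A) = ?E" by (rule embed_hom.char_poly_hom[OF A])
  have c: "map_mat embed_int A \<in> carrier_mat n n" using A by simp
  have monic: "Polynomial.lead_coeff (char_poly A) = 1" using degree_monic_char_poly[OF A] by auto
  then have nz: "?E \<noteq> 0" by auto
  have set: "{x \<in> new_integers K. eigenvalue (map_mat embed_int A) x} = {x \<in> set_mset (proots ?E). gen_field x = K}"
  proof -
    have "x \<in> new_integers K \<longleftrightarrow> gen_field x = K" if x: "poly ?E x = 0" for x
    proof -
      obtain g where g: "is_min_poly g x" using ex_min_poly_dvd[OF monic x] by blast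
      show ?thesis
        using new_elements_iff[OF g K] monic x unfolding new_integers_def integers_of_def new_elements_def by blast
    qed
    then show ?thesis
      using nz by (auto simp: eigenvalue_root_char_poly[OF c] hom set_count_proots)
  qed
  have "eigenvalue_count (new_integers K) A = (\<Sum>x\<in>{x \<in> set_mset (proots ?E). gen_field x = K}. count (proots ?E) x)"
    unfolding eigenvalue_count_def Let_def set hom using nz by simp
  also have "\<dots> = (\<Sum>x\<in>set_mset (filter_mset (\<lambda>x. gen_field x = K) (proots ?E)).
      count (filter_mset (\<lambda>x. gen_field x = K) (proots ?E)) x)"
    by (rule sum.cong) auto
  also have "\<dots> = root_count (\<lambda>x. gen_field x = K) (char_poly A)"
    by (simp only: root_count_def size_multiset_overloaded_eq)
  finally show ?thesis .
qed

section \<open>Hensel factorization and reduction\<close>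

lemma monic_factorization:
  fixes f :: "'p :: prime_card padic_int poly"
  assumes "Polynomial.lead_coeff f = 1"
  shows "\<exists>gs. (\<forall>g\<in>set gs. monic_irred g) \<and> f = prod_list gs"
  using assms
proof (induction "degree f" arbitrary: f rule: less_induct)
  case less
  show ?case
  proof (cases "degree f = 0")
    case True
    then have "f = 1" using less.prems monic_degree_0 by blast
    then show ?thesis by (intro exI[of _ "[]"]) simp
  next
    case False
    show ?thesis
    proof (cases "monic_irred f")
      case True
      then show ?thesis by (intro exI[of _ "[f]"]) simp
    next
      case nirr: False
      then obtain a b where ab: "Polynomial.lead_coeff a = 1" "Polynomial.lead_coeff b = 1" "f = a * b" "a \<noteq> 1" "b \<noteq> 1"
        using False less.prems unfolding monic_irred_def by blast
      have nz: "a \<noteq> 0" "b \<noteq> 0" using ab by auto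
      have "degree a \<noteq> 0" "degree b \<noteq> 0" using ab monic_degree_0 by blast+
      moreover have "degree f = degree a + degree b" using ab nz by (simp add: degree_mult_eq)
      ultimately have "degree a < degree f" "degree b < degree f" by auto
      then obtain gs hs where "\<forall>g\<in>set gs. monic_irred g" "a = prod_list gs"
        "\<forall>g\<in>set hs. monic_irred g" "b = prod_list hs"
        using less.hyps[of a] less.hyps[of b] ab by blast
      then show ?thesis using ab(3) by (intro exI[of _ "gs @ hs"]) auto
    qed
  qed
qed

text \<open>Fixing \<open>0\<close> and \<open>1\<close> makes coefficientwise lifts of monic polynomials monic of the same degree.\<close>

definition lift_coeff :: "'p :: prime_card mod_ring \<Rightarrow> 'p padic_int" where
  "lift_coeff c = (if c = 0 then 0 else if c = 1 then 1 else SOME x. red x = c)"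

lemma red_lift_coeff [simp]: "red (lift_coeff c) = c"
proof -
  have "\<exists>x. red x = c" using surj_red by (metis surjD)
  then show ?thesis using someI_ex[of "\<lambda>x. red x = c"] by (auto simp: lift_coeff_def)
qed

lemma coeff_map_poly_lift: "poly.coeff (map_poly lift_coeff f) i = lift_coeff (poly.coeff f i)"
  by (rule coeff_map_poly) (simp add: lift_coeff_def)

lemma map_poly_red_lift [simp]: "map_poly red (map_poly lift_coeff f) = f"
  by (rule poly_eqI) (simp add: coeff_map_poly coeff_map_poly_lift)

lemma lift_monic: "f \<in> monic_of_degree n \<Longrightarrow> map_poly lift_coeff f \<in> monic_of_degree n"
  by (auto simp: monic_of_degree_iff coeff_map_poly_lift lift_coeff_def)

lemma red_monic: "f \<in> monic_of_degree n \<Longrightarrow> map_poly red f \<in> monic_of_degree n"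
  by (auto simp: monic_of_degree_iff coeff_map_poly)

text \<open>Reducing the first Bezout coefficient modulo \<open>u\<close> bounds \<open>A\<close>;
  the bound on \<open>B\<close> follows by comparing degrees. These bounds keep the corrected
  factors of the Hensel step monic.\<close>

lemma coprime_linear_combination:
  fixes u v w :: "'a :: field_gcd poly"
  assumes u: "u \<in> monic_of_degree a" and v: "v \<in> monic_of_degree b" and cop: "coprime u v"
    and w: "\<And>i. i \<ge> a + b \<Longrightarrow> poly.coeff w i = 0"
  shows "\<exists>A B. v * A + u * B = w \<and> (\<forall>i\<ge>a. poly.coeff A i = 0) \<and> (\<forall>i\<ge>b. poly.coeff B i = 0)"
proof -
  obtain s s' where "s * u + s' * v = gcd u v" using bezout_coefficients_fst_snd by blast
  then have s: "s * u + s' * v = 1" using coprime_imp_gcd_eq_1[OF cop] by (rule trans)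
  define A where "A = (s' * w) mod u"
  have u0: "u \<noteq> 0" "degree u = a" using u by (auto simp: monic_of_degree_def)
  have v0: "degree v = b" using v by (auto simp: monic_of_degree_def)
  have A: "poly.coeff A i = 0" if "i \<ge> a" for i
    using degree_mod_less[OF u0(1), of "s' * w"] u0(2) that unfolding A_def
    by (cases "(s' * w) mod u = 0") (auto intro: coeff_eq_0)
  have "w - v * A = (s * u + s' * v) * w - v * (s' * w - (s' * w) div u * u)"
    unfolding s A_def by (simp add: minus_div_mult_eq_mod)
  also have "\<dots> = u * (s * w + v * ((s' * w) div u))" by (simp add: algebra_simps)
  finally obtain B where B: "w - v * A = u * B" by blast
  have B0: "poly.coeff B i = 0" if i: "i \<ge> b" for i
  proof (cases "B = 0")
    case False
    have "poly.coeff (v * A) i = 0" if "i \<ge> a + b" for i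
    proof (cases "A = 0")
      case False
      have "degree A < a" using A[of "degree A"] False by (cases "degree A < a") auto
      then have "degree (v * A) < i" using degree_mult_le[of v A] v0 that by linarith
      then show ?thesis by (rule coeff_eq_0)
    qed simp
    then have "poly.coeff (u * B) i = 0" if "i \<ge> a + b" for i using w that unfolding B[symmetric] by simp
    moreover have "poly.coeff (u * B) (degree (u * B)) \<noteq> 0" using False u0 by simp
    ultimately have "degree (u * B) < a + b" by (cases "degree (u * B) < a + b") auto
    moreover have "degree (u * B) = a + degree B" using False u0 by (simp add: degree_mult_eq)
    ultimately show ?thesis using i by (intro coeff_eq_0) simp
  qed simp
  have "v * A + u * B = w" unfolding B[symmetric] by simp
  then show ?thesis using A B0 by blast
qed

text \<open>With error \<open>?q ^ k * w\<close>, the factors are corrected by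
  \<open>?q ^ k * A\<close> and \<open>?q ^ k * B\<close> where \<open>v * A + u * B\<close> agrees
  with \<open>w\<close> modulo the prime. The new cross term carries \<open>?q ^ (2 * k)\<close>,
  enough because \<open>k > 0\<close>. As \<open>f\<close> and \<open>u * v\<close> are monic of
  equal degree, \<open>w\<close> has smaller degree.\<close>

lemma hensel_step:
  fixes f :: "'p :: prime_card padic_int poly"
  assumes f: "f \<in> monic_of_degree (a + b)" and cop: "coprime u0 v0" and k: "k > 0"
    and u: "u \<in> monic_of_degree a" "map_poly red u = u0" and v: "v \<in> monic_of_degree b" "map_poly red v = v0"
    and dvd: "of_nat CARD('p) ^ k dvd f - u * v"
  shows "\<exists>u' v'. u' \<in> monic_of_degree a \<and> v' \<in> monic_of_degree b \<and> map_poly red u' = u0 \<and>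
    map_poly red v' = v0 \<and> of_nat CARD('p) ^ Suc k dvd f - u' * v'"
proof -
  let ?q = "of_nat CARD('p) :: 'p padic_int poly"
  obtain w where w: "f - u * v = ?q ^ k * w" using dvd by (elim dvdE)
  have uv: "u * v \<in> monic_of_degree (a + b)" using monic_of_degree_mult u(1) v(1) by blast
  have qk: "?q ^ k = [:of_nat CARD('p) ^ k:]" by (simp add: of_nat_poly poly_const_pow)
  have "poly.coeff (?q ^ k * w) i = 0" if "i \<ge> a + b" for i
    using f uv that unfolding w[symmetric] by (cases "i = a + b") (auto simp: monic_of_degree_iff)
  then have w0: "poly.coeff w i = 0" if "i \<ge> a + b" for i
    using that of_nat_padic_nonzero[of "CARD('p)", where 'p = 'p] unfolding qk by simp
  have u0: "u0 \<in> monic_of_degree a" and v0: "v0 \<in> monic_of_degree b" using u v red_monic by blast+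
  obtain A0 B0 where AB: "v0 * A0 + u0 * B0 = map_poly red w"
      "\<And>i. i \<ge> a \<Longrightarrow> poly.coeff A0 i = 0" "\<And>i. i \<ge> b \<Longrightarrow> poly.coeff B0 i = 0"
    using coprime_linear_combination[OF u0 v0 cop, of "map_poly red w"] w0 by (auto simp: coeff_map_poly)
  define A B where "A = map_poly lift_coeff A0" and "B = map_poly lift_coeff B0"
  have A: "poly.coeff A i = 0" if "i \<ge> a" for i using AB(2)[OF that] by (simp add: A_def coeff_map_poly_lift lift_coeff_def)
  have B: "poly.coeff B i = 0" if "i \<ge> b" for i using AB(3)[OF that] by (simp add: B_def coeff_map_poly_lift lift_coeff_def)
  have redq: "map_poly red (?q ^ k * h) = 0" for h
    unfolding map_poly_red_eq_0_iff using k by (simp add: dvd_mult2 dvd_power)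
  have "map_poly red (w - (v * A + u * B)) = 0"
    by (simp only: red_poly_hom.hom_minus red_poly_hom.hom_add red_poly_hom.hom_mult u(2) v(2) A_def B_def map_poly_red_lift AB(1)) simp
  then have "?q dvd w - (v * A + u * B)" by (simp only: map_poly_red_eq_0_iff)
  then have 1: "?q ^ Suc k dvd ?q ^ k * (w - (v * A + u * B))" by (simp add: mult.commute mult_dvd_mono)
  have 2: "?q ^ Suc k dvd ?q ^ k * ?q ^ k * (A * B)"
    unfolding power_add[symmetric] using k by (intro dvd_mult2 le_imp_power_dvd) simp
  have "f - (u + ?q ^ k * A) * (v + ?q ^ k * B) = (f - u * v) - ?q ^ k * (v * A + u * B) - ?q ^ k * ?q ^ k * (A * B)"
    by (simp add: algebra_simps)
  also have "\<dots> = ?q ^ k * (w - (v * A + u * B)) - ?q ^ k * ?q ^ k * (A * B)" unfolding w by (simp add: algebra_simps)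
  finally have "?q ^ Suc k dvd f - (u + ?q ^ k * A) * (v + ?q ^ k * B)" using dvd_diff[OF 1 2] by simp
  moreover have "u + ?q ^ k * A \<in> monic_of_degree a" "v + ?q ^ k * B \<in> monic_of_degree b"
    using u(1) v(1) A B unfolding qk monic_of_degree_iff by auto
  moreover have "map_poly red (u + ?q ^ k * A) = u0" "map_poly red (v + ?q ^ k * B) = v0"
    by (simp_all only: red_poly_hom.hom_add redq u v add_0_right)
  ultimately show ?thesis by blast
qed

text \<open>There are approximate factorizations at each precision, chosen independently of one
  another; a common subsequence of the two factors converges and its limits multiply to
  \<open>f\<close>.\<close>

lemma hensel:
  fixes f :: "'p :: prime_card padic_int poly"
  assumes f: "f \<in> monic_of_degree (a + b)" and cop: "coprime u0 v0" and red: "map_poly red f = u0 * v0"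
    and u0: "u0 \<in> monic_of_degree a" and v0: "v0 \<in> monic_of_degree b"
  shows "\<exists>u v. u \<in> monic_of_degree a \<and> v \<in> monic_of_degree b \<and> f = u * v"
proof -
  let ?q = "of_nat CARD('p) :: 'p padic_int poly"
  have "\<exists>u v. u \<in> monic_of_degree a \<and> v \<in> monic_of_degree b \<and> map_poly red u = u0 \<and>
    map_poly red v = v0 \<and> ?q ^ Suc k dvd f - u * v" for k
  proof (induction k)
    case 0
    let ?u = "map_poly lift_coeff u0" and ?v = "map_poly lift_coeff v0"
    have "map_poly red (f - ?u * ?v) = 0"
      by (simp only: red_poly_hom.hom_minus red_poly_hom.hom_mult map_poly_red_lift red) simp
    then have "?q ^ Suc 0 dvd f - ?u * ?v" by (simp add: map_poly_red_eq_0_iff)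
    then show ?case using lift_monic[OF u0] lift_monic[OF v0] map_poly_red_lift by blast
  next
    case (Suc k)
    then show ?case using hensel_step[OF f cop, of "Suc k"] by blast
  qed
  then obtain U V where UV: "\<And>k. U k \<in> monic_of_degree a" "\<And>k. V k \<in> monic_of_degree b" "\<And>k. ?q ^ Suc k dvd f - U k * V k"
    by metis
  obtain s u where s: "strict_mono s" "padic_conv CARD('p) (\<lambda>m. U (s m)) u"
    using padic_poly_compact[of U a] UV(1) by (auto simp: monic_of_degree_def)
  obtain s' v where s': "strict_mono s'" "padic_conv CARD('p) (\<lambda>m. V (s (s' m))) v"
    using padic_poly_compact[of "\<lambda>m. V (s m)" b] UV(2) by (auto simp: monic_of_degree_def)
  have u: "padic_conv CARD('p) (\<lambda>m. U (s (s' m))) u" using padic_conv_subseq[OF s(2) s'(1)] .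
  have "f = u * v"
  proof (rule padic_conv_approx[OF padic_conv_const[of _ f] padic_conv_mult[OF u s'(2)]])
    fix k
    have "k \<le> s (s' k)" using seq_suble[OF s(1), of "s' k"] seq_suble[OF s'(1), of k] by simp
    then have "?q ^ k dvd ?q ^ Suc (s (s' k))" by (intro le_imp_power_dvd) simp
    then show "?q ^ k dvd f - U (s (s' k)) * V (s (s' k))" using UV(3) dvd_trans by blast
  qed (rule padic_poly_separated)
  moreover have "u \<in> monic_of_degree a" "v \<in> monic_of_degree b"
    using padic_conv_monic[OF u UV(1)] padic_conv_monic[OF s'(2) UV(2)] by auto
  ultimately show ?thesis by blast
qed

text \<open>If the reduction were \<open>\<phi> ^ k * v\<close> with \<open>\<phi>\<close> not
  dividing \<open>v\<close> and \<open>v\<close> nontrivial, this coprime factorization would lift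
  and split \<open>g\<close>.\<close>

lemma red_irreducible_power:
  fixes g :: "'p :: prime_card padic_int poly"
  assumes g: "monic_irred g"
  obtains \<phi> k where "irreducible \<phi>" "Polynomial.lead_coeff \<phi> = 1" "map_poly red g = \<phi> ^ k"
proof -
  let ?n = "degree g"
  have gm: "g \<in> monic_of_degree ?n" "?n > 0" using g by (auto simp: monic_irred_def monic_of_degree_def)
  have rm: "map_poly red g \<in> monic_of_degree ?n" using gm red_monic by blast
  then have "degree (map_poly red g) > 0" using gm(2) by (simp add: monic_of_degree_def)
  then obtain \<phi> where \<phi>: "irreducible \<phi>" "Polynomial.lead_coeff \<phi> = 1" "\<phi> dvd map_poly red g"
    by (rule monic_irreducible_factor_exists)
  have nz: "map_poly red g \<noteq> 0" using monic_of_degree_nonzero[OF rm] .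
  define k where "k = multiplicity \<phi> (map_poly red g)"
  obtain v where v: "map_poly red g = \<phi> ^ k * v" "\<not> \<phi> dvd v"
    using multiplicity_decompose'[OF nz irreducible_not_unit[OF \<phi>(1)]] unfolding k_def by blast
  have k0: "k > 0" unfolding k_def using power_dvd_iff_multiplicity[OF \<phi>(1) nz, of 1] \<phi>(3) by simp
  have \<phi>k: "\<phi> ^ k \<in> monic_of_degree (degree \<phi> * k)" using \<phi> by (intro monic_of_degree_power) (simp add: monic_of_degree_def)
  have d: "degree \<phi> * k \<le> ?n" "v \<in> monic_of_degree (?n - degree \<phi> * k)"
    using monic_of_degree_cofactor[OF \<phi>k, of v ?n] rm v(1) by auto
  have "coprime \<phi> v" using \<phi>(1) v(2) by (simp add: irreducible_imp_prime_elem prime_elem_imp_coprime)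
  then have cop: "coprime (\<phi> ^ k) v" by simp
  have "g \<in> monic_of_degree (degree \<phi> * k + (?n - degree \<phi> * k))" using gm d by simp
  from hensel[OF this cop v(1) \<phi>k d(2)] obtain a b where
    ab: "a \<in> monic_of_degree (degree \<phi> * k)" "b \<in> monic_of_degree (?n - degree \<phi> * k)" "g = a * b" by blast
  have "a = 1 \<or> b = 1" using g ab unfolding monic_irred_def monic_of_degree_def by blast
  moreover have "a \<noteq> 1" using ab(1) k0 irreducible_degree_pos[OF \<phi>(1)] by (auto simp: monic_of_degree_def)
  ultimately have "?n - degree \<phi> * k = 0" using ab(2) by (auto simp: monic_of_degree_def)
  then have "v = 1" using d(2) by simp
  then show thesis using that \<phi> v(1) by simp
qed

lemma multiplicity_prod_list:
  fixes \<phi> :: "'a :: field_gcd poly"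
  assumes "irreducible \<phi>" "0 \<notin> set gs"
  shows "multiplicity \<phi> (prod_list gs) = (\<Sum>g\<leftarrow>gs. multiplicity \<phi> g)"
  using assms(2)
proof (induction gs)
  case (Cons g gs)
  have "prime_elem \<phi>" using assms(1) by (simp add: irreducible_imp_prime_elem)
  moreover have "prod_list gs \<noteq> 0" using Cons.prems by (simp add: prod_list_zero_iff)
  ultimately show ?case using Cons by (simp add: prime_elem_multiplicity_mult_distrib)
qed simp

lemma sum_list_sum_swap: "(\<Sum>g\<leftarrow>gs. \<Sum>\<phi>\<in>I. h \<phi> g) = (\<Sum>\<phi>\<in>I. \<Sum>g\<leftarrow>gs. h \<phi> g)"
  for h :: "_ \<Rightarrow> _ \<Rightarrow> 'c :: comm_monoid_add"
  by (induction gs) (simp_all add: sum.distrib)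

definition small_degree_roots :: "nat \<Rightarrow> 'p :: prime_card padic_int poly \<Rightarrow> nat" where
  "small_degree_roots r = root_count (\<lambda>x. ext_degree (gen_field x) \<le> r)"

text \<open>Both sides are sums over the irreducible factors \<open>g\<close>. If
  \<open>degree g \<le> r\<close>, all factors of its reduction are small, so \<open>g\<close>
  contributes its degree to both counts. If \<open>degree g > r\<close>, its reduction is
  \<open>\<psi> ^ k\<close>; should \<open>\<psi>\<close> be small, its powers in the reduction of
  \<open>f\<close> have total degree above \<open>r\<close>, so \<open>\<psi>\<close> belongs to the
  bad part.\<close>

lemma small_degree_roots_bounds:
  fixes f :: "'p :: prime_card padic_int poly"
  assumes "Polynomial.lead_coeff f = 1"
  shows "small_degree_roots r f \<le> small_part r (map_poly red f)"
    "small_part r (map_poly red f) \<le> small_degree_roots r f + bad_part r (map_poly red f)"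
proof -
  obtain gs where gs: "\<And>g. g \<in> set gs \<Longrightarrow> monic_irred g" "f = prod_list gs"
    using monic_factorization[OF assms] by blast
  let ?R = "\<lambda>g. if degree g \<le> r then degree g else 0" and ?I = "irr_polys r :: 'p mod_ring poly set"
  have monic: "Polynomial.lead_coeff g = 1" if "g \<in> set gs" for g using gs(1)[OF that] by (simp add: monic_irred_def)
  have rm: "map_poly red g \<in> monic_of_degree (degree g)" if "g \<in> set gs" for g
    using monic[OF that] by (intro red_monic) (simp add: monic_of_degree_def)
  have X: "small_degree_roots r f = (\<Sum>g\<leftarrow>gs. ?R g)"
  proof -
    have "small_degree_roots r f = (\<Sum>g\<leftarrow>gs. root_count (\<lambda>x. ext_degree (gen_field x) \<le> r) g)"
      unfolding small_degree_roots_def gs(2) by (rule root_count_prod_list[OF monic])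
    also have "map (root_count (\<lambda>x. ext_degree (gen_field x) \<le> r)) gs = map ?R gs"
      by (rule map_cong[OF refl]) (rule root_count_small_degree_irred[OF gs(1)])
    finally show ?thesis .
  qed
  have redf: "map_poly red f = prod_list (map (map_poly red) gs)"
    unfolding gs(2) by (rule red_poly_hom.hom_prod_list)
  have nz: "0 \<notin> set (map (map_poly red) gs)"
  proof
    assume "0 \<in> set (map (map_poly red) gs)"
    then obtain g where "g \<in> set gs" "map_poly red g = 0" by auto
    then show False using monic_of_degree_nonzero[OF rm] by blast
  qed
  have mult: "multiplicity \<phi> (map_poly red f) = (\<Sum>g\<leftarrow>gs. multiplicity \<phi> (map_poly red g))" if "\<phi> \<in> ?I" for \<phi>
  proof -
    have "irreducible \<phi>" using that by (simp add: irr_polys_def)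
    then show ?thesis unfolding redf by (subst multiplicity_prod_list[OF _ nz]) (simp_all add: o_def)
  qed
  have part: "(\<Sum>\<phi>\<in>J. degree \<phi> * multiplicity \<phi> (map_poly red f))
      = (\<Sum>g\<leftarrow>gs. \<Sum>\<phi>\<in>J. degree \<phi> * multiplicity \<phi> (map_poly red g))" if "J \<subseteq> ?I" for J
  proof -
    have "(\<Sum>\<phi>\<in>J. degree \<phi> * multiplicity \<phi> (map_poly red f))
        = (\<Sum>\<phi>\<in>J. \<Sum>g\<leftarrow>gs. degree \<phi> * multiplicity \<phi> (map_poly red g))"
      using that mult by (intro sum.cong) (auto simp: sum_list_const_mult)
    then show ?thesis by (simp only: sum_list_sum_swap)
  qed
  have Y: "small_part r (map_poly red f) = (\<Sum>g\<leftarrow>gs. small_part r (map_poly red g))"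
    using part[of ?I] by (simp only: small_part_def)
  show "small_degree_roots r f \<le> small_part r (map_poly red f)"
    unfolding X Y
  proof (rule sum_list_mono)
    fix g assume "g \<in> set gs"
    then show "?R g \<le> small_part r (map_poly red g)"
      using small_part_bounds(2)[OF rm, of g r] by simp
  qed
  let ?bad = "{\<phi> \<in> ?I. r < degree \<phi> * multiplicity \<phi> (map_poly red f)}"
  have "small_part r (map_poly red f) = (\<Sum>\<phi>\<in>?I - ?bad. degree \<phi> * multiplicity \<phi> (map_poly red f))
      + bad_part r (map_poly red f)"
    unfolding small_part_def bad_part_def by (rule sum.subset_diff) auto
  also have "(\<Sum>\<phi>\<in>?I - ?bad. degree \<phi> * multiplicity \<phi> (map_poly red f))
      = (\<Sum>g\<leftarrow>gs. \<Sum>\<phi>\<in>?I - ?bad. degree \<phi> * multiplicity \<phi> (map_poly red g))" by (rule part) auto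
  also have "\<dots> \<le> (\<Sum>g\<leftarrow>gs. ?R g)"
  proof (rule sum_list_mono)
    fix g assume g: "g \<in> set gs"
    show "(\<Sum>\<phi>\<in>?I - ?bad. degree \<phi> * multiplicity \<phi> (map_poly red g)) \<le> ?R g"
    proof (cases "degree g \<le> r")
      case True
      have "(\<Sum>\<phi>\<in>?I - ?bad. degree \<phi> * multiplicity \<phi> (map_poly red g)) \<le> small_part r (map_poly red g)"
        unfolding small_part_def by (rule sum_mono2) auto
      then show ?thesis using small_part_bounds(1)[OF rm[OF g], of r] True by simp
    next
      case False
      obtain \<psi> k where \<psi>: "irreducible \<psi>" "Polynomial.lead_coeff \<psi> = 1" "map_poly red g = \<psi> ^ k"
        using red_irreducible_power[OF gs(1)[OF g]] .
      have "degree \<phi> * multiplicity \<phi> (map_poly red g) = 0" if \<phi>: "\<phi> \<in> ?I - ?bad" for \<phi>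
      proof -
        have irr: "irreducible \<phi>" "Polynomial.lead_coeff \<phi> = 1" using \<phi> by (auto simp: irr_polys_def)
        have m: "multiplicity \<phi> (map_poly red g) = k * (if \<phi> = \<psi> then 1 else 0)"
          unfolding \<psi>(3) multiplicity_monic_irreducible[OF irr \<psi>(1,2), symmetric] using irr \<psi>
          by (intro prime_elem_multiplicity_power_distrib) (auto simp: irreducible_imp_prime_elem)
        show ?thesis
        proof (cases "\<phi> = \<psi>")
          case True
          have "\<psi> \<noteq> 0" using \<psi>(2) by auto
          then have "degree (map_poly red g) = k * degree \<psi>" unfolding \<psi>(3) by (rule Polynomial.degree_power_eq)
          moreover have "degree (map_poly red g) = degree g" using rm[OF g] by (simp add: monic_of_degree_def)
          ultimately have dk: "degree \<phi> * k = degree g" unfolding True by (simp only: mult.commute)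
          have "multiplicity \<phi> (map_poly red g) \<in> set (map (\<lambda>g. multiplicity \<phi> (map_poly red g)) gs)"
            using g by simp
          moreover have "\<phi> \<in> ?I" using \<phi> by blast
          ultimately have "multiplicity \<phi> (map_poly red g) \<le> multiplicity \<phi> (map_poly red f)"
            unfolding mult[OF \<open>\<phi> \<in> ?I\<close>] by (intro member_le_sum_list) simp_all
          then have "degree \<phi> * k \<le> degree \<phi> * multiplicity \<phi> (map_poly red f)" using m True by simp
          then have "r < degree \<phi> * multiplicity \<phi> (map_poly red f)" using dk False by linarith
          then have False using \<phi> \<open>\<phi> \<in> ?I\<close> by blast
          then show ?thesis by blast
        qed (simp add: m)
      qed
      then have "(\<Sum>\<phi>\<in>?I - ?bad. degree \<phi> * multiplicity \<phi> (map_poly red g)) = 0" by (intro sum.neutral ballI)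
      then show ?thesis by (rule ord_eq_le_trans) (rule le0)
    qed
  qed
  finally show "small_part r (map_poly red f) \<le> small_degree_roots r f + bad_part r (map_poly red f)"
    unfolding X by simp
qed

section \<open>Expectations that depend only on the reduction\<close>

lemma uniform_haar: "uniform_on_balls n (haar n)"
  using is_haar_haar is_haar_iff_uniform_on_balls by blast

lemma space_haar [simp]: "space (haar n) = carrier_mat n n"
  using uniform_haar uniform_on_ballsD(2) by blast

lemma sets_haar: "sets (haar n) = sigma_sets (carrier_mat n n) {U. open_mat n U}"
  using uniform_haar uniform_on_ballsD(3) by blast

lemma prob_space_haar: "prob_space (haar n)"
  using uniform_haar uniform_on_ballsD(1) by blast

lemma red_eq_iff_residue: "red (a :: 'p :: prime_card padic_int) = red b \<longleftrightarrow> residue a 1 = residue b 1"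
  unfolding red_def of_int_mod_ring_eq_iff
  using residue_range[of a 1] residue_range[of b 1] by simp

text \<open>The fibres of reduction are the balls of level one, which have equal mass.\<close>

lemma haar_integral_red:
  fixes h :: "'p :: prime_card mod_ring Matrix.mat \<Rightarrow> real"
  shows "(\<lambda>A. h (map_mat red A)) \<in> borel_measurable (haar n)"
    "(LINT A|haar n. h (map_mat red A)) = avg (carrier_mat n n) h"
proof -
  interpret prob_space "haar n" by (rule prob_space_haar)
  let ?C = "carrier_mat n n :: 'p mod_ring Matrix.mat set"
  define L where "L B = cong_ball n (map_mat lift_coeff B) 1" for B :: "'p mod_ring Matrix.mat"
  have mem: "A \<in> L B \<longleftrightarrow> map_mat red A = B" if "A \<in> carrier_mat n n" "B \<in> ?C" for A B
  proof -
    have "A \<in> L B \<longleftrightarrow> (\<forall>i<n. \<forall>j<n. residue (A $$ (i, j)) 1 = residue (lift_coeff (B $$ (i, j))) 1)"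
      using that by (simp add: L_def cong_ball_def)
    also have "\<dots> \<longleftrightarrow> (\<forall>i<n. \<forall>j<n. red (A $$ (i, j)) = red (lift_coeff (B $$ (i, j))))"
      unfolding red_eq_iff_residue by (rule refl)
    also have "\<dots> \<longleftrightarrow> map_mat red A = B" unfolding red_lift_coeff using that by (auto simp: mat_eq_iff)
    finally show ?thesis .
  qed
  have L: "L B \<in> sets (haar n)" for B unfolding L_def by (rule ball_in_sets[OF sets_haar])
  have LI: "L B \<inter> carrier_mat n n = L B" for B using cong_ball_subset unfolding L_def by blast
  have eq: "h (map_mat red A) = (\<Sum>B\<in>?C. h B * indicator (L B) A)" if "A \<in> carrier_mat n n" for A
  proof -
    have "(\<Sum>B\<in>?C. h B * indicator (L B) A) = (\<Sum>B\<in>?C. if B = map_mat red A then h B else 0)"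
      using mem that by (intro sum.cong) (auto simp: indicator_def)
    then show ?thesis using that by simp
  qed
  have meas: "(\<lambda>A. \<Sum>B\<in>?C. h B * indicator (L B) A) \<in> borel_measurable (haar n)"
    using L by measurable
  show "(\<lambda>A. h (map_mat red A)) \<in> borel_measurable (haar n)"
    by (rule measurable_cong[THEN iffD1, OF _ meas]) (simp add: eq)
  have c: "measure (haar n) (L B) = 1 / real (card (balls n 1 :: 'p padic_int Matrix.mat set set))" if "B \<in> ?C" for B
    unfolding L_def using that by (intro measure_cong_ball[OF uniform_haar]) simp
  have int: "(LINT A|haar n. h (map_mat red A)) = (\<Sum>B\<in>?C. h B * measure (haar n) (L B))" for h :: "'p mod_ring Matrix.mat \<Rightarrow> real"
  proof -
    have "(LINT A|haar n. h (map_mat red A)) = (LINT A|haar n. (\<Sum>B\<in>?C. h B * indicator (L B) A))"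
    proof (rule Bochner_Integration.integral_cong)
      fix A assume "A \<in> space (haar n :: 'p padic_int Matrix.mat measure)"
      then have A: "A \<in> carrier_mat n n" by simp
      have "(\<Sum>B\<in>?C. h B * indicator (L B) A) = (\<Sum>B\<in>?C. if B = map_mat red A then h B else 0)"
        using mem A by (intro sum.cong) (auto simp: indicator_def)
      then show "h (map_mat red A) = (\<Sum>B\<in>?C. h B * indicator (L B) A)" using A by simp
    qed simp
    also have "\<dots> = (\<Sum>B\<in>?C. h B * measure (haar n) (L B))"
      using L LI by (subst Bochner_Integration.integral_sum) (auto simp: emeasure_eq_measure)
    finally show ?thesis .
  qed
  \<comment> \<open>Integrating \<open>1\<close> identifies the common mass without counting the
    balls.\<close>
  have "(LINT A|haar n. (1 :: real)) = 1" using prob_space by simp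
  from trans[OF int[of "\<lambda>_. 1", symmetric] this]
  have "1 = (\<Sum>B\<in>?C. 1 * measure (haar n) (L B))" by (rule sym)
  also have "\<dots> = real (card ?C) / real (card (balls n 1 :: 'p padic_int Matrix.mat set set))"
    by (simp add: c)
  finally have "1 / real (card (balls n 1 :: 'p padic_int Matrix.mat set set)) = 1 / real (card ?C)"
    by (simp add: field_simps split: if_splits)
  then show "(LINT A|haar n. h (map_mat red A)) = avg (carrier_mat n n) h"
    unfolding int avg_def by (simp add: c sum_divide_distrib)
qed

lemma haar_integral_char_poly:
  fixes h :: "'p :: prime_card mod_ring poly \<Rightarrow> real"
  shows "(\<lambda>A. h (map_poly red (char_poly A))) \<in> borel_measurable (haar n)"
    "(LINT A|haar n. h (map_poly red (char_poly A))) = mat_avg n h"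
proof -
  have hom: "char_poly (map_mat red A) = map_poly red (char_poly A)"
    if "A \<in> carrier_mat n n" for A :: "'p padic_int Matrix.mat"
    using that by (rule red_hom.char_poly_hom)
  show "(\<lambda>A. h (map_poly red (char_poly A))) \<in> borel_measurable (haar n)"
    by (rule measurable_cong[THEN iffD1, OF _ haar_integral_red(1)[of "\<lambda>B. h (char_poly B)"]]) (simp add: hom)
  have "(LINT A|haar n. h (map_poly red (char_poly A))) = (LINT A|haar n. h (char_poly (map_mat red A)))"
    by (rule Bochner_Integration.integral_cong) (simp_all add: hom)
  then show "(LINT A|haar n. h (map_poly red (char_poly A))) = mat_avg n h"
    unfolding mat_avg_def by (rule trans) (rule haar_integral_red(2))
qed

section \<open>Newton iteration and stability of root fields\<close>

text \<open>Division by the monic \<open>g\<close> stays integral, and the remainder vanishes by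
  minimality.\<close>

lemma min_poly_dvd_int:
  fixes f :: "'p :: prime_card padic_int poly"
  assumes g: "is_min_poly g x" and f: "poly (map_poly embed_int f) x = 0"
  shows "g dvd f"
proof -
  have lc: "poly.coeff g (degree g) = 1" "g \<noteq> 0" using g by (auto simp: is_min_poly_def)
  obtain s r where "pseudo_divmod f g = (s, r)" by (cases "pseudo_divmod f g")
  from pseudo_divmod[OF lc(2) this] have f_eq: "f = g * s + r" and r: "r = 0 \<or> degree r < degree g"
    by (simp_all add: lc)
  have "poly (map_poly embed_int r) x = 0"
    using f g unfolding f_eq is_min_poly_def by (simp add: embed_poly_hom.hom_add embed_poly_hom.hom_mult)
  then have "map_poly to_fract r = 0"
    using r by (intro min_poly_small_degree[OF g]) (auto simp: ac_eval_def map_poly_embed_int coeff_eq_0)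
  then have "r = 0" by simp
  then show ?thesis unfolding f_eq by simp
qed

lemma monic_div_rem:
  fixes f g :: "'a :: idom poly"
  assumes "Polynomial.lead_coeff g = 1"
  obtains s r where "f = g * s + r" "r = 0 \<or> degree r < degree g"
proof -
  have lc: "poly.coeff g (degree g) = 1" "g \<noteq> 0" using assms by auto
  obtain s r where "pseudo_divmod f g = (s, r)" by (cases "pseudo_divmod f g")
  from pseudo_divmod[OF lc(2) this] have "f = g * s + r" "r = 0 \<or> degree r < degree g"
    by (simp_all add: lc)
  then show thesis using that by blast
qed

lemma pcompose_monom_1: "pcompose p (pCons 0 1) = (p :: 'a :: comm_semiring_1 poly)"
  using pcompose_idR[of p] by simp

text \<open>The second-order remainder is a polynomial over the same ring, with no division by
  factorials, so \<open>p\<close>-adic precision is controlled by \<open>D\<close> alone.\<close>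

lemma pcompose_taylor:
  fixes p T D :: "'a :: idom poly"
  shows "\<exists>R. pcompose p (T + D) = pcompose p T + D * pcompose (pderiv p) T + D * D * R"
proof (induction p)
  case 0
  show ?case by (rule exI[of _ 0]) simp
next
  case (pCons a p)
  then obtain R where R: "pcompose p (T + D) = pcompose p T + D * pcompose (pderiv p) T + D * D * R" by blast
  have "pcompose (pCons a p) (T + D) = [:a:] + (T + D) * pcompose p (T + D)" by (simp add: pcompose_pCons)
  also have "\<dots> = pcompose (pCons a p) T + D * pcompose (pderiv (pCons a p)) T
      + D * D * (pcompose (pderiv p) T + (T + D) * R)"
    unfolding R by (simp add: pcompose_pCons pderiv_pCons pcompose_add algebra_simps)
  finally show ?case by blast
qed

lemma pcompose_diff_dvd:
  fixes p T U :: "'a :: idom poly"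
  shows "T - U dvd pcompose p T - pcompose p U"
proof -
  obtain R where "pcompose p (U + (T - U)) = pcompose p U + (T - U) * pcompose (pderiv p) U + (T - U) * (T - U) * R"
    using pcompose_taylor by blast
  then have "pcompose p T = pcompose p U + (T - U) * (pcompose (pderiv p) U + (T - U) * R)"
    by (simp only: diff_add_cancel add_diff_cancel_left' add_diff_eq) (simp add: distrib_left mult.assoc)
  then show ?thesis by (simp only: add_diff_cancel_left' dvd_triv_left)
qed

text \<open>A nonzero scalar is a power of the prime times a unit, seen by taking the primitive part
  of the constant polynomial.\<close>

lemma padic_int_decompose:
  fixes c :: "'p :: prime_card padic_int"
  assumes "c \<noteq> 0"
  obtains e y where "c * y = of_nat CARD('p) ^ e"
proof -
  have "[:c:] \<noteq> 0" using assms by simp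
  then obtain e g where g: "[:c:] = of_nat CARD('p) ^ e * g" "map_poly red g \<noteq> 0" by (rule padic_poly_primitive_part)
  have "of_nat CARD('p) ^ e * g = Polynomial.smult (of_nat CARD('p) ^ e) g" by (simp add: of_nat_poly poly_const_pow)
  then have c: "[:c:] = Polynomial.smult (of_nat CARD('p) ^ e) g" using g(1) by simp
  have q: "(of_nat CARD('p) :: 'p padic_int) ^ e \<noteq> 0" using of_nat_padic_nonzero[of "CARD('p)", where 'p = 'p] by simp
  have "degree [:c:] = degree g" unfolding c by (simp only: degree_smult_eq q if_False)
  then have "degree g = 0" by simp
  then obtain u where u: "g = [:u:]" by (elim degree_eq_zeroE)
  have "red u \<noteq> 0" using g(2) unfolding u by (rule contrapos_nn) (simp add: red_hom.map_poly_pCons_hom)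
  then have "u dvd 1" by (rule padic_unit)
  then obtain y where y: "1 = u * y" by (elim dvdE)
  have "c = of_nat CARD('p) ^ e * u" using c unfolding u by simp
  then have "c * y = of_nat CARD('p) ^ e * (u * y)" by (simp only: mult.assoc)
  then show thesis using that unfolding y[symmetric] by simp
qed

text \<open>In characteristic zero the derivative does not vanish at \<open>x\<close>, hence is
  invertible in the field generated by \<open>x\<close>. Clearing the denominator \<open>c\<close>
  of the inverse and completing \<open>c\<close> to a power of the prime gives \<open>v\<close>; the
  exponent \<open>e\<close> is the precision lost in each Newton correction.\<close>

lemma separable_bezout:
  fixes g :: "'p :: prime_card padic_int poly"
  assumes g: "is_min_poly g x"
  obtains v e where "g dvd v * pderiv g - of_nat CARD('p) ^ e"
proof -
  have irr: "monic_irred g" using min_poly_irred[OF g] .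
  let ?d = "degree g"
  have d: "?d > 0" "poly.coeff g ?d = 1" using irr by (auto simp: monic_irred_def)
  have "poly.coeff (pderiv g) (?d - 1) = of_nat ?d" using d by (simp add: coeff_pderiv)
  then have nz: "pderiv g \<noteq> 0" using of_nat_padic_nonzero[OF d(1), where 'p = 'p] by auto
  let ?S = "map_poly to_fract (pderiv g)"
  have Sx: "ac_eval ?S x \<noteq> 0"
  proof
    assume "ac_eval ?S x = 0"
    then have "?S = 0" using d
      by (intro min_poly_small_degree[OF g]) (auto simp: coeff_pderiv coeff_eq_0)
    then show False using nz by simp
  qed
  have "ac_eval ?S x \<in> gen_field x" by (auto simp: gen_field_def)
  then have "inverse (ac_eval ?S x) \<in> gen_field x"
    using intermediate_gen_field[OF g] unfolding intermediate_field_def by blast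
  then obtain b where b: "inverse (ac_eval ?S x) = ac_eval b x" by (auto simp: gen_field_def)
  obtain c b' where c: "c \<noteq> 0" "Polynomial.smult (to_fract c) b = map_poly to_fract b'"
    using fract_poly_clear_denominators[of b] by blast
  obtain e y where y: "c * y = of_nat CARD('p) ^ e" using padic_int_decompose[OF c(1)] .
  define v where "v = Polynomial.smult y b'"
  have vx: "ac_eval (map_poly to_fract v) x = to_ac (to_fract y) * (to_ac (to_fract c) * ac_eval b x)"
    unfolding v_def to_fract_hom.map_poly_hom_smult c(2)[symmetric] by simp
  have cy: "to_ac (to_fract (c * y)) = to_ac (to_fract c) * to_ac (to_fract y)" by simp
  have "ac_eval (map_poly to_fract v) x * ac_eval ?S x = to_ac (to_fract (c * y)) * (ac_eval b x * ac_eval ?S x)"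
    unfolding vx cy by (simp only: mult_ac)
  also have "ac_eval b x * ac_eval ?S x = 1" unfolding b[symmetric] using Sx by simp
  finally have vS: "ac_eval (map_poly to_fract v) x * ac_eval ?S x = embed_int (of_nat CARD('p) ^ e)"
    unfolding y embed_int_def by simp
  have qe: "(of_nat CARD('p) ^ e :: 'p padic_int poly) = [:of_nat CARD('p) ^ e:]" by (simp add: of_nat_poly poly_const_pow)
  have "poly (map_poly embed_int (v * pderiv g - of_nat CARD('p) ^ e)) x = 0"
    using vS unfolding qe embed_poly_hom.hom_minus embed_poly_hom.hom_mult ac_eval_def map_poly_embed_int[symmetric]
    by (simp add: embed_hom.map_poly_pCons_hom)
  then show thesis using that min_poly_dvd_int[OF g] by blast
qed

text \<open>\<open>g'\<close> is the nearby polynomial, not a derivative. The correction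
  \<open>D = - (q ^ (N - e) * v * y)\<close> cancels the error modulo \<open>g\<close>, as
  \<open>v * pderiv g\<close> is \<open>q ^ e\<close> there. The derivative of \<open>g'\<close> at
  the current point agrees with \<open>pderiv g\<close> modulo \<open>q ^ (e + 1)\<close>, so the
  linear error gains one power. The quadratic one does because \<open>2 * (N - e) > N\<close>, which
  is where \<open>2 * e + 1 \<le> N\<close> enters.\<close>

lemma newton_step:
  fixes g g' :: "'p :: prime_card padic_int poly"
  defines "q \<equiv> of_nat CARD('p) :: 'p padic_int poly"
  assumes v: "g dvd v * pderiv g - q ^ e" and g': "q ^ (2 * e + 1) dvd g' - g" and N: "2 * e + 1 \<le> N"
    and S: "pcompose g' ([:0, 1:] + q ^ (e + 1) * S) = g * z + q ^ N * y"
  shows "\<exists>S z y. pcompose g' ([:0, 1:] + q ^ (e + 1) * S) = g * z + q ^ Suc N * y"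
proof -
  let ?T = "[:0, 1:] + q ^ (e + 1) * S"
  obtain k where "v * pderiv g - q ^ e = g * k" using v by (elim dvdE)
  then have k: "v * pderiv g = g * k + q ^ e" by (simp only: diff_eq_eq)
  obtain w where "g' - g = q ^ (2 * e + 1) * w" using g' by (elim dvdE)
  then have w: "g' = q ^ (2 * e + 1) * w + g" by (simp only: diff_eq_eq)
  have "?T - [:0, 1:] dvd pcompose (pderiv g') ?T - pcompose (pderiv g') [:0, 1:]" by (rule pcompose_diff_dvd)
  then have "q ^ (e + 1) * S dvd pcompose (pderiv g') ?T - pderiv g'" by (simp add: pcompose_monom_1)
  then obtain h1 where "pcompose (pderiv g') ?T - pderiv g' = q ^ (e + 1) * S * h1" by (elim dvdE)
  then have h1: "pcompose (pderiv g') ?T = q ^ (e + 1) * S * h1 + pderiv g'" by (simp only: diff_eq_eq)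
  have qc: "q ^ m = [:of_nat CARD('p) ^ m:]" for m by (simp add: q_def of_nat_poly poly_const_pow)
  have "pderiv (q ^ (2 * e + 1) * w) = q ^ (2 * e + 1) * pderiv w" unfolding qc by (simp add: pderiv_smult)
  then have "pderiv g' = q ^ (2 * e + 1) * pderiv w + pderiv g"
    unfolding w by (simp only: pderiv_add)
  moreover have "q ^ (2 * e + 1) = q ^ (e + 1) * q ^ e" unfolding power_add[symmetric] by (simp add: mult_2)
  ultimately have h: "pcompose (pderiv g') ?T = pderiv g + q ^ (e + 1) * (S * h1 + q ^ e * pderiv w)"
    unfolding h1 by (simp only: distrib_left mult.assoc add_ac)
  define h where "h = S * h1 + q ^ e * pderiv w"
  note h = h[folded h_def]
  obtain m where m: "N = 2 * e + 1 + m" using le_Suc_ex[OF N] by blast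
  define D where "D = - (q ^ (N - e) * v * y)"
  obtain R where R: "pcompose g' (?T + D) = pcompose g' ?T + D * pcompose (pderiv g') ?T + D * D * R"
    using pcompose_taylor by blast
  have Ne: "N - e = e + 1 + m" using m by simp
  have TD: "?T + D = [:0, 1:] + q ^ (e + 1) * (S - q ^ m * v * y)"
    unfolding D_def Ne power_add by (simp add: algebra_simps)
  have "pcompose g' (?T + D) = g * (z - q ^ (N - e) * y * k) + q ^ Suc N * (- (v * y * h) + q ^ m * (v * y) * (v * y) * R)"
  proof -
    have "D * pcompose (pderiv g') ?T = - (q ^ (N - e) * y * (v * pderiv g)) - q ^ (N - e) * q ^ (e + 1) * (v * y * h)"
      unfolding h D_def by (simp add: algebra_simps)
    also have "\<dots> = - (q ^ (N - e) * q ^ e * y) - g * (q ^ (N - e) * y * k) - q ^ (N - e) * q ^ (e + 1) * (v * y * h)"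
      unfolding k by (simp add: algebra_simps)
    also have "q ^ (N - e) * q ^ e = q ^ N" unfolding power_add[symmetric] using N by simp
    also have "q ^ (N - e) * q ^ (e + 1) = q ^ Suc N" unfolding power_add[symmetric] using N by simp
    finally have 1: "D * pcompose (pderiv g') ?T = - (q ^ N * y) - g * (q ^ (N - e) * y * k) - q ^ Suc N * (v * y * h)" .
    have "D * D = q ^ (N - e) * q ^ (N - e) * ((v * y) * (v * y))" unfolding D_def by (simp add: algebra_simps)
    also have "q ^ (N - e) * q ^ (N - e) = q ^ Suc N * q ^ m"
      unfolding power_add[symmetric] by (rule arg_cong[of _ _ "power q"]) (use m in simp)
    finally have 2: "D * D * R = q ^ Suc N * (q ^ m * (v * y) * (v * y) * R)" by (simp only: mult.assoc)
    show ?thesis unfolding R S 1 2 by (simp add: algebra_simps)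
  qed
  then show ?thesis unfolding TD by blast
qed

text \<open>If \<open>x\<close> is a root of \<open>g\<close>, then \<open>T(x)\<close> is a root of \<open>g'\<close> in the field generated by \<open>x\<close>; this takes
  the place of Krasner's lemma.\<close>

lemma newton_root:
  fixes g :: "'p :: prime_card padic_int poly"
  assumes g: "is_min_poly g x"
  shows "\<exists>M. \<forall>g'. of_nat CARD('p) ^ M dvd g' - g \<longrightarrow>
    (\<exists>T. of_nat CARD('p) dvd T - [:0, 1:] \<and> g dvd pcompose g' T)"
proof -
  define q where "q = (of_nat CARD('p) :: 'p padic_int poly)"
  obtain v e where v: "g dvd v * pderiv g - q ^ e" using separable_bezout[OF g] unfolding q_def by blast
  have lc: "Polynomial.lead_coeff g = 1" using g by (simp add: is_min_poly_def)
  let ?T = "\<lambda>S. [:0, 1:] + q ^ (e + 1) * S"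
  have "\<exists>T. q dvd T - [:0, 1:] \<and> g dvd pcompose g' T" if g': "q ^ (2 * e + 1) dvd g' - g" for g'
  proof -
    have approx: "\<exists>S z y. pcompose g' (?T S) = g * z + q ^ N * y" if "2 * e + 1 \<le> N" for N
      using that
    proof (induction N rule: dec_induct)
      case base
      obtain w where "g' - g = q ^ (2 * e + 1) * w" using g' by (elim dvdE)
      then have "pcompose g' (?T 0) = g * 1 + q ^ (2 * e + 1) * w" by (simp add: algebra_simps pcompose_monom_1)
      then show ?case by blast
    next
      case (step N)
      then show ?case using newton_step[of g v e g' N] v g' unfolding q_def by blast
    qed
    \<comment> \<open>Modulo \<open>g\<close> only the remainder of \<open>S\<close> matters, and
      bounded degree is what compactness requires.\<close>
    have approx': "\<exists>S. degree S \<le> degree g \<and> (\<exists>z y. pcompose g' (?T S) = g * z + q ^ N * y)" if N: "2 * e + 1 \<le> N" for N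
    proof -
      obtain S z y where S: "pcompose g' (?T S) = g * z + q ^ N * y" using approx[OF N] by blast
      obtain s r where r: "S = g * s + r" "r = 0 \<or> degree r < degree g" using monic_div_rem[OF lc] .
      have "?T r - ?T S dvd pcompose g' (?T r) - pcompose g' (?T S)" by (rule pcompose_diff_dvd)
      moreover have "?T r - ?T S = g * (- (q ^ (e + 1) * s))" unfolding r(1) by (simp add: algebra_simps)
      then have "g dvd ?T r - ?T S" by (simp only: dvd_triv_left)
      ultimately have "g dvd pcompose g' (?T r) - pcompose g' (?T S)" by (rule dvd_trans[rotated])
      then obtain k where "pcompose g' (?T r) - pcompose g' (?T S) = g * k" by (elim dvdE)
      then have "pcompose g' (?T r) = g * (z + k) + q ^ N * y" using S by (simp add: algebra_simps)
      then show ?thesis using r(2) by (intro exI[of _ r] conjI exI) auto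
    qed
    have "\<forall>N. \<exists>S. degree S \<le> degree g \<and> (\<exists>z y. pcompose g' (?T S) = g * z + q ^ (2 * e + 1 + N) * y)"
      by (rule allI, rule approx') simp
    then obtain S where S: "\<forall>N. degree (S N) \<le> degree g \<and>
        (\<exists>z y. pcompose g' (?T (S N)) = g * z + q ^ (2 * e + 1 + N) * y)"
      by (rule choice[THEN exE])
    then have dS: "degree (S N) \<le> degree g" for N by blast
    obtain s l where l: "strict_mono s" "padic_conv CARD('p) (\<lambda>m. S (s m)) l"
      using padic_poly_compact[of S, OF dS] by blast
    obtain c r where r: "pcompose g' (?T l) = g * c + r" "r = 0 \<or> degree r < degree g" using monic_div_rem[OF lc] .
    \<comment> \<open>A term of the subsequence close to \<open>l\<close> and of high precision
      shows that \<open>r\<close> is a multiple of \<open>g\<close> plus a multiple of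
      \<open>q ^ k\<close>. Both \<open>r\<close> and the reduced second part have degree below
      \<open>degree g\<close>, so they coincide.\<close>
    have "q ^ k dvd r" for k
    proof -
      have "\<forall>\<^sub>F m in sequentially. q ^ k dvd S (s m) - l \<and> m \<ge> k"
        using padic_conv_eventually[OF l(2), of k] eventually_ge_at_top[of k] unfolding q_def by eventually_elim simp
      then obtain m where m: "q ^ k dvd S (s m) - l" "m \<ge> k" by (auto dest: eventually_happens)
      have sm: "k \<le> 2 * e + 1 + s m" using m(2) seq_suble[OF l(1), of m] by simp
      obtain z y where zy: "pcompose g' (?T (S (s m))) = g * z + q ^ (2 * e + 1 + s m) * y" using S by blast
      have "?T l - ?T (S (s m)) dvd pcompose g' (?T l) - pcompose g' (?T (S (s m)))" by (rule pcompose_diff_dvd)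
      moreover have "q ^ k dvd ?T l - ?T (S (s m))"
      proof -
        have "?T l - ?T (S (s m)) = (S (s m) - l) * (- (q ^ (e + 1)))" by (simp add: algebra_simps)
        then show ?thesis using m(1) by (simp only: dvd_mult2)
      qed
      ultimately have "q ^ k dvd pcompose g' (?T l) - pcompose g' (?T (S (s m)))" using dvd_trans by blast
      then obtain a where a: "pcompose g' (?T l) - pcompose g' (?T (S (s m))) = q ^ k * a" by (elim dvdE)
      have "q ^ k dvd q ^ (2 * e + 1 + s m) * y" by (intro dvd_mult2 le_imp_power_dvd sm)
      then obtain b where b: "q ^ (2 * e + 1 + s m) * y = q ^ k * b" by (elim dvdE)
      have ra: "r = g * (z - c) + q ^ k * (a + b)" using a b zy r(1) by (simp add: algebra_simps)
      obtain t y2 where y2: "a + b = g * t + y2" "y2 = 0 \<or> degree y2 < degree g" using monic_div_rem[OF lc] .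
      have "r - q ^ k * y2 = g * (z - c + q ^ k * t)" unfolding ra y2(1) by (simp add: algebra_simps)
      moreover have "r - q ^ k * y2 = 0 \<or> degree (r - q ^ k * y2) < degree g"
      proof -
        have g0: "degree g > 0" using min_poly_irred[OF g] by (simp add: monic_irred_def)
        have "q ^ k = [:of_nat CARD('p) ^ k:]" by (simp add: q_def of_nat_poly poly_const_pow)
        then have "degree (q ^ k * y2) < degree g" using y2(2) g0 by (auto intro: le_less_trans[OF degree_smult_le])
        moreover have "degree r < degree g" using r(2) g0 by auto
        ultimately show ?thesis using degree_diff_less by blast
      qed
      ultimately have "r - q ^ k * y2 = 0"
        using dvd_imp_degree_le[of g "r - q ^ k * y2"] by fastforce
      then have "r = q ^ k * y2" by simp
      then show ?thesis by simp
    qed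
    then have "r = 0" unfolding q_def by (rule padic_poly_separated)
    then have "g dvd pcompose g' (?T l)" using r(1) by simp
    moreover have "q dvd ?T l - [:0, 1:]" by (simp add: dvd_mult2)
    ultimately show ?thesis by blast
  qed
  then show ?thesis unfolding q_def by blast
qed

section \<open>Root fields of nearby polynomials\<close>

abbreviation int_roots :: "'p :: prime_card padic_int poly \<Rightarrow> 'p padic_closure set" where
  "int_roots g \<equiv> {x. poly (map_poly embed_int g) x = 0}"

text \<open>A double root would be a root of the derivative, which is nonzero of smaller degree than
  the minimal polynomial.\<close>

lemma order_irred_root:
  assumes g: "is_min_poly g x"
  shows "Polynomial.order x (map_poly embed_int g) = 1"
proof -
  let ?E = "map_poly embed_int g"
  have irr: "monic_irred g" using min_poly_irred[OF g] .
  have d: "degree g > 0" "poly.coeff g (degree g) = 1" using irr by (auto simp: monic_irred_def)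
  have nz: "?E \<noteq> 0" using d by auto
  have root: "poly ?E x = 0" using g by (simp add: is_min_poly_def)
  have "poly.coeff (pderiv g) (degree g - 1) = of_nat (degree g)" using d by (simp add: coeff_pderiv)
  then have pnz: "pderiv g \<noteq> 0" using of_nat_padic_nonzero[OF d(1), where ?'p = 'a] by auto
  have "\<not> [:- x, 1:] ^ 2 dvd ?E"
  proof
    assume "[:- x, 1:] ^ 2 dvd ?E"
    then obtain h where "?E = [:- x, 1:] ^ 2 * h" by (elim dvdE)
    moreover define L where "L = [:- x, 1:]"
    ultimately have h: "?E = L * (L * h)" by (simp only: power2_eq_square mult.assoc)
    have "poly L x = 0" by (simp add: L_def)
    then have "poly (pderiv ?E) x = 0" unfolding h pderiv_mult[of L] by simp
    then have "poly (map_poly embed_int (pderiv g)) x = 0" by (simp add: embed_hom.map_poly_pderiv)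
    then have "g dvd pderiv g" by (rule min_poly_dvd_int[OF g])
    then have "degree g \<le> degree (pderiv g)" using pnz by (rule dvd_imp_degree_le)
    moreover have "degree (pderiv g) < degree g" using d(1)
      by (intro degree_lessI) (auto simp: coeff_pderiv coeff_eq_0)
    ultimately show False by simp
  qed
  then have "\<not> 2 \<le> Polynomial.order x ?E" using Polynomial.order_divides[of x 2 ?E] by blast
  moreover have "Polynomial.order x ?E \<noteq> 0" using root nz Polynomial.order_root[of ?E x] by blast
  ultimately show ?thesis by simp
qed

lemma finite_int_roots: "g \<noteq> 0 \<Longrightarrow> finite (int_roots g)"
  by (intro poly_roots_finite) simp

lemma root_count_irred_eq_card:
  assumes g: "monic_irred g"
  shows "root_count P g = card {x \<in> int_roots g. P x}"
proof -
  let ?M = "filter_mset P (proots (map_poly embed_int g))"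
  have nz: "map_poly embed_int g \<noteq> 0" using g by (auto simp: monic_irred_def)
  have set: "set_mset ?M = {x \<in> int_roots g. P x}" using nz by auto
  have "root_count P g = (\<Sum>x\<in>set_mset ?M. count ?M x)"
    unfolding root_count_def by (rule size_multiset_overloaded_eq)
  also have "\<dots> = (\<Sum>x\<in>{x \<in> int_roots g. P x}. 1)"
    unfolding set using nz order_irred_root[OF monic_irred_min_poly[OF g]] by (intro sum.cong) auto
  finally show ?thesis by simp
qed

lemma card_int_roots_irred:
  assumes g: "monic_irred g"
  shows "card (int_roots g) = degree g"
proof -
  have "g \<noteq> 0" using g by (auto simp: monic_irred_def)
  then show ?thesis using root_count_irred_eq_card[OF g, of "\<lambda>_. True"] root_count_all[of g] by simp
qed

text \<open>Dimension count: if \<open>x\<close> were outside the field of \<open>y\<close>,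
  adjoining it to the powers of \<open>y\<close> would give too many independent elements in the
  field of \<open>x\<close>.\<close>

lemma gen_field_eq_of_mem:
  assumes g: "is_min_poly g x" and h: "is_min_poly h y" and deg: "degree g = degree h" and y: "y \<in> gen_field x"
  shows "gen_field y = gen_field x"
proof -
  let ?Bx = "(\<lambda>i. x ^ i) ` {..<degree g}" and ?By = "(\<lambda>i. y ^ i) ` {..<degree h}"
  have sub: "gen_field y \<subseteq> gen_field x" using gen_field_subset[OF intermediate_gen_field[OF g] y] .
  have cBx: "card ?Bx = degree g" using card_image[OF power_eq_min_poly[OF g]] by (simp only: card_lessThan)
  have cBy: "card ?By = degree h" using card_image[OF power_eq_min_poly[OF h]] by (simp only: card_lessThan)
  have "x \<in> gen_field y"
  proof (rule ccontr)
    assume "x \<notin> gen_field y"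
    then have nspan: "x \<notin> padic_vs.span ?By" unfolding gen_field_span[OF h] .
    have nin: "x \<notin> ?By" by (rule contra_subsetD[OF padic_vs.span_superset nspan])
    have ind: "padic_vs.independent (insert x ?By)"
      using nspan powers_independent[OF h] by (rule padic_vs.independent_insertI)
    have By: "?By \<subseteq> gen_field y" unfolding gen_field_span[OF h] by (rule padic_vs.span_superset)
    have "insert x ?By \<subseteq> gen_field x" by (rule insert_subsetI[OF gen_field_self order_trans[OF By sub]])
    then have "insert x ?By \<subseteq> padic_vs.span ?Bx" unfolding gen_field_span[OF g] .
    from conjunct2[OF padic_vs.independent_span_bound[OF finite_imageI[OF finite_lessThan] ind this]]
    have "card (insert x ?By) \<le> card ?Bx" .
    moreover have "card (insert x ?By) = Suc (card ?By)" using nin by (intro card_insert_disjoint finite_imageI finite_lessThan)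
    ultimately have "Suc (degree h) \<le> degree g" unfolding cBx cBy by (simp only:)
    then show False using deg by simp
  qed
  then show ?thesis using sub gen_field_subset[OF intermediate_gen_field[OF h]] by blast
qed

text \<open>The explicit precision makes this a property of the whole ball around \<open>g\<close>
  among monic polynomials of its degree, hence preserved under limits. The equality of counts serves
  measurability, the equality of sets of fields countability.\<close>

definition root_stable :: "nat \<Rightarrow> 'p :: prime_card padic_int poly \<Rightarrow> bool" where
  "root_stable M g \<longleftrightarrow> monic_irred g \<and>
     (\<forall>h\<in>monic_of_degree (degree g). of_nat CARD('p) ^ M dvd h - g \<longrightarrow>
        monic_irred h \<and> (\<forall>K. root_count (\<lambda>x. gen_field x = K) h = root_count (\<lambda>x. gen_field x = K) g) \<and>
        gen_field ` int_roots h = gen_field ` int_roots g)"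

text \<open>The composition of \<open>h\<close> with \<open>T\<close> vanishes at \<open>x\<close>,
  so \<open>g\<close> divides it. Modulo the prime \<open>T\<close> is the variable, so the
  reduction of \<open>g\<close> divides that of \<open>h\<close>, and monic polynomials keep their
  degree under reduction.\<close>

lemma min_poly_degree_ge:
  fixes g h T :: "'p :: prime_card padic_int poly"
  assumes g: "is_min_poly g x" and T: "of_nat CARD('p) dvd T - [:0, 1:]"
    and h: "Polynomial.lead_coeff h = 1" "poly (map_poly embed_int h) (poly (map_poly embed_int T) x) = 0"
  shows "degree g \<le> degree h"
proof (rule ccontr)
  assume lt: "\<not> degree g \<le> degree h"
  have "poly (map_poly embed_int (pcompose h T)) x = 0"
    using h(2) by (simp add: embed_hom.map_poly_pcompose poly_pcompose)
  then have "g dvd pcompose h T" by (rule min_poly_dvd_int[OF g])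
  then obtain k where k: "pcompose h T = g * k" by (elim dvdE)
  have "map_poly red T = map_poly red [:0, 1:]" using T by (simp only: map_poly_red_eq_iff)
  then have "map_poly red (pcompose h T) = map_poly red h"
    by (simp add: red_hom.map_poly_pcompose red_hom.map_poly_pCons_hom pcompose_monom_1)
  then have dvd: "map_poly red g dvd map_poly red h" unfolding k by (metis red_poly_hom.hom_mult dvd_triv_left)
  have "h \<in> monic_of_degree (degree h)" "g \<in> monic_of_degree (degree g)"
    using h(1) g by (simp_all add: monic_of_degree_def is_min_poly_def)
  then have "map_poly red h \<in> monic_of_degree (degree h)" "map_poly red g \<in> monic_of_degree (degree g)"
    by (simp_all only: red_monic)
  note m = this
  have "degree (map_poly red g) \<le> degree (map_poly red h)"
    by (rule dvd_imp_degree_le[OF dvd monic_of_degree_nonzero[OF m(1)]])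
  then have "degree g \<le> degree h" using m by (simp add: monic_of_degree_def)
  then show False using lt by simp
qed

text \<open>\<open>\<tau>\<close> sends roots of \<open>g\<close> to roots of \<open>h\<close>. By
  the degree bound \<open>h\<close> is the minimal polynomial of each image, so it is irreducible
  and \<open>\<tau>\<close> preserves generated fields. Injectivity and equal numbers of roots make
  \<open>\<tau>\<close> a bijection between the root sets.\<close>

lemma ex_root_stable:
  fixes g :: "'p :: prime_card padic_int poly"
  assumes g: "monic_irred g"
  shows "\<exists>M. root_stable M g"
proof -
  have gm: "Polynomial.lead_coeff g = 1" "degree g > 0" using g by (auto simp: monic_irred_def)
  have "card (int_roots g) > 0" using card_int_roots_irred[OF g] gm by simp
  then have "int_roots g \<noteq> {}" by (metis card.empty less_irrefl)
  then obtain x0 where x0: "poly (map_poly embed_int g) x0 = 0" by blast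
  obtain M where M: "\<And>h. of_nat CARD('p) ^ M dvd h - g \<Longrightarrow>
      \<exists>T. of_nat CARD('p) dvd T - [:0, 1:] \<and> g dvd pcompose h T"
    using newton_root[OF monic_irred_min_poly[OF g x0]] by blast
  have "monic_irred h \<and> (\<forall>K. root_count (\<lambda>x. gen_field x = K) h = root_count (\<lambda>x. gen_field x = K) g) \<and>
      gen_field ` int_roots h = gen_field ` int_roots g"
    if hm: "h \<in> monic_of_degree (degree g)" and hg: "of_nat CARD('p) ^ M dvd h - g" for h
  proof -
    obtain T where T: "of_nat CARD('p) dvd T - [:0, 1:]" "g dvd pcompose h T" using M[OF hg] by blast
    have hl: "Polynomial.lead_coeff h = 1" "degree h = degree g" using hm by (auto simp: monic_of_degree_def)
    define \<tau> where "\<tau> x = poly (map_poly embed_int T) x" for x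
    have root: "poly (map_poly embed_int h) (\<tau> x) = 0" if "x \<in> int_roots g" for x
    proof -
      obtain k where k: "pcompose h T = g * k" using T(2) by (elim dvdE)
      have "poly (map_poly embed_int (pcompose h T)) x = 0"
        using that unfolding k by (simp add: embed_poly_hom.hom_mult)
      then show ?thesis by (simp add: \<tau>_def embed_hom.map_poly_pcompose poly_pcompose)
    qed
    have min: "is_min_poly h (\<tau> x)" if x: "x \<in> int_roots g" for x
    proof -
      have mx: "is_min_poly g x" using monic_irred_min_poly[OF g] x by simp
      obtain m k where m: "is_min_poly m (\<tau> x)" "h = m * k" "Polynomial.lead_coeff k = 1"
        using ex_min_poly_dvd[OF hl(1) root[OF x]] .
      have ml: "Polynomial.lead_coeff m = 1" "poly (map_poly embed_int m) (\<tau> x) = 0"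
        using m(1) by (auto simp: is_min_poly_def)
      have "degree g \<le> degree m" using min_poly_degree_ge[OF mx T(1) ml(1)] ml(2) by (simp add: \<tau>_def)
      moreover have "degree h = degree m + degree k"
        unfolding m(2) using ml(1) m(3) by (intro degree_mult_eq) auto
      ultimately have "degree k = 0" using hl(2) by simp
      then have "k = 1" using m(3) monic_degree_0 by blast
      then show ?thesis using m by simp
    qed
    have tau_mem: "\<tau> x \<in> gen_field x" for x
      unfolding \<tau>_def gen_field_def map_poly_embed_int ac_eval_def[symmetric] by (rule rangeI)
    have gen: "gen_field (\<tau> x) = gen_field x" if x: "x \<in> int_roots g" for x
      using gen_field_eq_of_mem[OF monic_irred_min_poly[OF g] min[OF x] _ tau_mem] x hl(2) by simp
    have h: "monic_irred h" using min_poly_irred[OF min[of x0]] x0 by simp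
    \<comment> \<open>The polynomial \<open>P\<close> recovering \<open>x\<close> from
      \<open>\<tau> x\<close> has \<open>p\<close>-adic coefficients, so it also recovers the
      conjugate \<open>x'\<close> from \<open>\<tau> x'\<close>.\<close>
    have inj: "inj_on \<tau> (int_roots g)"
    proof (rule inj_onI)
      fix x x' assume x: "x \<in> int_roots g" "x' \<in> int_roots g" "\<tau> x = \<tau> x'"
      have mx: "is_min_poly g x" using monic_irred_min_poly[OF g] x by simp
      have "x \<in> gen_field (\<tau> x)" using gen[OF x(1)] gen_field_self by blast
      then obtain P where P: "x = ac_eval P (\<tau> x)" by (auto simp: gen_field_def)
      define R where "R = pcompose P (map_poly to_fract T) - [:0, 1:]"
      have R: "ac_eval R y = ac_eval P (\<tau> y) - y" for y
        by (simp add: R_def \<tau>_def ac_eval_def[of "pcompose _ _"] ac_hom.map_poly_pcompose poly_pcompose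
            map_poly_embed_int ac_eval_def[symmetric]) (simp add: ac_eval_def ac_hom.map_poly_pCons_hom)
      have "ac_eval R x = 0" using P by (simp add: R)
      then have "map_poly to_fract g dvd R" using mx by (simp add: is_min_poly_def)
      then obtain k where k: "R = map_poly to_fract g * k" by (elim dvdE)
      have "ac_eval (map_poly to_fract g) x' = 0" using x(2) by (simp add: ac_eval_def map_poly_embed_int)
      then have "ac_eval R x' = 0" unfolding k by simp
      then show "x = x'" using P x(3) by (simp add: R)
    qed
    have img: "\<tau> ` int_roots g = int_roots h"
    proof (rule card_subset_eq)
      show "finite (int_roots h)" using hl by (intro finite_int_roots) auto
      show "\<tau> ` int_roots g \<subseteq> int_roots h" using root by blast
      show "card (\<tau> ` int_roots g) = card (int_roots h)"
        using card_image[OF inj] card_int_roots_irred[OF g] card_int_roots_irred[OF h] hl(2) by simp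
    qed
    have "root_count (\<lambda>x. gen_field x = K) h = root_count (\<lambda>x. gen_field x = K) g" for K
    proof -
      have "{y \<in> int_roots h. gen_field y = K} = \<tau> ` {x \<in> int_roots g. gen_field x = K}"
        unfolding img[symmetric] using gen by auto
      moreover have "inj_on \<tau> {x \<in> int_roots g. gen_field x = K}" using inj by (rule inj_on_subset) auto
      ultimately show ?thesis
        by (simp add: root_count_irred_eq_card[OF g] root_count_irred_eq_card[OF h] card_image)
    qed
    moreover have "gen_field ` int_roots h = gen_field ` int_roots g"
      unfolding img[symmetric] image_image using gen by (rule image_cong[OF refl])
    ultimately show ?thesis using h by blast
  qed
  then show ?thesis unfolding root_stable_def using g by blast
qed

lemma root_stable_mono:
  assumes "root_stable M g" "M \<le> N"
  shows "root_stable N g"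
  using assms dvd_trans[OF le_imp_power_dvd[OF assms(2)]] unfolding root_stable_def by blast

text \<open>By the ultrametric inequality every member of a ball is a centre of it.\<close>

lemma root_stable_cong:
  fixes g h :: "'p :: prime_card padic_int poly"
  assumes g: "root_stable M g" and h: "h \<in> monic_of_degree (degree g)" "of_nat CARD('p) ^ M dvd h - g"
  shows "root_stable M h" "root_count (\<lambda>x. gen_field x = K) h = root_count (\<lambda>x. gen_field x = K) g"
proof -
  have deg: "degree h = degree g" using h(1) by (simp add: monic_of_degree_def)
  have trans: "of_nat CARD('p) ^ M dvd f - g" if "of_nat CARD('p) ^ M dvd f - h" for f
    using dvd_add[OF that h(2)] by simp
  show "root_stable M h"
    unfolding root_stable_def
  proof (intro conjI ballI impI allI)
    show "monic_irred h" using g h unfolding root_stable_def by blast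
    fix f assume f: "f \<in> monic_of_degree (degree h)" "of_nat CARD('p) ^ M dvd f - h"
    have f': "f \<in> monic_of_degree (degree g)" "of_nat CARD('p) ^ M dvd f - g" using f trans deg by auto
    show "monic_irred f" using g f' unfolding root_stable_def by blast
    show "root_count (\<lambda>x. gen_field x = K) f = root_count (\<lambda>x. gen_field x = K) h" for K
      using g f' h unfolding root_stable_def by metis
    show "gen_field ` int_roots f = gen_field ` int_roots h"
      using g f' h unfolding root_stable_def by metis
  qed
  show "root_count (\<lambda>x. gen_field x = K) h = root_count (\<lambda>x. gen_field x = K) g"
    using g h unfolding root_stable_def by blast
qed

lemma countable_int_polys: "countable (UNIV :: int poly set)"
proof -
  have "inj (coeffs :: int poly \<Rightarrow> _)" by (rule injI) (simp add: coeffs_eq_iff)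
  then show ?thesis by (rule countableI') 
qed

text \<open>Truncating the coefficients of a minimal polynomial to integer residues at a stable
  precision keeps the set of root fields, and there are only countably many integer
  polynomials.\<close>

lemma countable_gen_fields:
  "countable {gen_field x | x g. is_min_poly g (x :: 'p :: prime_card padic_closure)}"
proof (rule countable_subset)
  let ?R = "\<lambda>f :: int poly. if map_poly of_int f = (0 :: 'p padic_closure poly) then {}
      else {x :: 'p padic_closure. poly (map_poly of_int f) x = 0}"
  let ?S = "\<Union>f\<in>UNIV. gen_field ` ?R f"
  have "finite (?R f)" for f
  proof (cases "map_poly of_int f = (0 :: 'p padic_closure poly)")
    case False
    then show ?thesis unfolding if_not_P[OF False] by (rule poly_roots_finite)
  qed simp
  then have "countable (gen_field ` ?R f)" for f by (intro countable_finite finite_imageI)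
  then show "countable ?S" using countable_int_polys by (intro countable_UN)
  show "{gen_field x | x g. is_min_poly g (x :: 'p padic_closure)} \<subseteq> ?S"
  proof
    fix K :: "'p padic_closure set" assume "K \<in> {gen_field x | x g. is_min_poly g x}"
    then obtain x g where x: "K = gen_field x" "is_min_poly g x" by blast
    obtain M where "root_stable M g" using ex_root_stable[OF min_poly_irred[OF x(2)]] by blast
    \<comment> \<open>The precision must be positive: modulo the zeroth power the residue of
      \<open>1\<close> is \<open>0\<close>, and the truncation would not be monic.\<close>
    then have st: "root_stable (Suc M) g" by (rule root_stable_mono) simp
    define f where "f = map_poly (\<lambda>c. residue c (Suc M)) g"
    have cf: "poly.coeff f i = residue (poly.coeff g i) (Suc M)" for i
      unfolding f_def by (rule coeff_map_poly) (simp add: zero_padic_int.rep_eq)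
    define h where "h = (map_poly of_int f :: 'p padic_int poly)"
    have ch: "poly.coeff h i = of_int (residue (poly.coeff g i) (Suc M))" for i
      by (simp add: h_def coeff_map_poly cf)
    have "1 < int CARD('p)" using prime_card[where 'a = 'p] prime_gt_1_nat by simp
    then have "1 < int CARD('p) ^ Suc M" by (rule one_less_power) simp
    then have one: "residue (1 :: 'p padic_int) (Suc M) = 1"
      unfolding one_padic_int.rep_eq by (rule mod_pos_pos_trivial[OF zero_le_one])
    have "g \<in> monic_of_degree (degree g)" using x(2) by (simp add: is_min_poly_def monic_of_degree_def)
    then have hm: "h \<in> monic_of_degree (degree g)"
      unfolding monic_of_degree_iff ch by (auto simp: one zero_padic_int.rep_eq)
    have "of_nat CARD('p) ^ Suc M dvd h - g"
      unfolding of_nat_power_dvd_poly_iff coeff_diff ch residue_eq_iff_dvd[symmetric] residue_of_int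
      using residue_mod[of "Suc M" "Suc M"] by blast
    then have eq: "gen_field ` int_roots h = gen_field ` int_roots g" using st hm unfolding root_stable_def by blast
    have "K \<in> gen_field ` int_roots g" using x by (auto simp: is_min_poly_def)
    then obtain y where y: "poly (map_poly embed_int h) y = 0" "K = gen_field y" unfolding eq[symmetric] by blast
    have E: "map_poly embed_int h = map_poly of_int f"
      unfolding h_def by (simp add: map_poly_map_poly o_def embed_hom.hom_of_int)
    have "map_poly embed_int h \<noteq> 0" using monic_of_degree_nonzero[OF hm] by simp
    then show "K \<in> ?S" using y unfolding E by auto
  qed
qed

section \<open>Measurability of root counts\<close>

lemma prod_diff_dvd:
  fixes a b :: "_ \<Rightarrow> 'a :: comm_ring_1"
  assumes "\<And>i. i \<in> I \<Longrightarrow> c dvd a i - b i"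
  shows "c dvd (\<Prod>i\<in>I. a i) - (\<Prod>i\<in>I. b i)"
  using assms
proof (induction I rule: infinite_finite_induct)
  case (insert x I)
  have "(\<Prod>i\<in>insert x I. a i) - (\<Prod>i\<in>insert x I. b i)
      = (a x - b x) * (\<Prod>i\<in>I. a i) + b x * ((\<Prod>i\<in>I. a i) - (\<Prod>i\<in>I. b i))"
    using insert.hyps by (simp add: algebra_simps)
  moreover have "c dvd a x - b x" "c dvd (\<Prod>i\<in>I. a i) - (\<Prod>i\<in>I. b i)"
    using insert by auto
  ultimately show ?case by (simp add: dvd_mult dvd_mult2)
qed simp_all

lemma det_diff_dvd:
  fixes A B :: "'a :: comm_ring_1 Matrix.mat"
  assumes A: "A \<in> carrier_mat n n" and B: "B \<in> carrier_mat n n"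
    and dvd: "\<And>i j. i < n \<Longrightarrow> j < n \<Longrightarrow> c dvd A $$ (i, j) - B $$ (i, j)"
  shows "c dvd Determinant.det A - Determinant.det B"
proof -
  have "c dvd signof p * (\<Prod>i = 0..<n. A $$ (i, p i)) - signof p * (\<Prod>i = 0..<n. B $$ (i, p i))"
    if p: "p permutes {0..<n}" for p
  proof -
    have "c dvd (\<Prod>i = 0..<n. A $$ (i, p i)) - (\<Prod>i = 0..<n. B $$ (i, p i))"
    proof (rule prod_diff_dvd)
      fix i assume "i \<in> {0..<n}"
      then have "i < n" "p i < n" using permutes_in_image[OF p, of i] by auto
      then show "c dvd A $$ (i, p i) - B $$ (i, p i)" by (rule dvd)
    qed
    then show ?thesis unfolding right_diff_distrib[symmetric] by (rule dvd_mult)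
  qed
  then show ?thesis
    unfolding det_def'[OF A] det_def'[OF B] sum_subtractf[symmetric] by (intro dvd_sum) blast
qed

lemma char_poly_cong_ball:
  fixes A B :: "'p :: prime_card padic_int Matrix.mat"
  assumes A: "A \<in> carrier_mat n n" and B: "B \<in> cong_ball n A k"
  shows "of_nat CARD('p) ^ k dvd char_poly B - char_poly A"
proof -
  have Bc: "B \<in> carrier_mat n n" using B cong_ball_subset by blast
  show ?thesis
    unfolding char_poly_def
  proof (rule det_diff_dvd)
    show "char_poly_matrix B \<in> carrier_mat n n" "char_poly_matrix A \<in> carrier_mat n n" using A Bc by simp_all
    fix i j assume ij: "i < n" "j < n"
    have "of_nat CARD('p) ^ k dvd A $$ (i, j) - B $$ (i, j)"
      using B ij unfolding residue_eq_iff_dvd[symmetric] cong_ball_def by simp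
    moreover have "char_poly_matrix B $$ (i, j) - char_poly_matrix A $$ (i, j) = [:A $$ (i, j) - B $$ (i, j):]"
      using A Bc ij by (simp add: char_poly_matrix_def)
    ultimately show "of_nat CARD('p) ^ k dvd char_poly_matrix B $$ (i, j) - char_poly_matrix A $$ (i, j)"
      unfolding of_nat_power_dvd_poly_iff by (simp add: coeff_pCons split: nat.splits)
  qed
qed

lemma prod_list_eq_prod_nth: "prod_list xs = (\<Prod>i<length xs. xs ! i)"
  by (induction xs) (simp_all add: prod.lessThan_Suc_shift del: prod.lessThan_Suc)

lemma padic_conv_prod_list:
  assumes "\<And>m. length (f m) = L" "length l = L" "\<And>i. i < L \<Longrightarrow> padic_conv q (\<lambda>m. f m ! i) (l ! i)"
  shows "padic_conv q (\<lambda>m. prod_list (f m)) (prod_list l)"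
proof -
  have eq: "prod_list xs = (\<Prod>i<L. xs ! i)" if "length xs = L" for xs :: "'a list"
    using prod_list_eq_prod_nth[of xs] that by simp
  have "padic_conv q (\<lambda>m. \<Prod>i<k. f m ! i) (\<Prod>i<k. l ! i)" if "k \<le> L" for k
    using that
  proof (induction k)
    case 0
    show ?case using padic_conv_const[of q 1] by simp
  next
    case (Suc k)
    then show ?case using padic_conv_mult[OF Suc.IH assms(3)[of k]] by simp
  qed
  then show ?thesis using assms(1,2) by (simp add: eq)
qed

text \<open>These sets are closed because the degrees \<open>ds\<close> and the precision \<open>M\<close> are fixed. The head of \<open>fs\<close>
  is a cofactor that is not required to be irreducible.\<close>

definition factored_mats where
  "factored_mats K n M s ds = {A \<in> carrier_mat n n. \<exists>fs. map degree fs = ds \<and> fs \<noteq> [] \<and>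
     (\<forall>f\<in>set fs. Polynomial.lead_coeff f = 1) \<and> (\<forall>g\<in>set (tl fs). root_stable M g) \<and>
     char_poly A = prod_list fs \<and> s \<le> (\<Sum>g\<leftarrow>tl fs. root_count (\<lambda>x. gen_field x = K) g)}"

text \<open>Factor lists of nearby matrices have fixed degrees, so a subsequence converges entry by
  entry and its limits multiply to the characteristic polynomial of \<open>A\<close>. Terms within
  precision \<open>M\<close> of the limits hand over stability and root counts.\<close>

lemma factored_mats_closed:
  fixes A :: "'p :: prime_card padic_int Matrix.mat"
  assumes A: "A \<in> carrier_mat n n" and lim: "\<And>k. cong_ball n A k \<inter> factored_mats K n M s ds \<noteq> {}"
  shows "A \<in> factored_mats K n M s ds"
proof -
  let ?c = "root_count (\<lambda>x. gen_field x = K)"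
  let ?Q = "\<lambda>k B fs. B \<in> cong_ball n A k \<and> map degree fs = ds \<and> fs \<noteq> [] \<and>
     (\<forall>f\<in>set fs. Polynomial.lead_coeff f = 1) \<and> (\<forall>g\<in>set (tl fs). root_stable M g) \<and>
     char_poly B = prod_list fs \<and> s \<le> (\<Sum>g\<leftarrow>tl fs. ?c g)"
  have "\<forall>k. \<exists>fs. \<exists>B. ?Q k B fs"
  proof
    fix k
    obtain B where "B \<in> cong_ball n A k" "B \<in> factored_mats K n M s ds" using lim[of k] by blast
    then show "\<exists>fs. \<exists>B. ?Q k B fs" unfolding factored_mats_def by blast
  qed
  then obtain fs where "\<forall>k. \<exists>B. ?Q k B (fs k)" by (rule choice[THEN exE])
  then obtain B where "\<forall>k. ?Q k (B k) (fs k)" by (rule choice[THEN exE])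
  then have B: "\<And>k. B k \<in> cong_ball n A k" and deg: "\<And>k. map degree (fs k) = ds" and ne: "\<And>k. fs k \<noteq> []"
    and monic: "\<And>k f. f \<in> set (fs k) \<Longrightarrow> Polynomial.lead_coeff f = 1"
    and stable: "\<And>k g. g \<in> set (tl (fs k)) \<Longrightarrow> root_stable M g"
    and chi: "\<And>k. char_poly (B k) = prod_list (fs k)" and sum: "\<And>k. s \<le> (\<Sum>g\<leftarrow>tl (fs k). ?c g)"
    by blast+
  define L where "L = length ds"
  have len: "length (fs k) = L" for k using arg_cong[OF deg[of k], of length] by (simp add: L_def)
  have mem: "fs k ! i \<in> monic_of_degree (ds ! i)" if "i < L" for k i
  proof -
    have "degree (fs k ! i) = ds ! i" using arg_cong[OF deg[of k], of "\<lambda>xs. xs ! i"] that len[of k] by simp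
    moreover have "fs k ! i \<in> set (fs k)" using that len[of k] by simp
    then have "Polynomial.lead_coeff (fs k ! i) = 1" by (rule monic)
    ultimately show ?thesis by (simp add: monic_of_degree_def)
  qed
  have "degree g \<le> sum_list ds" if "g \<in> set (fs k)" for g k
  proof -
    have "degree g \<in> set ds" unfolding deg[of k, symmetric] using that by simp
    then show ?thesis by (rule member_le_sum_list) simp
  qed
  then obtain \<sigma> l where \<sigma>: "strict_mono \<sigma>" and l: "length l = L"
    and conv: "\<And>i. i < L \<Longrightarrow> padic_conv CARD('p) (\<lambda>m. fs (\<sigma> m) ! i) (l ! i)"
    using padic_poly_list_compact[of fs L "sum_list ds", OF len] by blast
  have lm: "l ! i \<in> monic_of_degree (ds ! i)" if "i < L" for i
    using padic_conv_monic[OF conv[OF that]] mem[OF that] by blast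
  have "char_poly A = prod_list l"
  proof (rule padic_conv_approx[symmetric])
    show "padic_conv CARD('p) (\<lambda>m. prod_list (fs (\<sigma> m))) (prod_list l)"
      by (rule padic_conv_prod_list[OF len l conv])
    show "padic_conv CARD('p) (\<lambda>_. char_poly A) (char_poly A)" by (rule padic_conv_const)
    fix k
    have "of_nat CARD('p) ^ \<sigma> k dvd char_poly (B (\<sigma> k)) - char_poly A" by (rule char_poly_cong_ball[OF A B])
    then show "of_nat CARD('p) ^ k dvd prod_list (fs (\<sigma> k)) - char_poly A"
      unfolding chi using le_imp_power_dvd[OF seq_suble[OF \<sigma>, of k]] by (rule dvd_trans[rotated])
  qed (rule padic_poly_separated)
  moreover have "map degree l = ds"
    using lm l by (intro nth_equalityI) (auto simp: L_def monic_of_degree_def)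
  moreover have "l \<noteq> []" using l len[of 0] ne[of 0] by auto
  moreover have "\<forall>f\<in>set l. Polynomial.lead_coeff f = 1"
  proof
    fix f assume "f \<in> set l"
    then obtain i where i: "i < L" "f = l ! i" using l by (auto simp: in_set_conv_nth)
    show "Polynomial.lead_coeff f = 1"
      unfolding i(2) using lm[OF i(1)] unfolding monic_of_degree_def by blast
  qed
  moreover have "(\<forall>g\<in>set (tl l). root_stable M g) \<and> s \<le> (\<Sum>g\<leftarrow>tl l. ?c g)"
  proof -
    \<comment> \<open>Finitely many factors, so one index \<open>m\<close> serves all of
      them.\<close>
    have "\<forall>i\<in>{..<L}. \<forall>\<^sub>F m in sequentially. of_nat CARD('p) ^ M dvd fs (\<sigma> m) ! i - l ! i"
      using conv padic_conv_eventually by blast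
    then have "\<forall>\<^sub>F m in sequentially. \<forall>i\<in>{..<L}. of_nat CARD('p) ^ M dvd fs (\<sigma> m) ! i - l ! i"
      by (intro eventually_ball_finite) auto
    then obtain m where m: "\<And>i. i < L \<Longrightarrow> of_nat CARD('p) ^ M dvd fs (\<sigma> m) ! i - l ! i"
      by (auto dest!: eventually_happens'[OF sequentially_bot])
    have near: "root_stable M (l ! Suc i) \<and> ?c (l ! Suc i) = ?c (fs (\<sigma> m) ! Suc i)" if i: "Suc i < L" for i
    proof -
      let ?g = "fs (\<sigma> m) ! Suc i"
      have "?g \<in> set (tl (fs (\<sigma> m)))" using i len[of "\<sigma> m"] by (simp add: nth_tl[symmetric])
      then have st: "root_stable M ?g" by (rule stable)
      have "degree ?g = ds ! Suc i" using mem[OF i, of "\<sigma> m"] by (simp add: monic_of_degree_def)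
      then have 1: "l ! Suc i \<in> monic_of_degree (degree ?g)" using lm[OF i] by simp
      have "of_nat CARD('p) ^ M dvd - (?g - l ! Suc i)" using m[OF i] by (simp only: dvd_minus_iff)
      then have 2: "of_nat CARD('p) ^ M dvd l ! Suc i - ?g" by (simp only: minus_diff_eq)
      show ?thesis using root_stable_cong[OF st 1 2] by blast
    qed
    have tl: "tl l ! i = l ! Suc i" "tl (fs (\<sigma> m)) ! i = fs (\<sigma> m) ! Suc i" if "Suc i < L" for i
      using that l len[of "\<sigma> m"] by (simp_all add: nth_tl)
    have "root_stable M g" if "g \<in> set (tl l)" for g
    proof -
      obtain i where "i < length (tl l)" "g = tl l ! i" using \<open>g \<in> set (tl l)\<close> by (auto simp: in_set_conv_nth)
      then show ?thesis using near[of i] tl(1)[of i] l by simp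
    qed
    moreover have "map ?c (tl l) = map ?c (tl (fs (\<sigma> m)))"
    proof (rule nth_equalityI)
      show "length (map ?c (tl l)) = length (map ?c (tl (fs (\<sigma> m))))" using l len[of "\<sigma> m"] by simp
      fix i assume "i < length (map ?c (tl l))"
      then have i: "Suc i < L" "i < length (tl l)" "i < length (tl (fs (\<sigma> m)))" using l len[of "\<sigma> m"] by auto
      show "map ?c (tl l) ! i = map ?c (tl (fs (\<sigma> m))) ! i"
        using near[OF i(1)] tl[OF i(1)] by (simp only: nth_map[OF i(2)] nth_map[OF i(3)])
    qed
    ultimately show ?thesis using sum[of "\<sigma> m"] by simp
  qed
  ultimately show ?thesis using A unfolding factored_mats_def by blast
qed

lemma factored_mats_sets: "factored_mats K n M s ds \<in> sets (haar n)"
proof -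
  let ?F = "factored_mats K n M s ds"
  have F: "?F \<subseteq> carrier_mat n n" by (auto simp: factored_mats_def)
  have "open_mat n (carrier_mat n n - ?F)"
    unfolding open_mat_def
  proof (intro conjI ballI)
    fix A assume A: "A \<in> carrier_mat n n - ?F"
    then obtain k where "cong_ball n A k \<inter> ?F = {}" using factored_mats_closed by blast
    then show "\<exists>k. cong_ball n A k \<subseteq> carrier_mat n n - ?F" using cong_ball_subset by blast
  qed simp
  then have "carrier_mat n n - ?F \<in> sets (haar n)" unfolding sets_haar by (intro sigma_sets.Basic) simp
  then have "space (haar n) - (carrier_mat n n - ?F) \<in> sets (haar n)" by (rule sets.compl_sets)
  moreover have "space (haar n) - (carrier_mat n n - ?F) = ?F" using F by auto
  ultimately show ?thesis by simp
qed

lemma ex_root_stable_list: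
  assumes "\<And>g. g \<in> set gs \<Longrightarrow> monic_irred g"
  shows "\<exists>M. \<forall>g\<in>set gs. root_stable M g"
  using assms
proof (induction gs)
  case (Cons g gs)
  obtain M where M: "\<forall>g\<in>set gs. root_stable M g" using Cons by auto
  obtain N where N: "root_stable N g" using ex_root_stable Cons.prems by (meson list.set_intros(1))
  have "root_stable (max M N) h" if "h \<in> set (g # gs)" for h
    using that M N root_stable_mono[of M h "max M N"] root_stable_mono[of N h "max M N"] by auto
  then show ?case by blast
qed simp

text \<open>From left to right, all irreducible factors are listed behind the cofactor
  \<open>1\<close>, with a common precision; conversely the roots of the cofactor can only add to
  the count. Both unions range over countable types, which yields measurability.\<close>

lemma root_count_ge_iff:
  "{A \<in> carrier_mat n n. s \<le> root_count (\<lambda>x. gen_field x = K) (char_poly A)} = (\<Union>M. \<Union>ds. factored_mats K n M s ds)"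
proof (intro equalityI subsetI)
  fix A assume "A \<in> {A \<in> carrier_mat n n. s \<le> root_count (\<lambda>x. gen_field x = K) (char_poly A)}"
  then have A: "A \<in> carrier_mat n n" "s \<le> root_count (\<lambda>x. gen_field x = K) (char_poly A)" by auto
  have "Polynomial.lead_coeff (char_poly A) = 1" using degree_monic_char_poly[OF A(1)] by auto
  then obtain gs where gs: "\<forall>g\<in>set gs. monic_irred g" "char_poly A = prod_list gs"
    using monic_factorization by blast
  then have monic: "\<And>g. g \<in> set gs \<Longrightarrow> Polynomial.lead_coeff g = 1" by (simp add: monic_irred_def)
  obtain M where M: "\<forall>g\<in>set gs. root_stable M g" using ex_root_stable_list gs(1) by blast
  have "A \<in> factored_mats K n M s (map degree (1 # gs))"
    unfolding factored_mats_def mem_Collect_eq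
  proof (intro conjI exI)
    have "root_count (\<lambda>x. gen_field x = K) (char_poly A) = (\<Sum>g\<leftarrow>gs. root_count (\<lambda>x. gen_field x = K) g)"
      unfolding gs(2) by (rule root_count_prod_list[OF monic])
    then show "s \<le> (\<Sum>g\<leftarrow>tl (1 # gs). root_count (\<lambda>x. gen_field x = K) g)"
      using A(2) by simp
    show "\<forall>f\<in>set (1 # gs). Polynomial.lead_coeff f = 1" using monic by simp
  qed (use A M gs in auto)
  then show "A \<in> (\<Union>M. \<Union>ds. factored_mats K n M s ds)" by blast
next
  fix A assume "A \<in> (\<Union>M. \<Union>ds. factored_mats K n M s ds)"
  then obtain M fs where A: "A \<in> carrier_mat n n" and fs: "fs \<noteq> []" "\<forall>f\<in>set fs. Polynomial.lead_coeff f = 1"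
    "char_poly A = prod_list fs" "s \<le> (\<Sum>g\<leftarrow>tl fs. root_count (\<lambda>x. gen_field x = K) g)"
    unfolding factored_mats_def by blast
  have "root_count (\<lambda>x. gen_field x = K) (char_poly A) = (\<Sum>g\<leftarrow>fs. root_count (\<lambda>x. gen_field x = K) g)"
    unfolding fs(3) using fs(2) by (intro root_count_prod_list) blast
  also have "\<dots> \<ge> (\<Sum>g\<leftarrow>tl fs. root_count (\<lambda>x. gen_field x = K) g)" using fs(1) by (cases fs) auto
  finally show "A \<in> {A \<in> carrier_mat n n. s \<le> root_count (\<lambda>x. gen_field x = K) (char_poly A)}"
    using A fs(4) by simp
qed

lemma root_count_measurable:
  fixes K :: "'p :: prime_card padic_closure set"
  shows "(\<lambda>A. real (root_count (\<lambda>x. gen_field x = K) (char_poly A))) \<in> borel_measurable (haar n)"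
proof -
  let ?Z = "\<lambda>A. root_count (\<lambda>x. gen_field x = K) (char_poly A)"
  let ?S = "\<lambda>s. {A \<in> carrier_mat n n. s \<le> ?Z A}"
  have S: "?S s \<in> sets (haar n)" for s
  proof -
    have inner: "(\<Union>ds. factored_mats K n M s ds) \<in> sets (haar n)" for M
      by (rule sets.countable_UN'[OF countableI_type]) (rule image_subsetI[OF factored_mats_sets])
    show ?thesis
      unfolding root_count_ge_iff by (rule sets.countable_UN'[OF countableI_type]) (rule image_subsetI[OF inner])
  qed
  have eq: "real (?Z A) = (\<Sum>s\<in>{1..n}. indicator (?S s) A)" if A: "A \<in> space (haar n)" for A
  proof -
    have A': "A \<in> carrier_mat n n" using A by simp
    have "?Z A \<le> n" using root_count_le_degree[of _ "char_poly A"] degree_monic_char_poly[OF A'] by auto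
    then have "{1..n} \<inter> {s. s \<le> ?Z A} = {1..?Z A}" by auto
    then have "real (?Z A) = (\<Sum>s\<in>{1..n}. if s \<le> ?Z A then 1 else 0)" by (simp add: sum.If_cases)
    also have "\<dots> = (\<Sum>s\<in>{1..n}. indicator (?S s) A)"
      using A' by (intro sum.cong) (auto simp: indicator_def)
    finally show ?thesis .
  qed
  have "(\<lambda>A. \<Sum>s\<in>{1..n}. indicator (?S s) A :: real) \<in> borel_measurable (haar n)"
    using S by (intro borel_measurable_sum borel_measurable_indicator)
  then show ?thesis by (rule measurable_cong[THEN iffD2, rotated]) (rule eq)
qed

text \<open>Exchange of expectation and an unordered countable sum of nonnegative terms. The bound
  on \<open>Y\<close> dominates all partial sums, giving integrability and convergence; an infinite
  index set is enumerated to reduce to series.\<close>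

lemma (in prob_space) has_sum_expectation:
  fixes F :: "'k \<Rightarrow> 'a \<Rightarrow> real"
  assumes I: "countable I" and meas: "\<And>i. i \<in> I \<Longrightarrow> F i \<in> borel_measurable M"
    and nonneg: "\<And>i a. i \<in> I \<Longrightarrow> a \<in> space M \<Longrightarrow> 0 \<le> F i a"
    and sum: "\<And>a. a \<in> space M \<Longrightarrow> ((\<lambda>i. F i a) has_sum Y a) I"
    and bound: "\<And>a. a \<in> space M \<Longrightarrow> Y a \<le> C"
  shows "integrable M Y" "((\<lambda>i. expectation (F i)) has_sum expectation Y) I"
proof -
  have part: "(\<Sum>i\<in>J. F i a) \<le> Y a" if "finite J" "J \<subseteq> I" "a \<in> space M" for J a
    using that sum[OF that(3)] nonneg
    by (intro has_sum_mono2[OF has_sum_finite[OF that(1), of "\<lambda>i. F i a"] sum[OF that(3)]]) auto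
  have int: "integrable M (F i)" if "i \<in> I" for i
  proof (rule integrable_const_bound[OF _ meas[OF that]])
    show "AE a in M. norm (F i a) \<le> C"
    proof (rule AE_I2)
      fix a assume "a \<in> space M"
      then show "norm (F i a) \<le> C" using part[of "{i}" a] bound[of a] nonneg that by fastforce
    qed
  qed
  have "integrable M Y \<and> ((\<lambda>i. expectation (F i)) has_sum expectation Y) I"
  proof (cases "finite I")
    case True
    have Y: "Y a = (\<Sum>i\<in>I. F i a)" if "a \<in> space M" for a
      using has_sum_unique[OF sum[OF that] has_sum_finite[OF True]] .
    have "integrable M (\<lambda>a. \<Sum>i\<in>I. F i a)" using int by (rule Bochner_Integration.integrable_sum)
    then have intY: "integrable M Y"
      using Y by (subst Bochner_Integration.integrable_cong[OF refl, where g = "\<lambda>a. \<Sum>i\<in>I. F i a"]) auto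
    from Y have "expectation Y = expectation (\<lambda>a. \<Sum>i\<in>I. F i a)"
      by (intro Bochner_Integration.integral_cong) auto
    also have "\<dots> = (\<Sum>i\<in>I. expectation (F i))" using int by (rule Bochner_Integration.integral_sum)
    finally show ?thesis using has_sum_finite[OF True] intY by simp
  next
    case False
    define e where "e = from_nat_into I"
    have e: "bij_betw e UNIV I" unfolding e_def using bij_betw_from_nat_into[OF I False] .
    have eI: "e n \<in> I" for n using bij_betwE[OF e] by blast
    have inj: "inj e" using e by (simp add: bij_betw_def)
    have sums: "(\<lambda>n. F (e n) a) sums Y a" if "a \<in> space M" for a
    proof -
      have "((\<lambda>n. F (e n) a) has_sum Y a) UNIV"
        using sum[OF that] has_sum_reindex_bij_betw[OF e, of "\<lambda>i. F i a"] by simp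
      then show ?thesis by (rule has_sum_imp_sums)
    qed
    have norm: "norm (F (e n) a) = F (e n) a" if "a \<in> space M" for n a using nonneg[OF eI that] by simp
    have sn: "summable (\<lambda>n. expectation (\<lambda>a. norm (F (e n) a)))"
    proof (rule summableI_nonneg_bounded)
      show "0 \<le> expectation (\<lambda>a. norm (F (e n) a))" for n by (rule integral_nonneg_AE) simp
      fix n
      have "(\<Sum>i<n. expectation (\<lambda>a. norm (F (e i) a))) = (\<Sum>i<n. expectation (F (e i)))"
        using norm by (intro sum.cong refl Bochner_Integration.integral_cong)
      also have "\<dots> = expectation (\<lambda>a. \<Sum>i<n. F (e i) a)"
        using int[OF eI] by (intro Bochner_Integration.integral_sum[symmetric])
      also have "\<dots> \<le> expectation (\<lambda>_. C)"
      proof (rule integral_mono)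
        show "integrable M (\<lambda>a. \<Sum>i<n. F (e i) a)" using int[OF eI] by (intro Bochner_Integration.integrable_sum)
        fix a assume a: "a \<in> space M"
        have "(\<Sum>i<n. F (e i) a) = (\<Sum>i\<in>e ` {..<n}. F i a)"
          using inj by (subst sum.reindex) (auto intro: inj_on_subset)
        also have "\<dots> \<le> Y a" using eI a by (intro part) auto
        finally show "(\<Sum>i<n. F (e i) a) \<le> C" using bound[OF a] by linarith
      qed simp
      finally show "(\<Sum>i<n. expectation (\<lambda>a. norm (F (e i) a))) \<le> C" by (simp add: prob_space)
    qed
    have AE: "AE a in M. summable (\<lambda>n. norm (F (e n) a))"
      using sums norm by (intro AE_I2) (simp add: sums_iff)
    have "integrable M (\<lambda>a. \<Sum>n. F (e n) a)" by (rule integrable_suminf[OF int[OF eI] AE sn])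
    then have intY: "integrable M Y"
      using sums by (subst Bochner_Integration.integrable_cong[OF refl, where g = "\<lambda>a. \<Sum>n. F (e n) a"]) (auto simp: sums_iff)
    have "(\<lambda>n. expectation (F (e n))) sums expectation (\<lambda>a. \<Sum>n. F (e n) a)"
      by (rule sums_integral[OF int[OF eI] AE sn])
    moreover have "expectation (\<lambda>a. \<Sum>n. F (e n) a) = expectation Y"
      using sums by (intro Bochner_Integration.integral_cong) (auto simp: sums_iff)
    ultimately have "(\<lambda>n. expectation (F (e n))) sums expectation Y" by simp
    moreover have "0 \<le> expectation (F (e n))" for n
      using nonneg[OF eI] by (intro integral_nonneg_AE AE_I2)
    ultimately have "((\<lambda>n. expectation (F (e n))) has_sum expectation Y) UNIV"
      by (intro sums_nonneg_imp_has_sum)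
    then show ?thesis using has_sum_reindex_bij_betw[OF e, of "\<lambda>i. expectation (F i)"] intY by simp
  qed
  then show "integrable M Y" "((\<lambda>i. expectation (F i)) has_sum expectation Y) I" by blast+
qed

section \<open>The expected number of eigenvalues of small degree\<close>

lemma size_filter_mset_partition:
  assumes "finite J" "\<And>x. x \<in># A \<Longrightarrow> P x \<longleftrightarrow> f x \<in> J"
  shows "size (filter_mset P A) = (\<Sum>K\<in>J. size (filter_mset (\<lambda>x. f x = K) A))"
  using assms(2)
proof (induction A)
  case (add x A)
  have "(\<Sum>K\<in>J. size (filter_mset (\<lambda>x. f x = K) (add_mset x A)))
      = (\<Sum>K\<in>J. (if f x = K then 1 else 0) + size (filter_mset (\<lambda>x. f x = K) A))"
    by (intro sum.cong) auto
  also have "\<dots> = (if f x \<in> J then 1 else 0) + (\<Sum>K\<in>J. size (filter_mset (\<lambda>x. f x = K) A))"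
    using assms(1) by (simp add: sum.distrib)
  finally show ?case using add by auto
qed simp

abbreviation small_fields :: "nat \<Rightarrow> 'p :: prime_card padic_closure set set" where
  "small_fields r \<equiv> {K. finite_extension K \<and> ext_degree K \<le> r}"

abbreviation primitive_fields :: "'p :: prime_card padic_closure set set" where
  "primitive_fields \<equiv> {gen_field x | x g. is_min_poly g x}"

lemma root_field_cases:
  assumes "Polynomial.lead_coeff f = 1" "x \<in># proots (map_poly embed_int f)"
  shows "gen_field x \<in> primitive_fields"
proof -
  have "map_poly embed_int f \<noteq> 0" using assms(1) by auto
  then have "poly (map_poly embed_int f) x = 0" using assms(2) by simp
  then obtain g where "is_min_poly g x" using ex_min_poly_dvd[OF assms(1)] by blast
  then show ?thesis by blast
qed

lemma root_count_not_primitive: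
  assumes "Polynomial.lead_coeff f = 1" "K \<notin> primitive_fields"
  shows "root_count (\<lambda>x. gen_field x = K) f = 0"
  using root_field_cases[OF assms(1)] assms(2) by (auto simp: root_count_def filter_mset_eq_conv)

text \<open>A fixed polynomial has finitely many roots, so only finitely many fields have a nonzero
  term.\<close>

lemma has_sum_root_count:
  fixes f :: "'p :: prime_card padic_int poly"
  assumes f: "Polynomial.lead_coeff f = 1"
  shows "((\<lambda>K. real (root_count (\<lambda>x. gen_field x = K) f)) has_sum real (small_degree_roots r f))
    (small_fields r \<inter> primitive_fields)"
proof -
  let ?P = "proots (map_poly embed_int f)" and ?I = "small_fields r \<inter> primitive_fields :: 'p padic_closure set set"
  let ?J = "gen_field ` {x \<in> set_mset ?P. ext_degree (gen_field x) \<le> r}"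
  have small: "gen_field x \<in> ?I \<longleftrightarrow> ext_degree (gen_field x) \<le> r" if "x \<in># ?P" for x
  proof -
    have "map_poly embed_int f \<noteq> 0" using f by auto
    then have "poly (map_poly embed_int f) x = 0" using that by simp
    then obtain g where "is_min_poly g x" using ex_min_poly_dvd[OF f] by blast
    then show ?thesis using finite_extension_gen_field(1) by blast
  qed
  have J: "finite ?J" "?J \<subseteq> ?I" using small by auto
  have zero: "root_count (\<lambda>x. gen_field x = K) f = 0" if K: "K \<in> ?I - ?J" for K
  proof -
    have "gen_field x \<noteq> K" if "x \<in># ?P" for x using K that by auto
    then have "filter_mset (\<lambda>x. gen_field x = K) ?P = {#}" by (auto simp: filter_mset_eq_conv)
    then show ?thesis by (simp add: root_count_def)
  qed
  have "small_degree_roots r f = (\<Sum>K\<in>?J. root_count (\<lambda>x. gen_field x = K) f)"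
    unfolding small_degree_roots_def root_count_def
  proof (rule size_filter_mset_partition[OF J(1)])
    fix x assume "x \<in># ?P"
    then show "ext_degree (gen_field x) \<le> r \<longleftrightarrow> gen_field x \<in> ?J" by auto
  qed
  then show ?thesis
    using zero by (intro has_sum_finite_neutralI[OF J]) auto
qed

lemma char_poly_lead: "A \<in> carrier_mat n n \<Longrightarrow> Polynomial.lead_coeff (char_poly A) = 1"
  using char_poly_monic[of A n] unfolding monic_of_degree_def by blast

lemma expected_count_eq:
  assumes "intermediate_field K"
  shows "expected_count n (new_integers K) = (LINT A|haar n. real (root_count (\<lambda>x. gen_field x = K) (char_poly A)))"
  unfolding expected_count_def using eigenvalue_count_eq[OF _ assms]
  by (intro Bochner_Integration.integral_cong) auto

text \<open>Fields not generated by a root of a monic polynomial have expectation \<open>0\<close>,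
  so the sum lives on the countable set of primitive fields, where expectation and sum can be
  exchanged.\<close>

lemma has_sum_expected_count:
  fixes r n defines "Y \<equiv> \<lambda>A :: 'p :: prime_card padic_int Matrix.mat. real (small_degree_roots r (char_poly A))"
  shows "integrable (haar n) Y"
    "((\<lambda>K :: 'p padic_closure set. expected_count n (new_integers K)) has_sum (LINT A|haar n. Y A)) (small_fields r)"
proof -
  interpret prob_space "haar n :: 'p padic_int Matrix.mat measure" by (rule prob_space_haar)
  let ?I = "small_fields r \<inter> primitive_fields :: 'p padic_closure set set"
  let ?F = "\<lambda>K (A :: 'p padic_int Matrix.mat). real (root_count (\<lambda>x. gen_field x = K) (char_poly A))"
  have cnt: "countable ?I" using countable_gen_fields by (rule countable_subset[rotated]) blast
  have sum: "((\<lambda>K. ?F K A) has_sum Y A) ?I" if "A \<in> space (haar n)" for A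
    unfolding Y_def using that by (intro has_sum_root_count char_poly_lead[of A n]) simp
  have bound: "Y A \<le> real n" if "A \<in> space (haar n)" for A
    using that root_count_le_degree[of _ "char_poly A"] degree_monic_char_poly[of A n]
    by (auto simp: Y_def small_degree_roots_def)
  note H = has_sum_expectation[OF cnt root_count_measurable of_nat_0_le_iff sum bound]
  show "integrable (haar n) Y" by (rule H(1))
  have "((\<lambda>K :: 'p padic_closure set. expected_count n (new_integers K)) has_sum expectation Y) (small_fields r)
      \<longleftrightarrow> ((\<lambda>K. expectation (?F K)) has_sum expectation Y) ?I"
  proof (rule has_sum_cong_neutral)
    fix K assume K: "K \<in> small_fields r \<inter> ?I"
    then show "expected_count n (new_integers K) = expectation (?F K)"
      by (intro expected_count_eq) (auto simp: finite_extension_def)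
  next
    fix K assume K: "K \<in> small_fields r - ?I"
    then have "expected_count n (new_integers K) = expectation (?F K)"
      by (intro expected_count_eq) (auto simp: finite_extension_def)
    also have "\<dots> = expectation (\<lambda>_. 0)"
    proof (rule Bochner_Integration.integral_cong)
      fix A :: "'p padic_int Matrix.mat" assume "A \<in> space (haar n)"
      then have "A \<in> carrier_mat n n" by simp
      moreover have "K \<notin> primitive_fields" using K by blast
      ultimately show "?F K A = 0" using root_count_not_primitive[OF char_poly_lead] by simp
    qed simp
    finally show "expected_count n (new_integers K) = 0" by simp
  qed blast
  then show "((\<lambda>K :: 'p padic_closure set. expected_count n (new_integers K)) has_sum expectation Y) (small_fields r)" using H(2) by blast
qed

lemma expected_small_degree_roots_bounds:
  fixes r n
  defines "E \<equiv> LINT A|(haar n :: 'p :: prime_card padic_int Matrix.mat measure). real (small_degree_roots r (char_poly A))"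
  shows "E \<le> mat_avg n (\<lambda>f :: 'p mod_ring poly. real (small_part r f))"
    "mat_avg n (\<lambda>f :: 'p mod_ring poly. real (small_part r f)) - mat_avg n (\<lambda>f :: 'p mod_ring poly. real (bad_part r f)) \<le> E"
proof -
  interpret prob_space "haar n :: 'p padic_int Matrix.mat measure" by (rule prob_space_haar)
  let ?red = "\<lambda>A :: 'p padic_int Matrix.mat. map_poly red (char_poly A)"
  have int: "integrable (haar n) (\<lambda>A. real (h (?red A)))"
    if h: "\<And>f. f \<in> monic_of_degree n \<Longrightarrow> h f \<le> n" for h :: "'p mod_ring poly \<Rightarrow> nat"
  proof (rule integrable_const_bound[OF AE_I2 haar_integral_char_poly(1)])
    fix A :: "'p padic_int Matrix.mat" assume "A \<in> space (haar n)"
    then have "?red A \<in> monic_of_degree n" by (intro red_monic char_poly_monic) simp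
    then show "norm (real (h (?red A))) \<le> real n" using h by simp
  qed
  have le: "bad_part r f \<le> small_part r f" for f :: "'p mod_ring poly"
    unfolding bad_part_def small_part_def by (rule sum_mono2) auto
  have intY: "integrable (haar n) (\<lambda>A. real (small_part r (?red A)))"
    by (rule int) (rule small_part_bounds(1))
  have intD: "integrable (haar n) (\<lambda>A. real (bad_part r (?red A)))"
    by (rule int) (rule order_trans[OF le small_part_bounds(1)])
  have bounds: "small_degree_roots r (char_poly A) \<le> small_part r (?red A)"
    "small_part r (?red A) \<le> small_degree_roots r (char_poly A) + bad_part r (?red A)"
    if "A \<in> space (haar n)" for A
    using that small_degree_roots_bounds[OF char_poly_lead[of A n], of r] by simp_all
  have "E \<le> expectation (\<lambda>A. real (small_part r (?red A)))"
    unfolding E_def using bounds(1) by (intro integral_mono has_sum_expected_count(1) intY) simp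
  then show "E \<le> mat_avg n (\<lambda>f :: 'p mod_ring poly. real (small_part r f))"
    unfolding haar_integral_char_poly(2)[of n "\<lambda>f. real (small_part r f)"] .
  have "expectation (\<lambda>A. real (small_part r (?red A)) - real (bad_part r (?red A))) \<le> E"
    unfolding E_def
  proof (intro integral_mono has_sum_expected_count(1) Bochner_Integration.integrable_diff intY intD)
    fix A :: "'p padic_int Matrix.mat" assume "A \<in> space (haar n)"
    from bounds(2)[OF this]
    show "real (small_part r (?red A)) - real (bad_part r (?red A)) \<le> real (small_degree_roots r (char_poly A))"
      by linarith
  qed
  then show "mat_avg n (\<lambda>f :: 'p mod_ring poly. real (small_part r f)) - mat_avg n (\<lambda>f :: 'p mod_ring poly. real (bad_part r f)) \<le> E"
    unfolding Bochner_Integration.integral_diff[OF intY intD]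
      haar_integral_char_poly(2)[of n "\<lambda>f. real (small_part r f)"] haar_integral_char_poly(2)[of n "\<lambda>f. real (bad_part r f)"] .
qed

theorem theorem1p2:
  fixes r :: "nat \<Rightarrow> nat"
  assumes "\<And>n. n \<ge> 1 \<Longrightarrow> r n > 0"
    and "filterlim (\<lambda>n. real (r n)) at_top sequentially"
    and "filterlim (\<lambda>n. real n - real (r n)) at_top sequentially"
  shows "(\<lambda>n. (\<Sum>\<^sub>\<infinity>K\<in>{K :: 'p :: prime_card padic_closure set.
                        finite_extension K \<and> ext_degree K \<le> r n}.
                  expected_count n (new_integers K))
              - (real (r n)
                 + (\<Sum>m. 1 - q_pochhammer_inf (1 / real CARD('p) ^ Suc m) (1 / real CARD('p)))))
         \<in> o(\<lambda>_. 1)"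
proof -
  let ?X = "\<lambda>n. LINT A|(haar n :: 'p padic_int Matrix.mat measure). real (small_degree_roots (r n) (char_poly A))"
  let ?c = "\<lambda>q :: nat. \<Sum>m. 1 - q_pochhammer_inf (1 / real q ^ Suc m) (1 / real q)"
  have card: "CARD('p mod_ring) = CARD('p)" by simp
  have "(\<lambda>n. ?X n - (real (r n) + ?c CARD('p mod_ring))) \<longlonglongrightarrow> 0"
    using assms(2,3) expected_small_degree_roots_bounds
    by (intro small_part_expectation_limit[where 'a = "'p mod_ring"])
  then have "(\<lambda>n. ?X n - (real (r n) + ?c CARD('p))) \<longlonglongrightarrow> 0" unfolding card .
  \<comment> \<open>\<open>infsum\<close> defaults to \<open>0\<close> for families that are not
    summable; \<open>has_sum_expected_count\<close> ensures that this value is the actual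
    sum.\<close>
  moreover have "(\<Sum>\<^sub>\<infinity>K\<in>(small_fields (r n) :: 'p padic_closure set set). expected_count n (new_integers K)) = ?X n" for n
    by (rule infsumI[OF has_sum_expected_count(2)])
  ultimately show ?thesis by (intro smalloI_tendsto) simp_all
qed

end
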